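(* For every integer $n\ge0$, \[ u_2^nB[n+1,0,0,n]u_1^{n+1}=\sum_{k,l}q^{f(n,k,l)}\begin{bmatrix}n-k\\ l\end{bmatrix}\begin{bmatrix}n+1-l\\ k\end{bmatrix}p_1^{n+1-k}u_2^{2k}u_1^{2l}p_0^{n-l}, \] where the sum runs over all $(k,l)\in\mathbb N^2$ with $k+l\le n$ or $(k,l)=(n+1,0)$, and \[ u_2^nB[n,0,0,n]u_1^{n}=\sum_{k,l}q^{g(n,k,l)}\begin{bmatrix}n-k\\ l\end{bmatrix}\begin{bmatrix}n-l\\ k\end{bmatrix}p_1^{n-k}u_2^{2k}u_1^{2l}p_0^{n-l}, \] where the sum runs over all $(k,l)\in\mathbb N^2$ with $k+l\le n$.
   Context: Let $q$ be an indeterminate. For $k\in\mathbb Z$ let $[k]=\frac{q^k-q^{-k}}{q-q^{-1}}$, $[k]!=[k]\cdots[1]$ for $k\in\mathbb N$. For $m\in\mathbb Z$ and $k\in\mathbb N$ the quantum binomial coefficient is $\begin{bmatrix}m\\k\end{bmatrix}=\frac{[m][m-1]\cdots[m-k+1]}{[k][k-1]\cdots[1]}$ (equal to $1$ for $k=0$). Define $f(n,k,l)=n(n-2)+k(n+2)+l(n+1)-2kl$ and $g(n,k,l)=n(n-3)+k(n+1)+l(n+1)-2kl$. Let $(a_{ij})=\begin{pmatrix}2&-2\\-2&2\end{pmatrix}$ and let $U_q(\mathfrak g)$ be the $\mathbb Q(q)$-algebra generated by $E_i,F_i,K_i^{\pm1}$ ($i=1,2$) with relations $K_1K_2=K_2K_1$,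 $K_iK_i^{-1}=K_i^{-1}K_i=1$, $K_iE_jK_i^{-1}=q^{a_{ij}}E_j$, $K_iF_jK_i^{-1}=q^{-a_{ij}}F_j$, $E_iF_j-F_jE_i=\delta_{ij}\frac{K_i-K_i^{-1}}{q-q^{-1}}$, and, for $\{i,j\}=\{1,2\}$, $E_i^3E_j-[3]E_i^2E_jE_i+[3]E_iE_jE_i^2-E_jE_i^3=0$ and the same with $F$ in place of $E$. Put $E_i^{(k)}=E_i^k/[k]!$, $F_i^{(k)}=F_i^k/[k]!$. Let $T_i$ ($i=1,2$) be Lusztig's automorphism of $U_q(\mathfrak g)$ with $T_i(E_i)=-K_i^{-1}F_i$, $T_i(F_i)=-E_iK_i$, $T_i(E_j)=\sum_{r+s=2}(-1)^rq^{-r}E_i^{(r)}E_jE_i^{(s)}$, $T_i(F_j)=\sum_{r+s=2}(-1)^rq^rF_i^{(s)}F_jF_i^{(r)}$ ($j\neq i$), $T_i(K_j)=K_jK_i^{-a_{ij}}$. Let $v_0=E_1$, $v_1=T_1(E_2)$, $v_2=T_1T_2(E_1)$, $v_3=T_1T_2T_1(E_2)$, and $w=s_1s_2s_1s_2$. By Lusztig, the elements $v_3^{(a_3)}v_2^{(a_2)}v_1^{(a_1)}v_0^{(a_0)}$ ($(a_3,a_2,a_1,a_0)\in\mathbb N^4$, with $x^{(k)}=x^k/[k]!$) form a $\mathbb Q(q)$-basis of a subalgebra $U_q^+(w)$ of $U_q(\mathfrak g)$. Put $u_i=(1-q^{-2})^{-2i}v_i$ for $i=0,1,2,3$, and $p_1=u_3u_1-q^2u_2^2$,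 $p_0=u_2u_0-q^2u_1^2$. For $\mathbf a=(a_3,a_2,a_1,a_0)\in\mathbb N^4$ let $b(\mathbf a)=\sum_{i}\binom{a_i}{2}$, $E[\mathbf a]=q^{b(\mathbf a)}u_3^{a_3}u_2^{a_2}u_1^{a_1}u_0^{a_0}$, and $N(\mathbf a)=(a_3+a_2+a_1+a_0)^2-7a_3-5a_2-3a_1-a_0$. Write $\mathbf a\lhd\mathbf b$ iff $\mathbf b-\mathbf a\in\mathbb N(-1,2,-1,0)+\mathbb N(0,-1,2,-1)$, and $S(\mathbf a)=\{\mathbf b\in\mathbb N^4:\mathbf a\lhd\mathbf b,\ \mathbf b\ne\mathbf a\}$. Let $\sigma$ be the ring anti-automorphism of $U_q^+(w)$ with $\sigma(q)=q^{-1}$ and $\sigma(u_i)=q^{2i}u_i$. The dual canonical basis $\{B[\mathbf a]:\mathbf a\in\mathbb N^4\}$ of $U_q^+(w)$ is the unique basis such that for all $\mathbf a$: $B[\mathbf a]-E[\mathbf a]\in\bigoplus_{\mathbf b\in S(\mathbf a)}q\mathbb Z[q]E[\mathbf b]$ and $\sigma(B[\mathbf a])=q^{-N(\mathbf a)}B[\mathbf a]$. *)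

theory Defs
  imports "HOL-Library.Poly_Mapping" "HOL-Computational_Algebra.Polynomial"
          "HOL-Computational_Algebra.Fraction_Field"
begin

type_synonym K = "rat poly fract"

definition qq :: K where "qq = Fract [:0, 1:] 1"

definition qpow :: "int \<Rightarrow> K" where "qpow m = qq powi m"

definition qint :: "int \<Rightarrow> K" where
  "qint k = (qpow k - qpow (- k)) / (qq - inverse qq)"

definition qfact :: "nat \<Rightarrow> K" where
  "qfact k = (\<Prod>j = 1..k. qint (int j))"

definition qbinom :: "int \<Rightarrow> nat \<Rightarrow> K" where
  "qbinom m k = (\<Prod>j<k. qint (m - int j)) / qfact k"

datatype ix = I1 | I2
datatype gen = GE ix | GF ix | GK ix | GKi ix

datatype word = W "gen list"

instantiation word :: monoid_add
begin
definition zero_word_def: "0 = W []"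
fun plus_word :: "word \<Rightarrow> word \<Rightarrow> word" where
  "plus_word (W xs) (W ys) = W (xs @ ys)"
instance
proof
  fix a b c :: word
  show "a + b + c = a + (b + c)" by (cases a; cases b; cases c) simp
  show "0 + a = a" by (cases a) (simp add: zero_word_def)
  show "a + 0 = a" by (cases a) (simp add: zero_word_def)
qed
end

fun letters :: "word \<Rightarrow> gen list" where "letters (W xs) = xs"

text \<open>Noncommutative polynomials over Q(q) in the generators (multiplication = concatenation).\<close>
type_synonym ncpoly = "word \<Rightarrow>\<^sub>0 K"

definition sc :: "K \<Rightarrow> ncpoly" where "sc c = Poly_Mapping.single 0 c"

definition gn :: "gen \<Rightarrow> ncpoly" where "gn g = Poly_Mapping.single (W [g]) 1"

abbreviation "E i \<equiv> gn (GE i)"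
abbreviation "F i \<equiv> gn (GF i)"
abbreviation "KK i \<equiv> gn (GK i)"
abbreviation "Ki i \<equiv> gn (GKi i)"

definition ext_hom :: "(gen \<Rightarrow> ncpoly) \<Rightarrow> ncpoly \<Rightarrow> ncpoly" where
  "ext_hom \<phi> x = (\<Sum>w\<in>Poly_Mapping.keys x. sc (Poly_Mapping.lookup x w) * prod_list (map \<phi> (letters w)))"

definition cartan :: "ix \<Rightarrow> ix \<Rightarrow> int" where
  "cartan i j = (if i = j then 2 else -2)"

definition other :: "ix \<Rightarrow> ix" where "other i = (if i = I1 then I2 else I1)"

definition serre :: "ncpoly \<Rightarrow> ncpoly \<Rightarrow> ncpoly" where
  "serre x y = x^3 * y - sc (qint 3) * x^2 * y * x + sc (qint 3) * x * y * x^2 - y * x^3"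

definition Rels :: "ncpoly set" where
  "Rels =
     {KK I1 * KK I2 - KK I2 * KK I1}
   \<union> {KK i * Ki i - 1 | i. True} \<union> {Ki i * KK i - 1 | i. True}
   \<union> {KK i * E j * Ki i - sc (qpow (cartan i j)) * E j | i j. True}
   \<union> {KK i * F j * Ki i - sc (qpow (- cartan i j)) * F j | i j. True}
   \<union> {E i * F j - F j * E i
        - (if i = j then sc (inverse (qq - inverse qq)) * (KK i - Ki i) else 0) | i j. True}
   \<union> {serre (E i) (E (other i)) | i. True}
   \<union> {serre (F i) (F (other i)) | i. True}"

inductive_set Ideal :: "ncpoly set" where
  gen: "r \<in> Rels \<Longrightarrow> r \<in> Ideal"
| zero: "0 \<in> Ideal"
| add: "a \<in> Ideal \<Longrightarrow> b \<in> Ideal \<Longrightarrow> a + b \<in> Ideal"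
| mult: "a \<in> Ideal \<Longrightarrow> x * a * y \<in> Ideal"

text \<open>Equality in U_q(g) = free algebra modulo Ideal.\<close>
definition Ueq :: "ncpoly \<Rightarrow> ncpoly \<Rightarrow> bool" (infix "\<simeq>" 50) where
  "x \<simeq> y \<longleftrightarrow> x - y \<in> Ideal"

section \<open>Lusztig's automorphisms T_i (lifted to the free algebra)\<close>

definition dpow :: "ncpoly \<Rightarrow> nat \<Rightarrow> ncpoly" where
  "dpow x k = sc (inverse (qfact k)) * x ^ k"

definition Tgen :: "ix \<Rightarrow> gen \<Rightarrow> ncpoly" where
  "Tgen i g = (case g of
      GE j \<Rightarrow> if j = i then - (Ki i * F i)
              else (\<Sum>r\<le>2. sc ((-1) ^ r * qpow (- int r)) * dpow (E i) r * E j * dpow (E i) (2 - r))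
    | GF j \<Rightarrow> if j = i then - (E i * KK i)
              else (\<Sum>r\<le>2. sc ((-1) ^ r * qpow (int r)) * dpow (F i) (2 - r) * F j * dpow (F i) r)
    | GK j \<Rightarrow> KK j * (if cartan i j \<ge> 0 then Ki i ^ nat (cartan i j) else KK i ^ nat (- cartan i j))
    | GKi j \<Rightarrow> Ki j * (if cartan i j \<ge> 0 then KK i ^ nat (cartan i j) else Ki i ^ nat (- cartan i j)))"

definition T :: "ix \<Rightarrow> ncpoly \<Rightarrow> ncpoly" where "T i = ext_hom (Tgen i)"

definition v :: "nat \<Rightarrow> ncpoly" where
  "v i = (if i = 0 then E I1 else if i = 1 then T I1 (E I2)
          else if i = 2 then T I1 (T I2 (E I1)) else T I1 (T I2 (T I1 (E I2))))"

definition u :: "nat \<Rightarrow> ncpoly" where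
  "u i = sc (inverse ((1 - qpow (-2)) ^ (2 * i))) * v i"

definition p1 :: ncpoly where "p1 = u 3 * u 1 - sc (qpow 2) * u 2 ^ 2"
definition p0 :: ncpoly where "p0 = u 2 * u 0 - sc (qpow 2) * u 1 ^ 2"

type_synonym exps = "nat \<times> nat \<times> nat \<times> nat"   \<comment> \<open>(a3, a2, a1, a0)\<close>

fun bexp :: "exps \<Rightarrow> nat" where
  "bexp (a3, a2, a1, a0) = (a3 choose 2) + (a2 choose 2) + (a1 choose 2) + (a0 choose 2)"

fun Nexp :: "exps \<Rightarrow> int" where
  "Nexp (a3, a2, a1, a0) = int (a3 + a2 + a1 + a0) ^ 2 - 7 * int a3 - 5 * int a2 - 3 * int a1 - int a0"

fun PBW :: "exps \<Rightarrow> ncpoly" where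
  "PBW (a3, a2, a1, a0) = sc (qpow (int (bexp (a3, a2, a1, a0))))
      * u 3 ^ a3 * u 2 ^ a2 * u 1 ^ a1 * u 0 ^ a0"

fun tri :: "exps \<Rightarrow> exps \<Rightarrow> bool" where
  "tri (a3, a2, a1, a0) (b3, b2, b1, b0) \<longleftrightarrow>
     (\<exists>x y :: nat. int b3 = int a3 - int x \<and> int b2 = int a2 + 2 * int x - int y
                  \<and> int b1 = int a1 - int x + 2 * int y \<and> int b0 = int a0 - int y)"

definition Sset :: "exps \<Rightarrow> exps set" where "Sset a = {b. tri a b \<and> b \<noteq> a}"

text \<open>Image under sigma (anti-automorphism, q \<mapsto> q^{-1}, u_i \<mapsto> q^{2i} u_i) of E[b].\<close>
fun sigmaPBW :: "exps \<Rightarrow> ncpoly" where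
  "sigmaPBW (b3, b2, b1, b0) = sc (qpow (- int (bexp (b3, b2, b1, b0))))
      * (sc (qpow 0) * u 0) ^ b0 * (sc (qpow 2) * u 1) ^ b1
      * (sc (qpow 4) * u 2) ^ b2 * (sc (qpow 6) * u 3) ^ b3"

definition evq :: "int poly \<Rightarrow> K" where "evq c = poly (map_poly of_int c) qq"
definition evqbar :: "int poly \<Rightarrow> K" where "evqbar c = poly (map_poly of_int c) (inverse qq)"

text \<open>Coefficient families c with c a = 1, c b \<in> q Z[q] for b \<in> S(a), c b = 0 otherwise,
  such that X = \<Sum> c_b E[b] satisfies sigma(X) = q^{-N(a)} X in U_q(g).\<close>
definition dcb_coeffs :: "exps \<Rightarrow> (exps \<Rightarrow> int poly) \<Rightarrow> bool" where
  "dcb_coeffs a c \<longleftrightarrow>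
     c a = 1 \<and> (\<forall>b\<in>Sset a. coeff (c b) 0 = 0) \<and> (\<forall>b. b \<notin> insert a (Sset a) \<longrightarrow> c b = 0)
     \<and> (\<Sum>b\<in>insert a (Sset a). sc (evqbar (c b)) * sigmaPBW b)
         \<simeq> sc (qpow (- Nexp a)) * (\<Sum>b\<in>insert a (Sset a). sc (evq (c b)) * PBW b)"

text \<open>The dual canonical basis element B[a] (a representative in the free algebra).\<close>
definition B :: "exps \<Rightarrow> ncpoly" where
  "B a = (\<Sum>b\<in>insert a (Sset a). sc (evq ((SOME c. dcb_coeffs a c) b)) * PBW b)"

definition fexp :: "int \<Rightarrow> int \<Rightarrow> int \<Rightarrow> int" where
  "fexp n k l = n * (n - 2) + k * (n + 2) + l * (n + 1) - 2 * k * l"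
definition gexp :: "int \<Rightarrow> int \<Rightarrow> int \<Rightarrow> int" where
  "gexp n k l = n * (n - 3) + k * (n + 1) + l * (n + 1) - 2 * k * l"

end

theory Submission
  imports Defs
begin

text \<open>
  The elements \<open>u\<^sub>0, \<dots>, u\<^sub>3\<close> satisfy six straightening relations, in which \<open>p\<^sub>0\<close> and \<open>p\<^sub>1\<close>
  commute with everything up to powers of \<open>q\<close>.  With \<open>Z = u\<^sub>3 u\<^sub>0 - q\<^sup>2 u\<^sub>2 u\<^sub>1\<close>, Chebyshev
  polynomials in \<open>Z\<close> yield elements \<open>S\<^sub>n\<close> and \<open>X\<^sub>n\<close> with the two-term recursions
  \<open>X\<^sub>n = q\<^sup>n u\<^sub>3 S\<^sub>n - q\<^bsup>5n-2\<^esup> p\<^sub>1 u\<^sub>2 S\<^bsub>n-1\<^esub>\<close> and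
  \<open>S\<^bsub>n+1\<^esub> = q\<^sup>n X\<^sub>n u\<^sub>0 - q\<^bsup>5n-1\<^esup> X\<^bsub>n-1\<^esub> p\<^sub>0 u\<^sub>1\<close>.  Each term maps a PBW monomial to at most
  two PBW monomials, with powers of \<open>q\<close> that keep the lower coefficients in \<open>q\<int>[q]\<close>; so \<open>S\<^sub>n\<close> and
  \<open>X\<^sub>n\<close> are dual canonical, and the two formulas follow from the same recursions by two forms of the
  \<open>q\<close>-Pascal rule.

  Uniqueness of the dual canonical element needs linear independence of PBW monomials in the full
  quantum group.  After multiplication by \<open>u\<^sub>2\<^sup>n\<close> and \<open>u\<^sub>1\<^sup>n\<close> these become triangular in the monomials
  \<open>p\<^sub>1\<^sup>i u\<^sub>2\<^sup>j u\<^sub>1\<^sup>k p\<^sub>0\<^sup>l\<close>, which commutation with \<open>u\<^sub>1\<close> and \<open>u\<^sub>2\<close> separates; that none of them vanishes is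
  read off from a tensor product of two evaluation modules, written in an eigenbasis of the imaginary
  root vector.
\<close>

section \<open>Scalars: quantum integers and binomials\<close>

text \<open>The anti-automorphism \<open>sigma\<close> is never constructed. The identities for S_n
  and X_n are derived in an arbitrary ring with central powers \<open>qp m\<close>, and then read in
  a ring of pairs whose second factor multiplies in reverse order and where \<open>qp m\<close> is
  (q^m, q^-m). With u_k paired to q^(2k) u_k, the second component of every such computation is the
  \<open>sigma\<close>-image of the first, so one lattice argument delivers the coefficients in q
  Z[q] together with their conjugates.

  The six relations are proved for iterated commutators: with d = E_2 E_1 - q^-2 E_1 E_2, each
  v_(k+1) turns out to be [d, v_k] / [2], because the q-commutator inside the braid formula is d
  every time. The derivations [d, .] and [h, .], with h built from the next imaginary root vector,
  then spread the two Serre relations over all root vectors.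

  No cancellation law is at hand in the quotient. Eliminations therefore multiply by further powers
  of u_1 and u_2, and the only input left is that no single monomial vanishes; one vector that no
  monomial kills provides this.\<close>

lemma qq_power: "qq ^ n = Fract (monom 1 n) 1"
proof (induction n)
  case 0 show ?case by (simp add: One_fract_def monom_0 one_pCons)
next
  case (Suc n)
  have "monom 1 (Suc n) = [:0, 1:] * monom (1::rat) n"
    by (simp add: monom_Suc)
  then show ?case unfolding power_Suc Suc by (simp add: qq_def)
qed

lemma qq_nz: "qq \<noteq> 0"
  unfolding qq_def by (metis pCons_eq_0_iff Fract_of_nat_eq eq_fract(1) mult.right_neutral mult_zero_left one_neq_zero Zero_fract_def)

text \<open>Powers of the indeterminate are told apart by degree. Hence \<open>qpow\<close> is
  injective and every quantum integer except [0] is invertible.\<close>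

lemma qq_powi_eq_1: "qq powi m = 1 \<Longrightarrow> m = 0"
proof (rule ccontr)
  assume m: "qq powi m = 1" "m \<noteq> 0"
  have n: False if "qq ^ n = 1" "n > 0" for n
  proof -
    have "Fract (monom 1 n) 1 = Fract (1::rat poly) 1"
      using that(1) unfolding qq_power One_fract_def .
    then have "monom (1::rat) n = 1" by (simp add: eq_fract)
    then have "degree (monom (1::rat) n) = 0" by simp
    then show False using that(2) by (simp add: degree_monom_eq)
  qed
  show False
  proof (cases "m > 0")
    case True
    then have "qq ^ nat m = 1" using m by (simp add: power_int_def)
    then show False using n[of "nat m"] True by simp
  next
    case False
    then have "qq ^ nat (- m) = 1" using m by (simp add: power_int_def power_inverse)
    then show False using n[of "nat (- m)"] False m by simp
  qed
qed

lemma qpow_0 [simp]: "qpow 0 = 1" by (simp add: qpow_def)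
lemma qpow_add: "qpow (m + n) = qpow m * qpow n"
  by (simp add: qpow_def power_int_add qq_nz)
lemma qpow_nz [simp]: "qpow m \<noteq> 0" by (simp add: qpow_def qq_nz)
lemma qpow_diff: "qpow (m - n) = qpow m / qpow n"
  by (simp add: qpow_def power_int_diff qq_nz)
lemma qpow_minus: "qpow (- m) = inverse (qpow m)"
  by (simp add: qpow_def power_int_minus)
lemma qpow_eq_1: "qpow m = 1 \<longleftrightarrow> m = 0" using qq_powi_eq_1 by (auto simp: qpow_def)
lemma qpow_inj: "qpow m = qpow n \<longleftrightarrow> m = n"
  by (metis qpow_diff qpow_eq_1 qpow_nz divide_self_if eq_iff_diff_eq_0 right_inverse_eq)

lemma qq_diff_nz: "qq - inverse qq \<noteq> 0"
  using qpow_inj[of 1 "-1"] by (simp add: qpow_def power_int_minus)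

lemma qint_0 [simp]: "qint 0 = 0" by (simp add: qint_def)
lemma qint_eq_0: "qint k = 0 \<longleftrightarrow> k = 0"
  using qq_diff_nz qpow_inj[of k "-k"] by (simp add: qint_def)
lemma qint_1: "qint 1 = 1"
  using qq_diff_nz by (simp add: qint_def qpow_def power_int_minus)

text \<open>Exchanging the roles of \<open>a\<close> and \<open>b\<close> yields a second splitting;
  the two together are the source of the two Pascal rules.\<close>

lemma qint_split: "qint (a + b) = qpow a * qint b + qpow (- b) * qint a"
proof -
  have e: "- (a + b) = (- b) + (- a)" by simp
  have "qpow (a + b) - qpow (- (a + b)) = qpow a * (qpow b - qpow (- b)) + qpow (- b) * (qpow a - qpow (- a))"
    unfolding e qpow_add by (simp add: algebra_simps)
  then show ?thesis by (simp add: qint_def add_divide_distrib)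
qed

lemma qfact_nz [simp]: "qfact k \<noteq> 0" by (simp add: qfact_def qint_eq_0)

lemma qfact_Suc: "qfact (Suc k) = qint (int k + 1) * qfact k"
  by (simp add: qfact_def prod.nat_ivl_Suc' algebra_simps)

lemma qbinom_0 [simp]: "qbinom m 0 = 1"
  by (simp add: qbinom_def qfact_def)

lemma qbinom_eq_0: "n < k \<Longrightarrow> qbinom (int n) k = 0"
  unfolding qbinom_def by (auto intro!: bexI[of _ n])

lemma qbinom_aux:
  "qbinom (m + 1) (Suc k) * qint (int k + 1) = qint (m + 1) * qbinom m k"
  "qbinom m (Suc k) * qint (int k + 1) = qint (m - int k) * qbinom m k"
proof -
  have "(\<Prod>j<Suc k. qint (m + 1 - int j)) = qint (m + 1) * (\<Prod>j<k. qint (m - int j))"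
    by (simp add: prod.lessThan_Suc_shift del: prod.lessThan_Suc)
  then show "qbinom (m + 1) (Suc k) * qint (int k + 1) = qint (m + 1) * qbinom m k"
    unfolding qbinom_def qfact_Suc by (simp add: qint_eq_0)
  show "qbinom m (Suc k) * qint (int k + 1) = qint (m - int k) * qbinom m k"
    unfolding qbinom_def qfact_Suc by (simp add: qint_eq_0)
qed

text \<open>After multiplication by [k+1], both forms come from splitting [m+1] into [k+1] and
  [m-k], in either order. The upper entry is any integer, because the extra index (n+1, 0) of the
  first formula brings in the upper entry -1.\<close>

lemma qbinom_pascal:
  "qbinom (m + 1) (Suc k) = qpow (int k + 1) * qbinom m (Suc k) + qpow (int k - m) * qbinom m k" (is ?A)
  "qbinom (m + 1) (Suc k) = qpow (- int k - 1) * qbinom m (Suc k) + qpow (m - int k) * qbinom m k" (is ?B)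
proof -
  have nz: "qint (int k + 1) \<noteq> 0" by (simp add: qint_eq_0)
  have e1: "m - int k + (int k + 1) = m + 1" and e2: "- (int k + 1) = - int k - 1"
    and e3: "int k + 1 + (m - int k) = m + 1" and e4: "- (m - int k) = int k - m" by simp_all
  have a: "qint (m + 1) = qpow (int k + 1) * qint (m - int k) + qpow (int k - m) * qint (int k + 1)"
    using qint_split[of "int k + 1" "m - int k"] by (simp add: add.commute)
  have b: "qint (m + 1) = qpow (- int k - 1) * qint (m - int k) + qpow (m - int k) * qint (int k + 1)"
    using qint_split[of "m - int k" "int k + 1"] unfolding e1 e2 by (simp only: add.commute)
  have "(qpow (int k + 1) * qbinom m (Suc k) + qpow (int k - m) * qbinom m k) * qint (int k + 1)
     = qbinom (m + 1) (Suc k) * qint (int k + 1)"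
    unfolding qbinom_aux(1) a distrib_right mult.assoc qbinom_aux(2)[of m] by (simp add: algebra_simps)
  with nz show ?A by (metis mult_cancel_right)
  have "(qpow (- int k - 1) * qbinom m (Suc k) + qpow (m - int k) * qbinom m k) * qint (int k + 1)
     = qbinom (m + 1) (Suc k) * qint (int k + 1)"
    unfolding qbinom_aux(1) b distrib_right mult.assoc qbinom_aux(2)[of m] by (simp add: algebra_simps)
  with nz show ?B by (metis mult_cancel_right)
qed

lemma qpow_merge: "qpow a * (qpow b * x) = qpow (a + b) * x" "qpow a * qpow b = qpow (a + b)"
  by (simp_all add: qpow_add)

lemma qint_3: "qint 3 = qpow 2 + 1 + qpow (-2)"
proof -
  have "qint 3 = qint (1 + (1 + 1))" by simp
  also have "\<dots> = qpow 2 + 1 + qpow (-2)"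
    unfolding qint_split[of 1 "1 + 1"] qint_split[of 1 1] by (simp add: qint_1 qpow_merge algebra_simps)
  finally show ?thesis .
qed

section \<open>Coefficients of the two expansions and their recursions\<close>

definition cS :: "nat \<Rightarrow> nat \<Rightarrow> nat \<Rightarrow> K" where
  "cS n k l = qpow (gexp (int n) (int k) (int l)) * qbinom (int n - int k) l * qbinom (int n - int l) k"
definition cX :: "nat \<Rightarrow> nat \<Rightarrow> nat \<Rightarrow> K" where
  "cX n k l = qpow (fexp (int n) (int k) (int l)) * qbinom (int n - int k) l * qbinom (int n + 1 - int l) k"

text \<open>Common core of the two recursions. One binomial is expanded on the left by the first
  Pascal rule, the other on the right by the second; the monomials are matched by exponents, and the
  surplus product \<open>x' * y'\<close> is what the subtracted term removes.\<close>

lemma pascal_combine: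
  assumes "e1 + a = e2 + e3" "e1 + b = e2 + e4 + c" "e2 + e4 + d = e5 + e6"
  shows "qpow e1 * x * (qpow a * y + qpow b * y') =
    qpow e2 * (qpow e3 * x * y + qpow e4 * (qpow c * x + qpow d * x') * y') - qpow e5 * (qpow e6 * x' * y')"
proof -
  have "qpow e1 * qpow a = qpow e2 * qpow e3" "qpow e1 * qpow b = qpow e2 * qpow e4 * qpow c"
    "qpow e5 * qpow e6 = qpow e2 * qpow e4 * qpow d"
    using assms by (simp_all only: qpow_add[symmetric])
  then show ?thesis by algebra
qed

text \<open>This is \<open>FX_Suc\<close> coefficient by coefficient: the factor q^(2k) and the
  shift to k - 1 come from \<open>u3_MM_u1\<close>, the diagonal shift of the last term from
  \<open>P1_MM\<close>.\<close>

lemma cX_rec: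
  "cX (Suc n) k l = qpow (int n + 1 + 2 * int k) * (cS (Suc n) k l + (if k = 0 then 0 else cS (Suc n) (k - 1) l))
     - (if k = 0 \<or> l = 0 then 0 else qpow (5 * int n + 3) * cS n (k - 1) (l - 1))"
proof (cases k)
  case 0
  then show ?thesis by (simp add: cX_def cS_def fexp_def gexp_def qpow_merge algebra_simps)
next
  case k: (Suc k')
  define m where "m = int n - int k'"
  show ?thesis
  proof (cases l)
    case 0
    then show ?thesis using qbinom_pascal(1)[of "int n + 1" k'] k
      by (simp add: cX_def cS_def fexp_def gexp_def qpow_merge algebra_simps)
  next
    case l: (Suc l')
    define p where "p = int n - int l'"
    have "cX (Suc n) k l = qpow (fexp (int n + 1) (int k' + 1) (int l' + 1)) * qbinom m (Suc l') * qbinom (p + 1) (Suc k')"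
      by (simp add: cX_def k l m_def p_def algebra_simps)
    moreover have "cS (Suc n) k l = qpow (gexp (int n + 1) (int k' + 1) (int l' + 1)) * qbinom m (Suc l') * qbinom p (Suc k')"
      by (simp add: cS_def k l m_def p_def algebra_simps)
    moreover have "cS (Suc n) (k - 1) l = qpow (gexp (int n + 1) (int k') (int l' + 1)) * qbinom (m + 1) (Suc l') * qbinom p k'"
      by (simp add: cS_def k l m_def p_def algebra_simps)
    moreover have "cS n (k - 1) (l - 1) = qpow (gexp (int n) (int k') (int l')) * qbinom m l' * qbinom p k'"
      by (simp add: cS_def k l m_def p_def algebra_simps)
    ultimately show ?thesis
      unfolding qbinom_pascal(1)[of p] qbinom_pascal(2)[of m]
      by (simp add: k l del: of_nat_Suc) (rule pascal_combine; simp add: fexp_def gexp_def m_def p_def algebra_simps)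
  qed
qed

lemma cS_rec:
  "cS (Suc (Suc n)) k l = qpow (int n - 1 + 2 * int l) * (cX (Suc n) k l + (if l = 0 then 0 else cX (Suc n) k (l - 1)))
     - (if k = 0 \<or> l = 0 then 0 else qpow (5 * int n + 4) * cX n (k - 1) (l - 1))"
proof (cases l)
  case 0
  then show ?thesis by (simp add: cX_def cS_def fexp_def gexp_def qpow_merge algebra_simps)
next
  case l: (Suc l')
  define p where "p = int n - int l' + 1"
  show ?thesis
  proof (cases k)
    case 0
    then show ?thesis using qbinom_pascal(1)[of "int n + 1" l'] l
      by (simp add: cX_def cS_def fexp_def gexp_def qpow_merge algebra_simps)
  next
    case k: (Suc k')
    define m where "m = int n - int k'"
    have "cS (Suc (Suc n)) k l = qpow (gexp (int n + 2) (int k' + 1) (int l' + 1)) * qbinom p (Suc k') * qbinom (m + 1) (Suc l')"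
      by (simp add: cS_def k l m_def p_def algebra_simps)
    moreover have "cX (Suc n) k l = qpow (fexp (int n + 1) (int k' + 1) (int l' + 1)) * qbinom p (Suc k') * qbinom m (Suc l')"
      by (simp add: cX_def k l m_def p_def algebra_simps)
    moreover have "cX (Suc n) k (l - 1) = qpow (fexp (int n + 1) (int k' + 1) (int l')) * qbinom (p + 1) (Suc k') * qbinom m l'"
      by (simp add: cX_def k l m_def p_def algebra_simps)
    moreover have "cX n (k - 1) (l - 1) = qpow (fexp (int n) (int k') (int l')) * qbinom p k' * qbinom m l'"
      by (simp add: cX_def k l m_def p_def algebra_simps)
    ultimately show ?thesis
      unfolding qbinom_pascal(1)[of m] qbinom_pascal(2)[of p]
      by (simp add: k l del: of_nat_Suc) (rule pascal_combine; simp add: fexp_def gexp_def m_def p_def algebra_simps)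
  qed
qed

lemma cS_out: "k \<le> n \<Longrightarrow> l \<le> n \<Longrightarrow> n < k + l \<Longrightarrow> cS n k l = 0"
  using qbinom_eq_0[of "n - k" l] by (simp add: cS_def of_nat_diff)

text \<open>Vanishing one step past the summation range lets the sums in \<open>comb_u3\<close> and
  \<open>comb_P1\<close> be extended to the range of their shifted partners.\<close>

lemma cS_edge: "l \<le> n \<Longrightarrow> cS n (Suc n) l = 0" "k \<le> n \<Longrightarrow> cS n k (Suc n) = 0"
  using qbinom_eq_0[of "n - l" "Suc n"] qbinom_eq_0[of "n - k" "Suc n"] by (auto simp: cS_def of_nat_diff)

lemma cX_out: "k \<le> Suc n \<Longrightarrow> l \<le> n \<Longrightarrow> n < k + l \<Longrightarrow> (k, l) \<noteq> (Suc n, 0) \<Longrightarrow> cX n k l = 0"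
  using qbinom_eq_0[of "n - k" l] qbinom_eq_0[of "Suc n - l" k]
  by (cases "k = Suc n") (auto simp: cX_def of_nat_diff algebra_simps)

lemma cX_edge: "l \<le> n \<Longrightarrow> cX n (n + 2) l = 0" "k \<le> Suc n \<Longrightarrow> cX n k (Suc n) = 0"
proof -
  show "l \<le> n \<Longrightarrow> cX n (n + 2) l = 0"
    using qbinom_eq_0[of "Suc n - l" "n + 2"] by (auto simp: cX_def of_nat_diff algebra_simps)
  show "k \<le> Suc n \<Longrightarrow> cX n k (Suc n) = 0"
    \<comment> \<open>For k = n + 1 the first binomial has upper entry -1 and need not vanish, so
      for k > 0 the second one, with upper entry 0, is used.\<close>
    using qbinom_eq_0[of "n - k" "Suc n"] qbinom_eq_0[of 0 k]
    by (cases "k = 0") (auto simp: cX_def of_nat_diff algebra_simps)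
qed

section \<open>Monomials in a Kronecker-type algebra\<close>

text \<open>Only central elements obeying the exponent rule are assumed, rather than a field of
  scalars, so that the pairs (q^m, q^-m) in the ring of mirrored pairs form an instance.\<close>

locale qscal =
  fixes qp :: "int \<Rightarrow> 'a::ring_1"
  assumes qp_0 [simp]: "qp 0 = 1"
    and qp_add: "qp (m + n) = qp m * qp n"
    and qp_comm: "qp m * x = x * qp m"
begin

text \<open>Rewriting collects all powers of q at the front; \<open>NO_MATCH\<close> keeps two such
  powers from being exchanged forever.\<close>

lemma qp_out: "NO_MATCH (qp k) x \<Longrightarrow> x * qp m = qp m * x"
  and qp_out_left: "NO_MATCH (qp k) x \<Longrightarrow> x * (qp m * y) = qp m * (x * y)"
  by (metis qp_comm mult.assoc)+

lemma qp_mult: "qp m * qp n = qp (m + n)" "qp m * (qp n * x) = qp (m + n) * x"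
  by (simp_all add: qp_add mult.assoc)

lemmas qp_norm = mult.assoc qp_out qp_out_left qp_mult

lemma qp_cancel: "qp m * x = qp m * y \<longleftrightarrow> x = y"
  by (metis qp_0 qp_mult(2) add.left_inverse mult_1)

lemma qp_cong: "m = n \<Longrightarrow> x = y \<Longrightarrow> qp m * x = qp n * y"
  by simp

lemma qp_solve: "x = qp m * y \<longleftrightarrow> qp (- m) * x = y"
  by (metis qp_cancel qp_mult(2) add.left_inverse mult_1 qp_0)

lemma qcomm_power_right:
  assumes "x * y = qp m * (y * x)"
  shows "x * y ^ n = qp (m * int n) * (y ^ n * x)"
proof (induction n)
  case (Suc n)
  have "x * y ^ Suc n = (x * y) * y ^ n" by (simp add: mult.assoc)
  also have "\<dots> = qp m * (y * (x * y ^ n))" by (simp add: assms mult.assoc)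
  also have "\<dots> = qp (m * int (Suc n)) * (y ^ Suc n * x)"
    unfolding Suc by (simp add: qp_norm algebra_simps)
  finally show ?case .
qed simp

lemma qcomm_sym: "x * y = qp m * (y * x) \<Longrightarrow> y * x = qp (- m) * (x * y)"
  by (simp add: qp_norm)

lemma qcomm_powers:
  assumes "x * y = qp m * (y * x)"
  shows "x ^ a * y ^ b = qp (m * int a * int b) * (y ^ b * x ^ a)"
proof -
  have "y ^ b * x = qp (- (m * int b)) * (x * y ^ b)"
    by (rule qcomm_sym[OF qcomm_power_right[OF assms]])
  from qcomm_sym[OF qcomm_power_right[OF this, of a]]
  show ?thesis by (simp add: mult.commute mult.left_commute)
qed

end

text \<open>Read from left to right, the relations move larger indices to the left and so rewrite
  every word into the PBW order u3, u2, u1, u0.\<close>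

locale kron = qscal qp for qp :: "int \<Rightarrow> 'a::ring_1" +
  fixes u0 u1 u2 u3 :: 'a
  assumes r10: "u0 * u1 = qp (-2) * (u1 * u0)"
    and r21: "u1 * u2 = qp (-2) * (u2 * u1)"
    and r32: "u2 * u3 = qp (-2) * (u3 * u2)"
    and r20: "u0 * u2 = qp (-2) * (u2 * u0) - u1 * u1 + qp (-2) * (u1 * u1)"
    and r31: "u1 * u3 = qp (-2) * (u3 * u1) - u2 * u2 + qp (-2) * (u2 * u2)"
    and r30: "u0 * u3 = qp (-2) * (u3 * u0) - u2 * u1 + qp (-4) * (u2 * u1)"
begin

lemma straighten_left:
  "u0 * (u1 * z) = qp (-2) * (u1 * (u0 * z))"
  "u1 * (u2 * z) = qp (-2) * (u2 * (u1 * z))"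
  "u2 * (u3 * z) = qp (-2) * (u3 * (u2 * z))"
  "u0 * (u2 * z) = qp (-2) * (u2 * (u0 * z)) - u1 * (u1 * z) + qp (-2) * (u1 * (u1 * z))"
  "u1 * (u3 * z) = qp (-2) * (u3 * (u1 * z)) - u2 * (u2 * z) + qp (-2) * (u2 * (u2 * z))"
  "u0 * (u3 * z) = qp (-2) * (u3 * (u0 * z)) - u2 * (u1 * z) + qp (-4) * (u2 * (u1 * z))"
  by (simp_all only: mult.assoc[symmetric] r10 r21 r32 r20 r31 r30 distrib_right left_diff_distrib)

lemmas straighten = r10 r21 r32 r20 r31 r30 straighten_left

section \<open>The q-commuting elements and Chebyshev polynomials in \<open>Z\<close>\<close>

definition P0 where "P0 = u2 * u0 - qp 2 * (u1 * u1)"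
definition P1 where "P1 = u3 * u1 - qp 2 * (u2 * u2)"
definition Z where "Z = u3 * u0 - qp 2 * (u2 * u1)"
definition r where "r = qp (-2) * (P1 * P0)"

lemma P0_comm:
  "P0 * u1 = u1 * P0" "u2 * P0 = qp 2 * (P0 * u2)"
  "u0 * P0 = qp (-2) * (P0 * u0)" "u3 * P0 = qp 4 * (P0 * u3)"
  unfolding P0_def by (simp_all add: qp_norm straighten algebra_simps)

lemma P1_comm:
  "P1 * u2 = u2 * P1" "u3 * P1 = qp 2 * (P1 * u3)"
  "u1 * P1 = qp (-2) * (P1 * u1)" "u0 * P1 = qp (-4) * (P1 * u0)"
  unfolding P1_def by (simp_all add: qp_norm straighten algebra_simps)

lemma P1_P0: "P1 * P0 = qp 4 * (P0 * P1)"
  unfolding P1_def P0_def by (simp add: qp_norm straighten algebra_simps)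

lemma Z_comm:
  "Z * P1 = qp (-2) * (P1 * Z)" "Z * P0 = qp 2 * (P0 * Z)"
  "u2 * Z = qp (-2) * (u3 * P0) + P1 * u1"
  "Z * u2 = qp (-2) * (u3 * P0 + P1 * u1)"
  "Z * u3 = qp (-2) * (u3 * Z) + qp (-2) * (P1 * u2) - P1 * u2"
  unfolding P1_def P0_def Z_def by (simp_all add: qp_norm straighten algebra_simps)

text \<open>The index is shifted: \<open>cheb (Suc n)\<close> has degree n in \<open>Z\<close>, and
  \<open>cheb 0 = 0\<close> stands for the polynomial of degree -1.\<close>

fun cheb :: "nat \<Rightarrow> 'a" where
  "cheb 0 = 0"
| "cheb (Suc 0) = 1"
| "cheb (Suc (Suc n)) = Z * cheb (Suc n) - r * cheb n"

text \<open>The factors q^-2 and q^2 picked up by \<open>Z\<close> in passing \<open>P1\<close> and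
  \<open>P0\<close> cancel in their product.\<close>

lemma Z_r: "Z * r = r * Z"
  unfolding r_def
  by (simp add: qp_norm Z_comm) (simp add: mult.assoc[symmetric] Z_comm, simp add: qp_norm Z_comm)

lemma cheb_r: "cheb n * r = r * cheb n"
proof (induction n rule: cheb.induct)
  case (3 n)
  have "Z * cheb (Suc n) * r = r * (Z * cheb (Suc n))"
    by (metis 3(1) Z_r mult.assoc)
  moreover have "r * cheb n * r = r * (r * cheb n)"
    by (simp add: 3(2) mult.assoc)
  ultimately show ?case by (simp add: left_diff_distrib right_diff_distrib)
qed simp_all

lemma cheb_Z: "Z * cheb n = cheb n * Z"
proof (induction n rule: cheb.induct)
  case (3 n)
  have "r * cheb n * Z = Z * (r * cheb n)"
    by (metis 3(2) Z_r mult.assoc)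
  moreover have "Z * cheb (Suc n) * Z = Z * (Z * cheb (Suc n))"
    by (metis 3(1) mult.assoc)
  ultimately show ?case by (simp add: left_diff_distrib right_diff_distrib)
qed simp_all

text \<open>\<open>xx\<close> and \<open>yy\<close> are mirror images, with u3 on opposite sides of
  the Chebyshev polynomial. Their agreement up to a power of q gives the invariance of X_n, and it
  allows the next step of the recursion to multiply by u0 on the right.\<close>

definition xx where "xx n = u3 * cheb (Suc n) - qp 2 * (P1 * (u2 * cheb n))"
definition yy where "yy n = cheb (Suc n) * u3 - qp (-2) * (cheb n * (P1 * u2))"

lemma P1_left:
  "P1 * (u2 * z) = u2 * (P1 * z)" "u3 * (P1 * z) = qp 2 * (P1 * (u3 * z))"
  "u1 * (P1 * z) = qp (-2) * (P1 * (u1 * z))" "u0 * (P1 * z) = qp (-4) * (P1 * (u0 * z))"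
  "P1 * (P0 * z) = qp 4 * (P0 * (P1 * z))"
  by (simp_all only: mult.assoc[symmetric] P1_comm P1_P0)

lemma P0_left:
  "P0 * (u1 * z) = u1 * (P0 * z)" "u2 * (P0 * z) = qp 2 * (P0 * (u2 * z))"
  "u0 * (P0 * z) = qp (-2) * (P0 * (u0 * z))" "u3 * (P0 * z) = qp 4 * (P0 * (u3 * z))"
  by (simp_all only: mult.assoc[symmetric] P0_comm)

text \<open>Passing \<open>Z\<close> through u3 leaves multiples of P1 u2, and passing it through u2
  leaves multiples of u3 P0; these errors recombine into a recursion of Chebyshev type.\<close>

lemma Z_xx: "Z * xx (Suc n) = qp (-2) * xx (Suc (Suc n)) + qp (-4) * (xx n * r)"
proof -
  let ?c = cheb
  have zc: "Z * ?c (Suc n) = ?c (Suc (Suc n)) + r * ?c n" by simp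
  have zc2: "Z * ?c (Suc (Suc n)) = ?c (Suc (Suc (Suc n))) + r * ?c (Suc n)" by simp
  have a: "Z * xx (Suc n) = (Z * u3) * ?c (Suc (Suc n)) - qp 2 * ((Z * P1) * (u2 * ?c (Suc n)))"
    by (simp add: xx_def right_diff_distrib qp_norm)
  have b: "(Z * u3) * ?c (Suc (Suc n))
      = qp (-2) * (u3 * (Z * ?c (Suc (Suc n)))) + qp (-2) * (P1 * (u2 * ?c (Suc (Suc n)))) - P1 * (u2 * ?c (Suc (Suc n)))"
    by (simp only: Z_comm) (simp add: algebra_simps qp_norm)
  have zu2: "Z * u2 = qp (-2) * (u2 * Z) + qp (-2) * (u3 * P0) - qp (-4) * (u3 * P0)"
    by (simp add: Z_comm algebra_simps qp_norm)
  have "qp 2 * ((Z * P1) * (u2 * ?c (Suc n))) = P1 * ((Z * u2) * ?c (Suc n))"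
    by (simp only: Z_comm(1)) (simp add: qp_norm)
  also have "\<dots> = qp (-2) * (P1 * (u2 * (Z * ?c (Suc n)))) + (qp (-2) - qp (-4)) * (P1 * (u3 * (P0 * ?c (Suc n))))"
    unfolding zu2 by (simp add: algebra_simps qp_norm)
  also have "P1 * (u3 * (P0 * ?c (Suc n))) = qp (-2) * (u3 * (P1 * (P0 * ?c (Suc n))))"
    by (simp only: P1_left(2) qp_mult) simp
  also have "P1 * (P0 * ?c (Suc n)) = qp 2 * (r * ?c (Suc n))"
    by (simp add: r_def qp_norm)
  finally have c: "qp 2 * ((Z * P1) * (u2 * ?c (Suc n)))
     = qp (-2) * (P1 * (u2 * (Z * ?c (Suc n)))) + qp (-2) * (u3 * (r * ?c (Suc n))) - qp (-4) * (u3 * (r * ?c (Suc n)))"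
    by (simp add: algebra_simps qp_norm)
  show ?thesis unfolding a b c zc zc2
    by (simp add: xx_def algebra_simps qp_norm cheb_r del: cheb.simps)
qed

lemma r_comm: "u3 * r = qp 6 * (r * u3)" "u2 * r = qp 2 * (r * u2)" "P1 * r = qp 4 * (r * P1)"
  by (simp_all add: r_def qp_norm P1_left P0_left P1_comm P0_comm P1_P0)

lemma r_left: "u3 * (r * z) = qp 6 * (r * (u3 * z))" "u2 * (r * z) = qp 2 * (r * (u2 * z))"
  "P1 * (r * z) = qp 4 * (r * (P1 * z))"
  by (simp_all only: mult.assoc[symmetric] r_comm)

lemma xx_r: "xx n * r = qp 6 * (r * xx n)"
  by (simp add: xx_def algebra_simps qp_norm cheb_r r_left del: cheb.simps)

text \<open>Up to the power of q, both sides obey the same three-term recursion, \<open>yy\<close>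
  by the definition of \<open>cheb\<close> and \<open>xx\<close> by \<open>Z_xx\<close> with
  \<open>xx_r\<close>, so the cases n = 0 and n = 1 decide.\<close>

lemma xx_yy: "xx n = qp (2 * int n) * yy n"
proof (induction n rule: less_induct)
  case (less n)
  consider "n = 0" | "n = 1" | m where "n = Suc (Suc m)"
    by (metis One_nat_def not0_implies_Suc)
  then show ?case
  proof cases
    case 1
    then show ?thesis by (simp add: xx_def yy_def)
  next
    case 2
    have "qp 2 * (Z * u3) = u3 * Z + P1 * u2 - qp 2 * (P1 * u2)"
      by (simp add: Z_comm algebra_simps qp_norm)
    then show ?thesis using 2 by (simp add: xx_def yy_def algebra_simps qp_norm)
  next
    case 3
    have 1: "xx (Suc m) = qp (2 * int m + 2) * yy (Suc m)" and 2: "xx m = qp (2 * int m) * yy m"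
      using less[of "Suc m"] less[of m] 3 by (simp_all add: algebra_simps)
    have "xx (Suc (Suc m)) = qp 2 * (Z * xx (Suc m)) - qp (-2) * (xx m * r)"
      by (simp add: Z_xx algebra_simps qp_norm)
    also have "\<dots> = qp (2 * int m + 4) * (Z * yy (Suc m)) - qp (2 * int m + 4) * (r * yy m)"
      unfolding xx_r unfolding 1 2 by (simp add: qp_norm algebra_simps)
    also have "\<dots> = qp (2 * int n) * yy n"
      unfolding 3 by (simp add: yy_def algebra_simps qp_norm)
    finally show ?thesis unfolding 3 .
  qed
qed

text \<open>Replace u3 u0 through \<open>Z\<close>, u2 u0 through \<open>P0\<close>, and u3 P0
  through Z u2. The terms with P1 u1 u1 cancel, those with u2 u1 cancel by the Chebyshev recursion,
  and the rest is that recursion one degree higher.\<close>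

lemma cheb_step: "cheb (Suc (Suc (Suc n))) = yy (Suc n) * u0 - yy n * (P0 * u1)"
proof -
  let ?c = cheb
  have u30: "u3 * u0 = Z + qp 2 * (u2 * u1)" by (simp add: Z_def)
  have u20: "u2 * u0 = P0 + qp 2 * (u1 * u1)" by (simp add: P0_def)
  have zu: "u3 * P0 = qp 2 * (Z * u2) - P1 * u1"
    by (simp add: Z_comm algebra_simps qp_norm)
  have e: "yy (Suc n) * u0 = ?c (Suc (Suc n)) * (u3 * u0) - qp (-2) * (?c (Suc n) * (P1 * (u2 * u0)))"
    by (simp add: yy_def algebra_simps qp_norm)
  have f: "yy n * (P0 * u1) = ?c (Suc n) * ((u3 * P0) * u1) - qp (-2) * (?c n * (P1 * (u2 * (P0 * u1))))"
    by (simp add: yy_def algebra_simps qp_norm)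
  have g: "P1 * (u2 * (P0 * u1)) = qp 4 * (r * (u2 * u1))"
    by (simp add: r_def qp_norm P1_left P0_left)
  have h: "P1 * P0 = qp 2 * r" by (simp add: r_def qp_norm)
  have k: "?c (Suc (Suc n)) * (u2 * u1) = ?c (Suc n) * (Z * (u2 * u1)) - ?c n * (r * (u2 * u1))"
    by (simp add: mult.assoc[symmetric] cheb_Z cheb_r left_diff_distrib)
  have l: "?c (Suc (Suc n)) * Z = Z * ?c (Suc (Suc n))" "?c (Suc n) * r = r * ?c (Suc n)"
    by (simp_all only: cheb_Z cheb_r)
  show ?thesis unfolding e f u30 u20 zu g
    by (simp add: algebra_simps qp_norm h k l del: cheb.simps(3)) (simp add: l(1))
qed

end

section \<open>The integral lattice\<close>

context kron begin

text \<open>The powers of q normalise the leading coefficient to 1: the leading term of Z^n is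
  q^(-n(n-1)) u3^n u0^n, whereas E[n,0,0,n] is q^(n(n-1)) u3^n u0^n.\<close>

definition SS where "SS n = qp (2 * int n ^ 2 - 2 * int n) * cheb (Suc n)"
definition XX where "XX n = qp (2 * int n ^ 2 - int n) * xx n"

lemma SS_0: "SS 0 = 1" and SS_1: "SS (Suc 0) = Z" and XX_0: "XX 0 = u3"
  by (simp_all add: SS_def XX_def xx_def)

lemma XX_Suc: "XX (Suc n) = qp (int n + 1) * (u3 * SS (Suc n)) - qp (5 * int n + 3) * (P1 * (u2 * SS n))"
  by (simp add: XX_def SS_def xx_def qp_norm algebra_simps power2_eq_square del: cheb.simps)

lemma SS_Suc: "SS (Suc (Suc n)) = qp (int n + 1) * (XX (Suc n) * u0) - qp (5 * int n + 4) * (XX n * (P0 * u1))"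
proof -
  have "yy (Suc n) = qp (- 2 * int n - 2) * xx (Suc n)" "yy n = qp (- 2 * int n) * xx n"
    by (simp_all add: xx_yy qp_norm)
  then show ?thesis unfolding SS_def XX_def cheb_step
    by (simp add: qp_norm algebra_simps power2_eq_square del: cheb.simps)
qed

definition pbw :: "nat \<Rightarrow> nat \<Rightarrow> nat \<Rightarrow> nat \<Rightarrow> 'a" where
  "pbw a3 a2 a1 a0 = qp (int (bexp (a3, a2, a1, a0))) * (u3 ^ a3 * (u2 ^ a2 * (u1 ^ a1 * u0 ^ a0)))"

lemma choose_two_Suc: "Suc n choose 2 = (n choose 2) + n"
  by (simp add: numeral_2_eq_2)

lemma choose_two_0: "0 choose 2 = 0" "Suc 0 choose 2 = 0"
  by (simp_all add: numeral_2_eq_2)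

lemma choose_two_add3: "(n + 3) choose 2 = (n choose 2) + 3 * n + 3"
  using choose_two_Suc[of n] choose_two_Suc[of "Suc n"] choose_two_Suc[of "Suc (Suc n)"]
  by (simp add: eval_nat_numeral)

lemma power_left: "w * (w ^ n * z) = w ^ Suc n * (z::'a)" "w ^ n * (w * z) = w ^ Suc n * z"
  by (simp_all add: mult.assoc[symmetric] power_commutes)

lemma u3_pbw: "u3 * pbw a3 a2 a1 a0 = qp (- int a3) * pbw (Suc a3) a2 a1 a0"
  by (simp add: pbw_def qp_norm choose_two_Suc algebra_simps)

lemma pbw_u0: "pbw a3 a2 a1 a0 * u0 = qp (- int a0) * pbw a3 a2 a1 (Suc a0)"
  by (simp add: pbw_def qp_norm choose_two_Suc power_commutes algebra_simps)

text \<open>\<open>P1\<close> q-commutes with u3 and commutes with u2, so it travels intact to the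
  place between u2 and u1. Only there is it split into its two summands, whence just two PBW
  monomials.\<close>

lemma P1_u2_pbw: "P1 * (u2 * pbw a3 a2 a1 a0)
   = qp (- 2 - 5 * int a3 - 3 * int a2 - int a1) * pbw (Suc a3) (Suc a2) (Suc a1) a0
     - qp (- 1 - 4 * int a3 - 3 * int a2) * pbw a3 (a2 + 3) a1 a0"
proof -
  have P1_u3: "P1 * u3 ^ n = qp (- 2 * int n) * (u3 ^ n * P1)" for n
    using qcomm_power_right[OF qcomm_sym[OF P1_comm(2)]] by simp
  have P1_u2: "P1 * u2 ^ n = u2 ^ n * P1" for n
    using qcomm_power_right[of P1 u2 0] P1_comm(1) by simp
  have u23: "u2 * u3 ^ n = qp (- 2 * int n) * (u3 ^ n * u2)" for n
    by (rule qcomm_power_right[OF r32])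
  have u2n3: "u2 ^ n * u3 = qp (- 2 * int n) * (u3 * u2 ^ n)" for n
    using qcomm_powers[OF r32, of n 1] by simp
  note l = P1_u3 P1_u2 u23 u2n3
  note ll = arg_cong[OF l(1), of "\<lambda>t. t * z" for z] arg_cong[OF l(2), of "\<lambda>t. t * z" for z]
    arg_cong[OF l(3), of "\<lambda>t. t * z" for z] arg_cong[OF l(4), of "\<lambda>t. t * z" for z]
  note ll' = ll[unfolded mult.assoc]
  let ?t = "u1 ^ a1 * u0 ^ a0"
  have "P1 * (u2 * (u3 ^ a3 * (u2 ^ a2 * ?t))) = qp (- 4 * int a3) * (u3 ^ a3 * (u2 ^ Suc a2 * (P1 * ?t)))"
    by (simp add: ll' qp_norm P1_left power_left del: power_Suc)
  also have "\<dots> = qp (- 4 * int a3 - 2 * (int a2 + 1)) * (u3 ^ Suc a3 * (u2 ^ Suc a2 * (u1 ^ Suc a1 * u0 ^ a0)))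
      - qp (2 - 4 * int a3) * (u3 ^ a3 * (u2 ^ (a2 + 3) * ?t))"
    by (simp add: P1_def algebra_simps qp_norm ll' power_left power_add eval_nat_numeral power_commutes del: power_Suc)
      (rule qp_cong; simp)
  finally have e: "P1 * (u2 * (u3 ^ a3 * (u2 ^ a2 * ?t))) = \<dots>" .
  have "P1 * (u2 * pbw a3 a2 a1 a0) = qp (int (bexp (a3, a2, a1, a0))) * (P1 * (u2 * (u3 ^ a3 * (u2 ^ a2 * ?t))))"
    by (simp add: pbw_def qp_norm)
  then show ?thesis unfolding e right_diff_distrib pbw_def qp_mult
    by (simp add: choose_two_Suc choose_two_add3 algebra_simps del: power_Suc)
qed

lemma pbw_P0_u1: "pbw a3 a2 a1 a0 * (P0 * u1)
   = qp (- 2 - 5 * int a0 - 3 * int a1 - int a2) * pbw a3 (Suc a2) (Suc a1) (Suc a0)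
     - qp (- 1 - 4 * int a0 - 3 * int a1) * pbw a3 a2 (a1 + 3) a0"
proof -
  have l1: "u0 ^ n * P0 = qp (- 2 * int n) * (P0 * u0 ^ n)" for n
    using qcomm_powers[OF P0_comm(3), of n 1] by simp
  have l2: "u1 ^ n * P0 = P0 * u1 ^ n" for n
    using qcomm_powers[of u1 P0 0 n 1] P0_comm(1) by simp
  have l3: "u0 ^ n * u1 = qp (- 2 * int n) * (u1 * u0 ^ n)" for n
    using qcomm_powers[OF r10, of n 1] by simp
  have l4: "u0 * u1 ^ n = qp (- 2 * int n) * (u1 ^ n * u0)" for n
    by (rule qcomm_power_right[OF r10])
  note l = l1 l2 l3 l4
  note ll = arg_cong[OF l(1), of "\<lambda>t. t * z" for z] arg_cong[OF l(2), of "\<lambda>t. t * z" for z]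
    arg_cong[OF l(3), of "\<lambda>t. t * z" for z] arg_cong[OF l(4), of "\<lambda>t. t * z" for z]
  note ll' = ll[unfolded mult.assoc]
  have "u2 ^ a2 * (u1 ^ a1 * (u0 ^ a0 * (P0 * u1))) = qp (- 4 * int a0) * (u2 ^ a2 * (P0 * (u1 ^ Suc a1 * u0 ^ a0)))"
    by (simp add: l ll' qp_norm power_left del: power_Suc)
  also have "\<dots> = qp (- 4 * int a0 - 2 * (int a1 + 1)) * (u2 ^ Suc a2 * (u1 ^ Suc a1 * u0 ^ Suc a0))
      - qp (2 - 4 * int a0) * (u2 ^ a2 * (u1 ^ (a1 + 3) * u0 ^ a0))"
    by (simp add: P0_def algebra_simps qp_norm ll' power_left power_add eval_nat_numeral power_commutes del: power_Suc)
      (simp add: power_left, rule qp_cong; simp)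
  finally have e: "u2 ^ a2 * (u1 ^ a1 * (u0 ^ a0 * (P0 * u1))) = \<dots>" .
  have "pbw a3 a2 a1 a0 * (P0 * u1) = qp (int (bexp (a3, a2, a1, a0))) * (u3 ^ a3 * (u2 ^ a2 * (u1 ^ a1 * (u0 ^ a0 * (P0 * u1)))))"
    by (simp add: pbw_def mult.assoc)
  then show ?thesis unfolding e by (simp add: right_diff_distrib pbw_def qp_norm choose_two_Suc choose_two_add3 algebra_simps del: power_Suc)
qed

end

text \<open>The pairs (x, y) for which (A,0,0,C) + x(-1,2,-1,0) + y(0,-1,2,-1) has nonnegative
  entries. They parametrise a = (A,0,0,C) together with S(a).\<close>

definition idx :: "nat \<Rightarrow> nat \<Rightarrow> (nat \<times> nat) set" where
  "idx A C = {(x, y). x \<le> A \<and> y \<le> C \<and> y \<le> 2 * x \<and> x \<le> 2 * y}"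

context kron begin

definition EE :: "nat \<Rightarrow> nat \<Rightarrow> nat \<Rightarrow> nat \<Rightarrow> 'a" where
  "EE A C x y = pbw (A - x) (2 * x - y) (2 * y - x) (C - y)"

text \<open>The q Z[q]-span of the E[b] with b in S(A,0,0,C), given by generators and differences
  alone, so that it makes sense where only powers of q act, in particular for mirrored
  pairs.\<close>

inductive_set lat :: "nat \<Rightarrow> nat \<Rightarrow> 'a set" for A C where
  zero: "0 \<in> lat A C"
| gen: "(x, y) \<in> idx A C \<Longrightarrow> (x, y) \<noteq> (0, 0) \<Longrightarrow> qp (int (Suc e)) * EE A C x y \<in> lat A C"
| diff: "a \<in> lat A C \<Longrightarrow> b \<in> lat A C \<Longrightarrow> a - b \<in> lat A C"

lemma lat_add: "a \<in> lat A C \<Longrightarrow> b \<in> lat A C \<Longrightarrow> a + b \<in> lat A C"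
  using lat.diff[of a A C "0 - b"] lat.diff[OF lat.zero] by simp

lemma lat_gen: "(x, y) \<in> idx A C \<Longrightarrow> (x, y) \<noteq> (0, 0) \<Longrightarrow> m \<ge> 1 \<Longrightarrow> qp m * EE A C x y \<in> lat A C"
  using lat.gen[of x y A C "nat m - 1"] by simp

lemma lat_qp: "a \<in> lat A C \<Longrightarrow> m \<ge> 0 \<Longrightarrow> qp m * a \<in> lat A C"
proof (induction rule: lat.induct)
  case (gen x y e)
  then show ?case using lat_gen[of x y A C "m + int (Suc e)"] by (simp add: qp_mult del: of_nat_Suc)
qed (simp_all add: lat.zero lat.diff right_diff_distrib)

lemma lat_map:
  assumes "a \<in> lat A C"
    and diff: "\<And>a b. f (a - b) = f a - f b" and qp: "\<And>m a. f (qp m * a) = qp m * f a"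
    and EE: "\<And>x y. (x, y) \<in> idx A C - {(0, 0)} \<Longrightarrow> f (EE A C x y) \<in> lat A' C'"
  shows "f a \<in> lat A' C'"
  using assms(1)
proof (induction rule: lat.induct)
  case zero
  have "f 0 = 0" using diff[of 0 0] by simp
  then show ?case by (simp add: lat.zero)
next
  case gen
  then show ?case unfolding qp by (intro lat_qp EE) auto
qed (simp add: diff lat.diff)

lemma u3_EE: "(x, y) \<in> idx A C \<Longrightarrow> u3 * EE A C x y = qp (int x - int A) * EE (Suc A) C x y"
  by (auto simp: EE_def u3_pbw idx_def Suc_diff_le of_nat_diff)

lemma EE_u0: "(x, y) \<in> idx A C \<Longrightarrow> EE A C x y * u0 = qp (int y - int C) * EE A (Suc C) x y"
  by (auto simp: EE_def pbw_u0 idx_def Suc_diff_le of_nat_diff)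

lemma P1_EE:
  assumes "(x, y) \<in> idx A C"
  shows "P1 * (u2 * EE A C x y) = qp (int y - 2 - 5 * int A) * EE (A + 2) (C + 1) (x + 1) (y + 1)
    - qp (3 * int y - 2 * int x - 1 - 4 * int A) * EE (A + 2) (C + 1) (x + 2) (y + 1)"
proof -
  have "x \<le> A" "y \<le> C" "y \<le> 2 * x" "x \<le> 2 * y" using assms by (auto simp: idx_def)
  then have e: "A + 2 - (x + 1) = Suc (A - x)" "2 * (x + 1) - (y + 1) = Suc (2 * x - y)"
     "2 * (y + 1) - (x + 1) = Suc (2 * y - x)" "C + 1 - (y + 1) = C - y"
     "A + 2 - (x + 2) = A - x" "2 * (x + 2) - (y + 1) = 2 * x - y + 3"
     "2 * (y + 1) - (x + 2) = 2 * y - x"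
     "int (A - x) = int A - int x" "int (2 * x - y) = 2 * int x - int y" "int (2 * y - x) = 2 * int y - int x"
    by auto
  show ?thesis unfolding EE_def P1_u2_pbw e by (simp add: algebra_simps)
qed

lemma EE_P0:
  assumes "(x, y) \<in> idx A C"
  shows "EE A C x y * (P0 * u1) = qp (int x - 2 - 5 * int C) * EE (A + 1) (C + 2) (x + 1) (y + 1)
    - qp (3 * int x - 2 * int y - 1 - 4 * int C) * EE (A + 1) (C + 2) (x + 1) (y + 2)"
proof -
  have "x \<le> A" "y \<le> C" "y \<le> 2 * x" "x \<le> 2 * y" using assms by (auto simp: idx_def)
  then have e: "C + 2 - (y + 1) = Suc (C - y)" "2 * (x + 1) - (y + 1) = Suc (2 * x - y)"
     "2 * (y + 1) - (x + 1) = Suc (2 * y - x)" "A + 1 - (x + 1) = A - x"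
     "C + 2 - (y + 2) = C - y" "2 * (y + 2) - (x + 1) = 2 * y - x + 3"
     "2 * (x + 1) - (y + 2) = 2 * x - y"
     "int (C - y) = int C - int y" "int (2 * x - y) = 2 * int x - int y" "int (2 * y - x) = 2 * int y - int x"
    by auto
  show ?thesis unfolding EE_def pbw_P0_u1 e by (simp add: algebra_simps)
qed

text \<open>The factor q^n offsets the loss q^(x-n) and leaves q^x. Here x is at least 1: the
  inequalities y <= 2x and x <= 2y let x and y vanish only together.\<close>

lemma lat_u3:
  assumes "a \<in> lat n n" shows "qp (int n) * (u3 * a) \<in> lat (Suc n) n"
  using assms
proof (rule lat_map)
  fix x y assume "(x, y) \<in> idx n n - {(0, 0)}"
  then show "qp (int n) * (u3 * EE n n x y) \<in> lat (Suc n) n"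
    by (auto simp: u3_EE qp_mult idx_def intro!: lat_gen)
qed (simp_all add: algebra_simps qp_norm)

lemma lat_u0:
  assumes "a \<in> lat (Suc n) n" shows "qp (int n) * (a * u0) \<in> lat (Suc n) (Suc n)"
  using assms
proof (rule lat_map)
  fix x y assume "(x, y) \<in> idx (Suc n) n - {(0, 0)}"
  then show "qp (int n) * (EE (Suc n) n x y * u0) \<in> lat (Suc n) (Suc n)"
    by (auto simp: EE_u0 qp_mult idx_def intro!: lat_gen)
qed (simp_all add: algebra_simps qp_norm)

text \<open>The resulting exponents are y + 1 and n + 2 + 3y - 2x, the latter at least y + 2 because
  x <= n and x <= 2y. The index (0, 0) is included: even the leading term contributes only to the
  lattice here.\<close>

lemma EE_P1_lat:
  assumes "(x, y) \<in> idx n n"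
  shows "qp (5 * int n + 3) * (P1 * (u2 * EE n n x y)) \<in> lat (n + 2) (n + 1)"
  using assms unfolding P1_EE[OF assms] right_diff_distrib qp_mult
  by (intro lat.diff lat_gen) (auto simp: idx_def)

lemma lat_P1:
  assumes "a \<in> lat n n" shows "qp (5 * int n + 3) * (P1 * (u2 * a)) \<in> lat (n + 2) (n + 1)"
  using assms
proof (rule lat_map)
  fix x y assume "(x, y) \<in> idx n n - {(0, 0)}"
  then show "qp (5 * int n + 3) * (P1 * (u2 * EE n n x y)) \<in> lat (n + 2) (n + 1)"
    by (intro EE_P1_lat) simp
qed (simp_all add: algebra_simps qp_norm)

text \<open>Now the exponents are x + 2 and n + 3 + 3x - 2y, the latter at least x + 3 because y <=
  n and y <= 2x.\<close>

lemma EE_P0_lat: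
  assumes "(x, y) \<in> idx (n + 1) n"
  shows "qp (5 * int n + 4) * (EE (n + 1) n x y * (P0 * u1)) \<in> lat (n + 2) (n + 2)"
  using assms unfolding EE_P0[OF assms] right_diff_distrib qp_mult
  by (simp add: numeral_2_eq_2) (intro lat.diff lat_gen, auto simp: idx_def)

lemma lat_P0:
  assumes "a \<in> lat (n + 1) n" shows "qp (5 * int n + 4) * (a * (P0 * u1)) \<in> lat (n + 2) (n + 2)"
  using assms
proof (rule lat_map)
  fix x y assume "(x, y) \<in> idx (n + 1) n - {(0, 0)}"
  then show "qp (5 * int n + 4) * (EE (n + 1) n x y * (P0 * u1)) \<in> lat (n + 2) (n + 2)"
    by (intro EE_P0_lat) simp
qed (simp_all add: algebra_simps qp_norm)

lemma zero_idx: "(0, 0) \<in> idx A C" by (simp add: idx_def)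

text \<open>In each recursion only the first term carries the leading PBW element along, with
  coefficient exactly 1, and everything else falls into the lattice. The induction is joint because
  the two recursions alternate.\<close>

lemma SS_XX_lat:
  "SS n - EE n n 0 0 \<in> lat n n \<and> XX n - EE (Suc n) n 0 0 \<in> lat (Suc n) n"
proof (induction n rule: less_induct)
  case (less n)
  have S: "SS n - EE n n 0 0 \<in> lat n n"
  proof -
    consider "n = 0" | "n = 1" | m where "n = Suc (Suc m)"
      by (metis One_nat_def not0_implies_Suc)
    then show ?thesis
    proof cases
      case 1
      then show ?thesis by (simp add: SS_0 EE_def pbw_def lat.zero choose_two_0)
    next
      case 2
      have "SS 1 - EE 1 1 0 0 = 0 - qp (int (Suc 1)) * EE 1 1 1 1"
        by (simp add: SS_1 EE_def pbw_def Z_def choose_two_0)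
      also have "\<dots> \<in> lat 1 1" by (intro lat.diff lat.zero lat.gen) (simp_all add: idx_def)
      finally show ?thesis using 2 by simp
    next
      case 3
      let ?a = "XX (Suc m) - EE (Suc (Suc m)) (Suc m) 0 0" and ?b = "XX m - EE (m + 1) m 0 0"
      have "?a \<in> lat (Suc (Suc m)) (Suc m)" "?b \<in> lat (m + 1) m" using less[of "Suc m"] less[of m] 3 by simp_all
      then have "qp (int (Suc m)) * (?a * u0) - (qp (5 * int m + 4) * (?b * (P0 * u1))
          + qp (5 * int m + 4) * (EE (m + 1) m 0 0 * (P0 * u1))) \<in> lat n n"
        using lat_u0[of ?a "Suc m"] lat_P0[of ?b m] EE_P0_lat[of 0 0 m] 3
        by (intro lat.diff lat_add) (simp_all add: zero_idx)
      also have "qp (int (Suc m)) * (?a * u0) - (qp (5 * int m + 4) * (?b * (P0 * u1))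
          + qp (5 * int m + 4) * (EE (m + 1) m 0 0 * (P0 * u1))) = SS n - EE n n 0 0"
        unfolding 3 SS_Suc by (simp add: algebra_simps EE_u0 zero_idx qp_mult)
      finally show ?thesis .
    qed
  qed
  have "XX n - EE (Suc n) n 0 0 \<in> lat (Suc n) n"
  proof (cases n)
    case 0
    then show ?thesis by (simp add: XX_0 EE_def pbw_def lat.zero choose_two_0)
  next
    case (Suc m)
    let ?a = "SS (Suc m) - EE (Suc m) (Suc m) 0 0" and ?b = "SS m - EE m m 0 0"
    have "?a \<in> lat (Suc m) (Suc m)" "?b \<in> lat m m" using less[of m] S Suc by simp_all
    then have "qp (int (Suc m)) * (u3 * ?a) - (qp (5 * int m + 3) * (P1 * (u2 * ?b))
          + qp (5 * int m + 3) * (P1 * (u2 * EE m m 0 0))) \<in> lat (Suc n) n"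
      using lat_u3[of ?a "Suc m"] lat_P1[of ?b m] EE_P1_lat[of 0 0 m] Suc
      by (intro lat.diff lat_add) (simp_all add: zero_idx)
    also have "qp (int (Suc m)) * (u3 * ?a) - (qp (5 * int m + 3) * (P1 * (u2 * ?b))
          + qp (5 * int m + 3) * (P1 * (u2 * EE m m 0 0))) = XX n - EE (Suc n) n 0 0"
      unfolding Suc XX_Suc by (simp add: algebra_simps u3_EE zero_idx qp_mult)
    finally show ?thesis .
  qed
  with S show ?case ..
qed

end

section \<open>Rings with a central copy of Q(q)\<close>

locale scalars =
  fixes s :: "K \<Rightarrow> 'a::ring_1"
  assumes s_add: "s (a + b) = s a + s b"
    and s_mult: "s (a * b) = s a * s b"
    and s_1 [simp]: "s 1 = 1"
    and s_comm: "s a * x = x * s a"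
begin

sublocale qscal "\<lambda>m. s (qpow m)"
proof
  show "s (qpow m) * x = x * s (qpow m)" for m x by (rule s_comm)
qed (simp_all add: s_1 qpow_add s_mult)

abbreviation "qs m \<equiv> s (qpow m)"

lemma s_0 [simp]: "s 0 = 0" using s_add[of 0 0] by simp
lemma s_minus: "s (- a) = - s a" using s_add[of a "- a"] by (simp add: s_0 eq_neg_iff_add_eq_0 add.commute)
lemma s_diff: "s (a - b) = s a - s b" using s_add[of a "- b"] by (simp add: s_minus)

lemma s_merge: "s a * (s b * x) = s (a * b) * x"
  by (simp add: s_mult mult.assoc)

lemma s_pull: "x * (s c * y) = s c * (x * y)"
  by (metis s_comm mult.assoc)

lemma s_out: "NO_MATCH (s d) x \<Longrightarrow> x * (s c * y) = s c * (x * y)"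
  by (rule s_pull)

lemma s_cancel: "c \<noteq> 0 \<Longrightarrow> s c * x = s c * y \<Longrightarrow> x = y"
  by (metis s_merge s_1 left_inverse mult_1)

lemma s_eq_0: "c \<noteq> 0 \<Longrightarrow> s c * x = 0 \<Longrightarrow> x = 0"
  using s_cancel[of c x 0] by simp

lemma two_cancel: "x + x = y + y \<Longrightarrow> x = (y::'a)"
proof -
  assume "x + x = y + y"
  then have "s (1 + 1) * x = s (1 + 1) * y" by (simp only: s_add s_1 distrib_right mult_1)
  moreover have "(1 + 1 :: K) \<noteq> 0"
  proof -
    have "1 + 1 = Fract (1 + 1) (1::rat poly)" by (simp add: One_fract_def)
    moreover have "Fract (1 + 1) (1::rat poly) \<noteq> 0" by (simp add: Zero_fract_def eq_fract)
    ultimately show ?thesis by simp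
  qed
  ultimately show ?thesis by (rule s_cancel[rotated])
qed

end

section \<open>Expansion in the initial cluster\<close>

locale kron_alg = scalars s + kron "\<lambda>m. s (qpow m)" u0 u1 u2 u3
  for s :: "K \<Rightarrow> 'a::ring_1" and u0 u1 u2 u3
begin

lemma power_commutes_left: "w * (w ^ n * z) = w ^ n * (w * (z::'a))"
  by (simp only: mult.assoc[symmetric] power_commutes)

text \<open>The factors q-commute pairwise. The exponents of u2 and u1 go in steps of two because u3
  u1 = P1 + q^2 u2^2 and u2 u0 = P0 + q^2 u1^2.\<close>

definition MM :: "nat \<Rightarrow> nat \<Rightarrow> nat \<Rightarrow> nat \<Rightarrow> 'a" where
  "MM A C k l = P1 ^ (A - k) * (u2 ^ (2 * k) * (u1 ^ (2 * l) * P0 ^ (C - l)))"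

definition comb :: "nat \<Rightarrow> nat \<Rightarrow> (nat \<Rightarrow> nat \<Rightarrow> K) \<Rightarrow> 'a" where
  "comb A C f = (\<Sum>k\<le>A. \<Sum>l\<le>C. s (f k l) * MM A C k l)"

lemma comb_cong: "(\<And>k l. k \<le> A \<Longrightarrow> l \<le> C \<Longrightarrow> f k l = g k l) \<Longrightarrow> comb A C f = comb A C g"
  by (simp add: comb_def)

lemma comb_add: "comb A C f + comb A C g = comb A C (\<lambda>k l. f k l + g k l)"
  by (simp add: comb_def sum.distrib s_add distrib_right)

lemma comb_diff: "comb A C f - comb A C g = comb A C (\<lambda>k l. f k l - g k l)"
  by (simp add: comb_def sum_subtractf s_diff left_diff_distrib)

lemma comb_scale: "s c * comb A C f = comb A C (\<lambda>k l. c * f k l)"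
  by (simp add: comb_def sum_distrib_left s_mult mult.assoc)

lemma comb_sum: "(\<Sum>i\<in>I. comb A C (f i)) = comb A C (\<lambda>k l. \<Sum>i\<in>I. f i k l)"
proof (induction I rule: infinite_finite_induct)
  case (insert i I)
  then show ?case by (simp add: comb_add)
qed (simp_all add: comb_def)

lemma qcomm_left: "x * y = qs m * (y * x) \<Longrightarrow> x * (y * z) = qs m * (y * (x * z))"
  by (metis mult.assoc)

text \<open>u3 passes \<open>P1\<close> and u2 from the left, u1 passes \<open>P0\<close> from the
  right, and where they meet u3 u1 = P1 + q^2 u2^2. Relative to \<open>Suc A\<close>, the first
  summand keeps k and the second raises it.\<close>

lemma u3_MM_u1:
  assumes "k \<le> A"
  shows "u3 * (MM A C k l * u1) = qs (2 * int A + 2 * int k) * (MM (Suc A) C k l + qs 2 * MM (Suc A) C (Suc k) l)"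
proof -
  have a: "u3 * P1 ^ n = qs (2 * int n) * (P1 ^ n * u3)" for n by (rule qcomm_power_right[OF P1_comm(2)])
  have "u3 * u2 = qs 2 * (u2 * u3)" using qcomm_sym[OF r32] by simp
  from qcomm_power_right[OF this] have b: "u3 * u2 ^ n = qs (2 * int n) * (u2 ^ n * u3)" for n .
  have c: "P0 ^ n * u1 = u1 * P0 ^ n" for n using qcomm_powers[of P0 u1 0 n 1] P0_comm(1) by simp
  have d: "u2 ^ n * P1 = P1 * u2 ^ n" for n using qcomm_powers[of u2 P1 0 n 1] P1_comm(1) by simp
  have "u3 * (MM A C k l * u1)
    = u3 * (P1 ^ (A - k) * (u2 ^ (2 * k) * (u1 ^ (2 * l) * (P0 ^ (C - l) * u1))))"
    by (simp add: MM_def mult.assoc)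
  also have "\<dots> = u3 * (P1 ^ (A - k) * (u2 ^ (2 * k) * (u1 * (u1 ^ (2 * l) * P0 ^ (C - l)))))"
    unfolding c by (simp only: power_commutes mult.assoc[symmetric])
  also have "\<dots> = qs (2 * int (A - k) + 4 * int k) * (P1 ^ (A - k) * (u2 ^ (2 * k) * ((u3 * u1) * (u1 ^ (2 * l) * P0 ^ (C - l)))))"
    unfolding qcomm_left[OF a] qcomm_left[OF b] by (simp add: qp_norm)
  also have "u3 * u1 = P1 + qs 2 * (u2 * u2)" by (simp add: P1_def)
  also have "P1 ^ (A - k) * (u2 ^ (2 * k) * ((P1 + qs 2 * (u2 * u2)) * (u1 ^ (2 * l) * P0 ^ (C - l))))
      = MM (Suc A) C k l + qs 2 * MM (Suc A) C (Suc k) l"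
    unfolding MM_def using assms
    by (simp add: distrib_left distrib_right qp_norm Suc_diff_le qcomm_left[of _ _ 0, simplified, OF d] power_Suc2 del: power_Suc)
  finally show ?thesis using assms by (simp add: of_nat_diff algebra_simps)
qed

lemma u2_MM_u0:
  assumes "l \<le> C"
  shows "u2 * (MM A C k l * u0) = qs (2 * int C + 2 * int l) * (MM A (Suc C) k l + qs 2 * MM A (Suc C) k (Suc l))"
proof -
  have "P0 * u0 = qs 2 * (u0 * P0)" using qcomm_sym[OF P0_comm(3)] by simp
  from qcomm_powers[OF this, of _ 1] have a: "P0 ^ n * u0 = qs (2 * int n) * (u0 * P0 ^ n)" for n by simp
  have "u1 * u0 = qs 2 * (u0 * u1)" using qcomm_sym[OF r10] by simp
  from qcomm_powers[OF this, of _ 1] have b: "u1 ^ n * u0 = qs (2 * int n) * (u0 * u1 ^ n)" for n by simp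
  have c: "u2 * P1 ^ n = P1 ^ n * u2" for n using qcomm_powers[of u2 P1 0 1 n] P1_comm(1) by simp
  have d: "P0 * u1 ^ n = u1 ^ n * P0" for n using qcomm_powers[of P0 u1 0 1 n] P0_comm(1) by simp
  have "u2 * (MM A C k l * u0)
    = u2 * (P1 ^ (A - k) * (u2 ^ (2 * k) * (u1 ^ (2 * l) * (P0 ^ (C - l) * u0))))"
    by (simp add: MM_def mult.assoc)
  also have "\<dots> = qs (2 * int (C - l) + 4 * int l) * (P1 ^ (A - k) * (u2 ^ (2 * k) * ((u2 * u0) * (u1 ^ (2 * l) * P0 ^ (C - l)))))"
    unfolding a qcomm_left[of _ _ 0, simplified, OF c]
    by (simp add: qp_norm qcomm_left[OF b] power_commutes_left)
  also have "u2 * u0 = P0 + qs 2 * (u1 * u1)" by (simp add: P0_def)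
  also have "P1 ^ (A - k) * (u2 ^ (2 * k) * ((P0 + qs 2 * (u1 * u1)) * (u1 ^ (2 * l) * P0 ^ (C - l))))
      = MM A (Suc C) k l + qs 2 * MM A (Suc C) k (Suc l)"
    unfolding MM_def using assms
    by (simp add: distrib_left distrib_right qp_norm Suc_diff_le qcomm_left[of _ _ 0, simplified, OF d])
  finally show ?thesis using assms by (simp add: of_nat_diff algebra_simps)
qed

lemma P1_MM:
  assumes "k \<le> A"
  shows "P1 * (u2 ^ 2 * (MM A C k l * u1 ^ 2)) = MM (A + 2) (Suc C) (Suc k) (Suc l)"
proof -
  have c: "u2 ^ m * P1 ^ n = P1 ^ n * u2 ^ m" for m n using qcomm_powers[of u2 P1 0 m n] P1_comm(1) by simp
  have d: "P0 ^ n * u1 ^ m = u1 ^ m * P0 ^ n" for m n using qcomm_powers[of P0 u1 0 n m] P0_comm(1) by simp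
  have "P1 * (u2 ^ 2 * (MM A C k l * u1 ^ 2))
    = P1 * ((u2 ^ 2 * P1 ^ (A - k)) * (u2 ^ (2 * k) * (u1 ^ (2 * l) * (P0 ^ (C - l) * u1 ^ 2))))"
    by (simp add: MM_def mult.assoc)
  also have "\<dots> = (P1 * P1 ^ (A - k)) * ((u2 ^ 2 * u2 ^ (2 * k)) * ((u1 ^ (2 * l) * u1 ^ 2) * P0 ^ (C - l)))"
    unfolding c d by (simp only: mult.assoc)
  also have "\<dots> = MM (A + 2) (Suc C) (Suc k) (Suc l)"
    unfolding power_add[symmetric] power_Suc[symmetric] using assms by (simp only: MM_def) (simp add: Suc_diff_le del: power_Suc)
  finally show ?thesis .
qed

lemma MM_P0:
  assumes "l \<le> C"
  shows "u2 ^ 2 * (MM A C k l * (P0 * u1 ^ 2)) = MM (Suc A) (C + 2) (Suc k) (Suc l)"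
proof -
  have c: "u2 ^ m * P1 ^ n = P1 ^ n * u2 ^ m" for m n using qcomm_powers[of u2 P1 0 m n] P1_comm(1) by simp
  have d: "P0 ^ n * u1 ^ m = u1 ^ m * P0 ^ n" for m n using qcomm_powers[of P0 u1 0 n m] P0_comm(1) by simp
  have "u2 ^ 2 * (MM A C k l * (P0 * u1 ^ 2))
    = (u2 ^ 2 * P1 ^ (A - k)) * (u2 ^ (2 * k) * (u1 ^ (2 * l) * ((P0 ^ (C - l) * P0) * u1 ^ 2)))"
    by (simp add: MM_def mult.assoc)
  also have "\<dots> = P1 ^ (A - k) * ((u2 ^ 2 * u2 ^ (2 * k)) * ((u1 ^ (2 * l) * u1 ^ 2) * P0 ^ Suc (C - l)))"
    unfolding c power_Suc2[symmetric] d by (simp only: mult.assoc)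
  also have "\<dots> = MM (Suc A) (C + 2) (Suc k) (Suc l)"
    unfolding power_add[symmetric] using assms by (simp only: MM_def) (simp add: Suc_diff_le del: power_Suc)
  finally show ?thesis .
qed

lemma comb_u3:
  assumes "\<And>l. l \<le> C \<Longrightarrow> f (Suc A) l = 0"
  shows "u3 * (comb A C f * u1) = comb (Suc A) C (\<lambda>k l. qpow (2 * int A + 2 * int k) * (f k l + (if k = 0 then 0 else f (k - 1) l)))"
proof -
  have "u3 * (comb A C f * u1) = (\<Sum>k\<le>A. \<Sum>l\<le>C. s (qpow (2 * int A + 2 * int k) * f k l) * MM (Suc A) C k l)
     + (\<Sum>k\<le>A. \<Sum>l\<le>C. s (qpow (2 * int A + 2 * int (Suc k)) * f k l) * MM (Suc A) C (Suc k) l)"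
    unfolding comb_def sum.distrib[symmetric] sum_distrib_left sum_distrib_right
  proof (intro sum.cong refl)
    fix k l assume "k \<in> {..A}"
    then have "u3 * (s (f k l) * MM A C k l * u1) = s (f k l) * (qs (2 * int A + 2 * int k) * (MM (Suc A) C k l + qs 2 * MM (Suc A) C (Suc k) l))"
      by (simp add: u3_MM_u1 mult.assoc s_out)
    also have "\<dots> = s (qpow (2 * int A + 2 * int k) * f k l) * MM (Suc A) C k l
       + s (qpow (2 * int A + 2 * int (Suc k)) * f k l) * MM (Suc A) C (Suc k) l"
      by (simp add: distrib_left s_merge) (simp add: qpow_add algebra_simps)
    finally show "u3 * (s (f k l) * MM A C k l * u1) = \<dots>" .
  qed
  also have "(\<Sum>k\<le>A. \<Sum>l\<le>C. s (qpow (2 * int A + 2 * int k) * f k l) * MM (Suc A) C k l)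
     = (\<Sum>k\<le>Suc A. \<Sum>l\<le>C. s (qpow (2 * int A + 2 * int k) * f k l) * MM (Suc A) C k l)"
    using assms by simp
  also have "(\<Sum>k\<le>A. \<Sum>l\<le>C. s (qpow (2 * int A + 2 * int (Suc k)) * f k l) * MM (Suc A) C (Suc k) l)
     = (\<Sum>k\<le>Suc A. \<Sum>l\<le>C. s (qpow (2 * int A + 2 * int k) * (if k = 0 then 0 else f (k - 1) l)) * MM (Suc A) C k l)"
    by (subst sum.atMost_Suc_shift) simp
  finally show ?thesis
    by (simp only: comb_def sum.distrib[symmetric] distrib_left s_add distrib_right)
qed

lemma comb_u0:
  assumes "\<And>k. k \<le> A \<Longrightarrow> f k (Suc C) = 0"
  shows "u2 * (comb A C f * u0) = comb A (Suc C) (\<lambda>k l. qpow (2 * int C + 2 * int l) * (f k l + (if l = 0 then 0 else f k (l - 1))))"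
proof -
  have "u2 * (comb A C f * u0) = (\<Sum>k\<le>A. \<Sum>l\<le>C. s (qpow (2 * int C + 2 * int l) * f k l) * MM A (Suc C) k l)
     + (\<Sum>k\<le>A. \<Sum>l\<le>C. s (qpow (2 * int C + 2 * int (Suc l)) * f k l) * MM A (Suc C) k (Suc l))"
    unfolding comb_def sum.distrib[symmetric] sum_distrib_left sum_distrib_right
  proof (intro sum.cong refl)
    fix k l assume "l \<in> {..C}"
    then have "u2 * (s (f k l) * MM A C k l * u0) = s (f k l) * (qs (2 * int C + 2 * int l) * (MM A (Suc C) k l + qs 2 * MM A (Suc C) k (Suc l)))"
      by (simp add: u2_MM_u0 mult.assoc s_out)
    also have "\<dots> = s (qpow (2 * int C + 2 * int l) * f k l) * MM A (Suc C) k l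
       + s (qpow (2 * int C + 2 * int (Suc l)) * f k l) * MM A (Suc C) k (Suc l)"
      by (simp add: distrib_left s_merge) (simp add: qpow_add algebra_simps)
    finally show "u2 * (s (f k l) * MM A C k l * u0) = \<dots>" .
  qed
  also have "(\<Sum>k\<le>A. \<Sum>l\<le>C. s (qpow (2 * int C + 2 * int l) * f k l) * MM A (Suc C) k l)
     = (\<Sum>k\<le>A. \<Sum>l\<le>Suc C. s (qpow (2 * int C + 2 * int l) * f k l) * MM A (Suc C) k l)"
    using assms by simp
  also have "(\<Sum>k\<le>A. \<Sum>l\<le>C. s (qpow (2 * int C + 2 * int (Suc l)) * f k l) * MM A (Suc C) k (Suc l))
     = (\<Sum>k\<le>A. \<Sum>l\<le>Suc C. s (qpow (2 * int C + 2 * int l) * (if l = 0 then 0 else f k (l - 1))) * MM A (Suc C) k l)"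
    by (rule sum.cong[OF refl], subst sum.atMost_Suc_shift) simp
  finally show ?thesis
    by (simp only: comb_def sum.distrib[symmetric] distrib_left s_add distrib_right)
qed

lemma comb_P1:
  assumes "\<And>l. l \<le> C \<Longrightarrow> f (Suc A) l = 0"
  shows "P1 * (u2 ^ 2 * (comb A C f * u1 ^ 2)) = comb (A + 2) (Suc C) (\<lambda>k l. if k = 0 \<or> l = 0 then 0 else f (k - 1) (l - 1))"
proof -
  have "P1 * (u2 ^ 2 * (comb A C f * u1 ^ 2)) = (\<Sum>k\<le>A. \<Sum>l\<le>C. s (f k l) * MM (A + 2) (Suc C) (Suc k) (Suc l))"
    unfolding comb_def sum_distrib_left sum_distrib_right
    by (intro sum.cong refl) (simp add: P1_MM[unfolded numeral_2_eq_2] mult.assoc s_out numeral_2_eq_2 del: power_Suc)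
  also have "\<dots> = (\<Sum>k\<le>Suc A. \<Sum>l\<le>C. s (f k l) * MM (A + 2) (Suc C) (Suc k) (Suc l))"
    using assms by simp
  also have "\<dots> = comb (Suc (Suc A)) (Suc C) (\<lambda>k l. if k = 0 \<or> l = 0 then 0 else f (k - 1) (l - 1))"
    unfolding comb_def sum.atMost_Suc_shift[of _ "Suc A"] sum.atMost_Suc_shift[of _ C] by simp
  finally show ?thesis by simp
qed

lemma comb_P0:
  assumes "\<And>k. k \<le> A \<Longrightarrow> f k (Suc C) = 0"
  shows "u2 ^ 2 * (comb A C f * (P0 * u1 ^ 2)) = comb (Suc A) (C + 2) (\<lambda>k l. if k = 0 \<or> l = 0 then 0 else f (k - 1) (l - 1))"
proof -
  have "u2 ^ 2 * (comb A C f * (P0 * u1 ^ 2)) = (\<Sum>k\<le>A. \<Sum>l\<le>C. s (f k l) * MM (Suc A) (C + 2) (Suc k) (Suc l))"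
    unfolding comb_def sum_distrib_left sum_distrib_right
    by (intro sum.cong refl) (simp add: MM_P0[unfolded numeral_2_eq_2] mult.assoc s_out numeral_2_eq_2 del: power_Suc)
  also have "\<dots> = (\<Sum>k\<le>A. \<Sum>l\<le>Suc C. s (f k l) * MM (Suc A) (C + 2) (Suc k) (Suc l))"
    using assms by simp
  also have "\<dots> = comb (Suc A) (Suc (Suc C)) (\<lambda>k l. if k = 0 \<or> l = 0 then 0 else f (k - 1) (l - 1))"
    unfolding comb_def sum.atMost_Suc_shift[of _ A] sum.atMost_Suc_shift[of _ "Suc C"] by simp
  finally show ?thesis by simp
qed

end

context kron_alg begin

definition FS where "FS n = u2 ^ n * (SS n * u1 ^ n)"
definition FX where "FX n = u2 ^ n * (XX n * u1 ^ Suc n)"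

lemma u2n_u3: "u2 ^ n * u3 = qs (- 2 * int n) * (u3 * u2 ^ n)"
  using qcomm_powers[OF r32, of n 1] by simp

lemma u0_u1n: "u0 * u1 ^ n = qs (- 2 * int n) * (u1 ^ n * u0)"
  by (rule qcomm_power_right[OF r10])

lemma u2n_P1: "u2 ^ n * P1 = P1 * u2 ^ n"
  using qcomm_powers[of u2 P1 0 n 1] P1_comm(1) by simp

lemma FX_Suc: "FX (Suc n) = qs (- int n - 1) * (u3 * (FS (Suc n) * u1))
    - qs (5 * int n + 3) * (P1 * (u2 ^ 2 * (FS n * u1 ^ 2)))"
proof -
  have "u2 ^ Suc n * (u3 * (SS (Suc n) * u1 ^ Suc (Suc n))) = qs (- 2 * int (Suc n)) * (u3 * (FS (Suc n) * u1))"
    unfolding FS_def mult.assoc[symmetric] u2n_u3 power_Suc2[of u1 "Suc n"] ..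
  moreover have "u2 ^ Suc n * (P1 * (u2 * (SS n * u1 ^ Suc (Suc n)))) = P1 * (u2 ^ 2 * (FS n * u1 ^ 2))"
  proof -
    have "u2 ^ Suc n * (P1 * (u2 * (SS n * u1 ^ Suc (Suc n)))) = P1 * ((u2 ^ Suc n * u2) * (SS n * u1 ^ (n + 2)))"
      by (simp only: mult.assoc[symmetric] u2n_P1) simp
    also have "u2 ^ Suc n * u2 = u2 ^ 2 * u2 ^ n"
      by (simp only: power_add[symmetric] power_Suc2[symmetric]) simp
    finally show ?thesis by (simp only: FS_def power_add mult.assoc)
  qed
  ultimately show ?thesis
    by (simp add: FX_def XX_Suc left_diff_distrib right_diff_distrib qp_norm del: power_Suc) (rule qp_cong; simp)
qed

lemma FS_Suc: "FS (Suc (Suc n)) = qs (- int n - 3) * (u2 * (FX (Suc n) * u0))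
    - qs (5 * int n + 4) * (u2 ^ 2 * (FX n * (P0 * u1 ^ 2)))"
proof -
  have "u2 ^ Suc (Suc n) * (XX (Suc n) * (u0 * u1 ^ Suc (Suc n)))
      = qs (- 2 * int (Suc (Suc n))) * (u2 * (FX (Suc n) * u0))"
    unfolding u0_u1n FX_def by (simp add: qp_norm)
  moreover have "u2 ^ Suc (Suc n) * (XX n * (P0 * (u1 * u1 ^ Suc (Suc n)))) = u2 ^ 2 * (FX n * (P0 * u1 ^ 2))"
  proof -
    have c: "P0 * u1 ^ m = u1 ^ m * P0" for m using qcomm_powers[of P0 u1 0 1 m] P0_comm(1) by simp
    have e: "u1 * u1 ^ Suc (Suc n) = u1 ^ Suc n * u1 ^ 2"
      by (simp only: power_add[symmetric] power_Suc[symmetric]) simp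
    have f: "u2 ^ Suc (Suc n) = u2 ^ 2 * u2 ^ n" by (simp only: power_add[symmetric]) simp
    have "P0 * (u1 * u1 ^ Suc (Suc n)) = u1 ^ Suc n * (P0 * u1 ^ 2)"
      unfolding e by (simp only: mult.assoc[symmetric] c[of "Suc n"])
    then show ?thesis unfolding f FX_def by (simp only: mult.assoc)
  qed
  ultimately show ?thesis
    by (simp add: FS_def SS_Suc left_diff_distrib right_diff_distrib qp_norm del: power_Suc) (rule qp_cong; simp)
qed

text \<open>Through \<open>comb_u3\<close>, \<open>comb_P1\<close>, \<open>comb_u0\<close> and
  \<open>comb_P0\<close> the recursions \<open>FX_Suc\<close> and \<open>FS_Suc\<close> turn into
  \<open>cX_rec\<close> and \<open>cS_rec\<close>. The latter reaches back two steps, so FS is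
  computed directly for n = 0 and n = 1.\<close>

lemma FS_FX: "FS n = comb n n (cS n) \<and> FX n = comb (Suc n) n (cX n)"
proof (induction n rule: less_induct)
  case (less n)
  have S: "FS n = comb n n (cS n)"
  proof -
    consider "n = 0" | "n = 1" | m where "n = Suc (Suc m)"
      by (metis One_nat_def not0_implies_Suc)
    then show ?thesis
    proof cases
      case 1
      then show ?thesis by (simp add: FS_def SS_0 comb_def MM_def cS_def gexp_def)
    next
      case 2
      have u: "u0 * u1 = qs (-2) * (u1 * u0)" by (rule r10)
      have q1: "qbinom 1 1 = 1" by (simp add: qbinom_def qfact_def qint_1 qint_eq_0)
      have q0: "qbinom 0 1 = 0" using qbinom_eq_0[of 0 1] by simp
      have q: "cS 1 0 0 = qpow (-2)" "cS 1 1 0 = 1" "cS 1 0 1 = 1" "cS 1 1 1 = 0"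
        using q1 q0 by (simp_all add: cS_def gexp_def del: One_nat_def)
      have a: "P1 * P0 = (u3 * u1 - qs 2 * (u2 * u2)) * (u2 * u0 - qs 2 * (u1 * u1))"
        by (simp add: P1_def P0_def)
      have "comb 1 1 (cS 1) = qs (-2) * (P1 * P0) + P1 * u1 ^ 2 + u2 ^ 2 * P0"
        by (simp add: comb_def MM_def q[simplified] numeral_2_eq_2)
      also have "\<dots> = u2 * (Z * u1)"
        by (simp add: P1_def P0_def Z_def power2_eq_square algebra_simps qp_norm straighten)
      finally show ?thesis using 2 by (simp add: FS_def SS_1)
    next
      case 3
      have 1: "FX (Suc m) = comb (Suc (Suc m)) (Suc m) (cX (Suc m))" "FX m = comb (Suc m) m (cX m)"
        using less[of "Suc m"] less[of m] 3 by simp_all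
      show ?thesis unfolding 3 FS_Suc 1
        apply (subst comb_u0)
        subgoal by (rule cX_edge)
        apply (subst comb_P0)
        subgoal by (rule cX_edge)
        unfolding comb_scale numeral_2_eq_2 add_Suc_right add_0_right comb_diff cS_rec
        by (rule comb_cong) (simp add: algebra_simps qpow_merge)
    qed
  qed
  have "FX n = comb (Suc n) n (cX n)"
  proof (cases n)
    case 0
    have q: "qbinom 1 1 = 1" by (simp add: qbinom_def qfact_def qint_1 qint_eq_0)
    have q: "cX 0 0 0 = 1" "cX 0 1 0 = qpow 2"
      using q by (simp_all add: cX_def fexp_def del: One_nat_def)
    show ?thesis using 0
      by (simp add: FX_def XX_0 comb_def MM_def q[simplified] P1_def power2_eq_square numeral_2_eq_2)
  next
    case (Suc m)
    have 1: "FS (Suc m) = comb (Suc m) (Suc m) (cS (Suc m))" "FS m = comb m m (cS m)"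
      using less[of m] Suc S by simp_all
    show ?thesis unfolding Suc FX_Suc 1
      apply (subst comb_u3)
      subgoal by (rule cS_edge)
      apply (subst comb_P1)
      subgoal by (rule cS_edge)
      unfolding comb_scale numeral_2_eq_2 add_Suc_right add_0_right comb_diff cX_rec
      by (rule comb_cong) (simp add: algebra_simps qpow_merge)
  qed
  with S show ?case ..
qed

end

section \<open>Uniqueness of bar-invariant elements\<close>

context kron_alg begin

text \<open>Each further pair u3, u1 wrapped around the sum acts by \<open>comb_u3\<close>. Only the
  coefficient of the pure power of \<open>P1\<close> is tracked, as it will be the leading
  one.\<close>

lemma ex_u3_u1: "\<exists>f. u3 ^ b * u1 ^ b = comb b 0 f \<and> f 0 0 = qpow (int b * (int b - 1))"
proof (induction b)
  case 0
  show ?case by (rule exI[of _ "\<lambda>_ _. 1"]) (simp add: comb_def MM_def)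
next
  case (Suc b)
  then obtain f where f: "u3 ^ b * u1 ^ b = comb b 0 f" "f 0 0 = qpow (int b * (int b - 1))" by blast
  \<comment> \<open>\<open>comb\<close> sees f only inside its range; cutting f off outside supplies
    the vanishing that \<open>comb_u3\<close> asks for.\<close>
  define g where "g k l = (if k \<le> b \<and> l \<le> 0 then f k l else 0)" for k l :: nat
  have "u3 ^ Suc b * u1 ^ Suc b = u3 * (comb b 0 f * u1)"
    unfolding f(1)[symmetric] power_Suc2[of u1] by (simp add: mult.assoc)
  also have "comb b 0 f = comb b 0 g" by (rule comb_cong) (simp add: g_def)
  also have "u3 * (comb b 0 g * u1) = comb (Suc b) 0 (\<lambda>k l. qpow (2 * int b + 2 * int k) * (g k l + (if k = 0 then 0 else g (k - 1) l)))"
    by (rule comb_u3) (simp add: g_def)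
  finally show ?case
    by (intro exI conjI) (assumption, simp add: g_def f(2) qpow_merge algebra_simps)
qed

lemma ex_u2_u0: "\<exists>f. u2 ^ b * u0 ^ b = comb 0 b f \<and> f 0 0 = qpow (int b * (int b - 1))"
proof (induction b)
  case 0
  show ?case by (rule exI[of _ "\<lambda>_ _. 1"]) (simp add: comb_def MM_def)
next
  case (Suc b)
  then obtain f where f: "u2 ^ b * u0 ^ b = comb 0 b f" "f 0 0 = qpow (int b * (int b - 1))" by blast
  define g where "g k l = (if k \<le> 0 \<and> l \<le> b then f k l else 0)" for k l :: nat
  have "u2 ^ Suc b * u0 ^ Suc b = u2 * (comb 0 b f * u0)"
    unfolding f(1)[symmetric] power_Suc2[of u0] by (simp add: mult.assoc)
  also have "comb 0 b f = comb 0 b g" by (rule comb_cong) (simp add: g_def)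
  also have "u2 * (comb 0 b g * u0) = comb 0 (Suc b) (\<lambda>k l. qpow (2 * int b + 2 * int l) * (g k l + (if l = 0 then 0 else g k (l - 1))))"
    by (rule comb_u0) (simp add: g_def)
  finally show ?case
    by (intro exI conjI) (assumption, simp add: g_def f(2) qpow_merge algebra_simps)
qed

lemma power_swap:
  "u1 ^ a * P1 ^ b = qs (- 2 * int a * int b) * (P1 ^ b * u1 ^ a)"
  "P0 ^ a * P1 ^ b = qs (- 4 * int a * int b) * (P1 ^ b * P0 ^ a)"
  "u2 ^ a * P1 ^ b = P1 ^ b * u2 ^ a"
  "u1 ^ a * u2 ^ b = qs (- 2 * int a * int b) * (u2 ^ b * u1 ^ a)"
  "P0 ^ a * u2 ^ b = qs (- 2 * int a * int b) * (u2 ^ b * P0 ^ a)"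
  "P0 ^ a * u1 ^ b = u1 ^ b * P0 ^ a"
proof -
  show "u1 ^ a * P1 ^ b = qs (- 2 * int a * int b) * (P1 ^ b * u1 ^ a)"
    by (rule qcomm_powers[OF P1_comm(3)])
  show "P0 ^ a * P1 ^ b = qs (- 4 * int a * int b) * (P1 ^ b * P0 ^ a)"
    by (rule qcomm_powers[OF qcomm_sym[OF P1_P0]])
  show "u2 ^ a * P1 ^ b = P1 ^ b * u2 ^ a"
    using qcomm_powers[of u2 P1 0 a b] P1_comm(1) by simp
  show "u1 ^ a * u2 ^ b = qs (- 2 * int a * int b) * (u2 ^ b * u1 ^ a)"
    by (rule qcomm_powers[OF r21])
  show "P0 ^ a * u2 ^ b = qs (- 2 * int a * int b) * (u2 ^ b * P0 ^ a)"
    by (rule qcomm_powers[OF qcomm_sym[OF P0_comm(2)]])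
  show "P0 ^ a * u1 ^ b = u1 ^ b * P0 ^ a"
    using qcomm_powers[of P0 u1 0 a b] P0_comm(1) by simp
qed

lemma power_swap_left:
  "u1 ^ a * (P1 ^ b * z) = qs (- 2 * int a * int b) * (P1 ^ b * (u1 ^ a * z))"
  "P0 ^ a * (P1 ^ b * z) = qs (- 4 * int a * int b) * (P1 ^ b * (P0 ^ a * z))"
  "u2 ^ a * (P1 ^ b * z) = P1 ^ b * (u2 ^ a * z)"
  "u1 ^ a * (u2 ^ b * z) = qs (- 2 * int a * int b) * (u2 ^ b * (u1 ^ a * z))"
  "P0 ^ a * (u2 ^ b * z) = qs (- 2 * int a * int b) * (u2 ^ b * (P0 ^ a * z))"
  "P0 ^ a * (u1 ^ b * z) = u1 ^ b * (P0 ^ a * z)"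
  by (simp_all only: mult.assoc[symmetric] power_swap)

lemma power_merge: "w ^ a * w ^ b = (w::'a) ^ (a + b)" "w ^ a * (w ^ b * z) = w ^ (a + b) * (z::'a)"
  by (simp_all add: power_add mult.assoc)

lemma sum_offset:
  fixes b x :: nat
  shows "(\<Sum>k\<le>b + x. if x \<le> k then h (k - x) else 0) = (\<Sum>k\<le>b. h k :: 'a)"
proof (induction b)
  case 0
  have "(\<Sum>k\<le>x. if x \<le> k then h (k - x) else 0) = (\<Sum>k\<in>{x}. if x \<le> k then h (k - x) else 0)"
    by (rule sum.mono_neutral_right) auto
  then show ?case by simp
qed simp

lemma comb_offset:
  "(\<Sum>k\<le>b. \<Sum>l\<le>c. s (g k l) * MM (b + x) (c + y) (x + k) (y + l))
    = comb (b + x) (c + y) (\<lambda>k l. if x \<le> k \<and> y \<le> l then g (k - x) (l - y) else 0)"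
proof -
  have "comb (b + x) (c + y) (\<lambda>k l. if x \<le> k \<and> y \<le> l then g (k - x) (l - y) else 0)
    = (\<Sum>k\<le>b + x. if x \<le> k then \<Sum>l\<le>c + y. if y \<le> l then s (g (k - x) (l - y)) * MM (b + x) (c + y) (x + (k - x)) (y + (l - y)) else 0 else 0)"
    unfolding comb_def by (auto intro!: sum.cong sum.neutral)
  also have "\<dots> = (\<Sum>k\<le>b + x. if x \<le> k then \<Sum>l\<le>c. s (g (k - x) l) * MM (b + x) (c + y) (x + (k - x)) (y + l) else 0)"
    unfolding sum_offset[of y "\<lambda>l. s (g (k - x) l) * MM (b + x) (c + y) (x + (k - x)) (y + l)" for k] ..
  also have "\<dots> = (\<Sum>k\<le>b. \<Sum>l\<le>c. s (g k l) * MM (b + x) (c + y) (x + k) (y + l))"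
    by (rule sum_offset)
  finally show ?thesis ..
qed

text \<open>Triangular shape with a unit on the diagonal, which lets PBW elements be peeled off by
  induction on x + y.\<close>

definition leading :: "nat \<Rightarrow> nat \<Rightarrow> nat \<Rightarrow> nat \<Rightarrow> int \<Rightarrow> 'a \<Rightarrow> bool" where
  "leading A C x y m X \<longleftrightarrow> (\<exists>g. X = comb A C g \<and> (\<forall>k l. \<not> (x \<le> k \<and> y \<le> l) \<longrightarrow> g k l = 0) \<and> g x y = qpow m)"

lemma leadingI:
  assumes "f 0 0 = qpow a" "f' 0 0 = qpow a'"
    and X: "X = (\<Sum>k\<le>b. \<Sum>l\<le>c. s (f k 0 * f' 0 l * qpow (\<phi> k l)) * MM (b + x) (c + y) (x + k) (y + l))"
    and "m = a + a' + \<phi> 0 0"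
  shows "leading (b + x) (c + y) x y m X"
  unfolding leading_def X comb_offset[of "\<lambda>k l. f k 0 * f' 0 l * qpow (\<phi> k l)"]
  by (rule exI, rule conjI[OF refl]) (use assms in \<open>auto simp: qpow_add\<close>)

lemma leading_scale: "leading A C x y m X \<Longrightarrow> leading A C x y (e + m) (qs e * X)"
  unfolding leading_def by (force simp: comb_scale qpow_add)

text \<open>The \<open>sigma\<close>-image of \<open>pbw\<close> written out: reversed order,
  inverted q, and u_k replaced by q^(2k) u_k.\<close>

definition rpbw :: "nat \<Rightarrow> nat \<Rightarrow> nat \<Rightarrow> nat \<Rightarrow> 'a" where
  "rpbw a3 a2 a1 a0 = qs (- int (bexp (a3, a2, a1, a0)) + 2 * int a1 + 4 * int a2 + 6 * int a3)
     * (u0 ^ a0 * (u1 ^ a1 * (u2 ^ a2 * u3 ^ a3)))"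

definition RE :: "nat \<Rightarrow> nat \<Rightarrow> nat \<Rightarrow> nat \<Rightarrow> 'a" where
  "RE A C x y = rpbw (A - x) (2 * x - y) (2 * y - x) (C - y)"

text \<open>Three sources: \<open>bexp\<close>, the commutations that bring u1 next to u3 and u2
  next to u0, and the leading exponents in \<open>ex_u3_u1\<close> and
  \<open>ex_u2_u0\<close>.\<close>

definition topexp :: "nat \<Rightarrow> nat \<Rightarrow> nat \<Rightarrow> nat \<Rightarrow> int" where
  "topexp b3 b2 b1 b0 = int (bexp (b3, b2, b1, b0)) + 2 * int b2 * int b3 - 2 * int b3 * int b0 + 2 * int b1 * int b0
     + int b3 * (int b3 - 1) + int b0 * (int b0 - 1)"

lemma comb_rows: "comb b 0 f = (\<Sum>k\<le>b. s (f k 0) * (P1 ^ (b - k) * u2 ^ (2 * k)))"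
  "comb 0 b f = (\<Sum>l\<le>b. s (f 0 l) * (u1 ^ (2 * l) * P0 ^ (b - l)))"
  by (simp_all add: comb_def MM_def)

text \<open>Of the added factors, b3 copies of u1 are paired with u3 and b0 copies of u2 with u0.
  What is left of u2 and u1 joins the inner powers to u2^(2x) and u1^(2y), a shift of the index by
  exactly (x, y).\<close>

lemma leading_pbw:
  assumes e2: "b2 + y = 2 * x" and e1: "b1 + x = 2 * y"
  shows "leading (b3 + x) (b0 + y) x y (topexp b3 b2 b1 b0) (u2 ^ (b0 + y) * (pbw b3 b2 b1 b0 * u1 ^ (b3 + x)))"
proof -
  obtain f where f: "u3 ^ b3 * u1 ^ b3 = comb b3 0 f" "f 0 0 = qpow (int b3 * (int b3 - 1))" using ex_u3_u1 by blast
  obtain f' where f': "u2 ^ b0 * u0 ^ b0 = comb 0 b0 f'" "f' 0 0 = qpow (int b0 * (int b0 - 1))" using ex_u2_u0 by blast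
  have c1: "u2 ^ a * (u3 ^ b * z) = qs (- 2 * int a * int b) * (u3 ^ b * (u2 ^ a * z))" for a b z
    by (rule qcomm_left[OF qcomm_powers[OF r32]])
  have c2: "u0 ^ a * u1 ^ b = qs (- 2 * int a * int b) * (u1 ^ b * u0 ^ a)" for a b
    by (rule qcomm_powers[OF r10])
  have c3: "u2 ^ a * (u1 ^ b * z) = qs (2 * int a * int b) * (u1 ^ b * (u2 ^ a * z))" for a b z
    using qcomm_left[OF qcomm_sym[OF qcomm_powers[OF r21, of b a]]] by (simp add: mult.commute mult.left_commute)
  have c4: "u1 ^ a * (u0 ^ b) = qs (2 * int a * int b) * (u0 ^ b * u1 ^ a)" for a b
    using qcomm_sym[OF qcomm_powers[OF r10, of b a]] by (simp add: mult.commute mult.left_commute)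
  let ?e = "2 * int b2 * int b3 - 2 * int b3 * int b0 + 2 * int b1 * int b0"
  have i1: "int b1 + int x = 2 * int y" and i2: "int b2 + int y = 2 * int x" using e1 e2 by linarith+
  have "u2 ^ (b0 + y) * (u3 ^ b3 * (u2 ^ b2 * (u1 ^ b1 * (u0 ^ b0 * u1 ^ (b3 + x)))))
     = qs (- 2 * int (b0 + y) * int b3 - 2 * int b0 * int (b3 + x)) * (u3 ^ b3 * (u2 ^ (b0 + 2 * x) * (u1 ^ (b3 + 2 * y) * u0 ^ b0)))"
  proof -
    have "b0 + y + b2 = b0 + 2 * x" "b1 + (b3 + x) = b3 + 2 * y" using e1 e2 by simp_all
    moreover have "u2 ^ (b0 + y) * (u3 ^ b3 * (u2 ^ b2 * (u1 ^ b1 * (u0 ^ b0 * u1 ^ (b3 + x)))))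
     = qs (- 2 * int (b0 + y) * int b3 - 2 * int b0 * int (b3 + x)) * (u3 ^ b3 * (u2 ^ (b0 + y + b2) * (u1 ^ (b1 + (b3 + x)) * u0 ^ b0)))"
      by (simp add: c1 c2 qp_norm power_merge)
    ultimately show ?thesis by (simp only:)
  qed
  also have "u2 ^ (b0 + 2 * x) * (u1 ^ (b3 + 2 * y) * u0 ^ b0)
     = qs (2 * int (b0 + 2 * x) * int b3 + 4 * int y * int b0) * (u1 ^ b3 * (u2 ^ (2 * x) * ((u2 ^ b0 * u0 ^ b0) * u1 ^ (2 * y))))"
  proof -
    have "u2 ^ (b0 + 2 * x) * (u1 ^ (b3 + 2 * y) * u0 ^ b0) = u2 ^ (b0 + 2 * x) * (u1 ^ b3 * (u1 ^ (2 * y) * u0 ^ b0))"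
      by (simp add: power_add mult.assoc)
    also have "\<dots> = qs (2 * int (b0 + 2 * x) * int b3) * (u1 ^ b3 * (u2 ^ (b0 + 2 * x) * (qs (2 * int (2 * y) * int b0) * (u0 ^ b0 * u1 ^ (2 * y)))))"
      unfolding c3 c4 ..
    also have "u2 ^ (b0 + 2 * x) * (qs (2 * int (2 * y) * int b0) * (u0 ^ b0 * u1 ^ (2 * y)))
        = u2 ^ (2 * x) * (u2 ^ b0 * (qs (2 * int (2 * y) * int b0) * (u0 ^ b0 * u1 ^ (2 * y))))"
      by (simp add: power_add add.commute[of b0] mult.assoc)
    finally show ?thesis by (simp add: qp_norm)
  qed
  also have "qs (- 2 * int (b0 + y) * int b3 - 2 * int b0 * int (b3 + x)) * (u3 ^ b3 * (qs (2 * int (b0 + 2 * x) * int b3 + 4 * int y * int b0) * (u1 ^ b3 * (u2 ^ (2 * x) * ((u2 ^ b0 * u0 ^ b0) * u1 ^ (2 * y))))))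
     = qs ?e * ((u3 ^ b3 * u1 ^ b3) * (u2 ^ (2 * x) * ((u2 ^ b0 * u0 ^ b0) * u1 ^ (2 * y))))"
  proof -
    have "- 2 * int (b0 + y) * int b3 - 2 * int b0 * int (b3 + x) + (2 * int (b0 + 2 * x) * int b3 + 4 * int y * int b0)
       = 2 * (2 * int x - int y) * int b3 - 2 * int b3 * int b0 + 2 * (2 * int y - int x) * int b0" by (simp add: algebra_simps)
    also have "\<dots> = ?e" unfolding i1[symmetric] i2[symmetric] by simp
    finally show ?thesis by (simp add: qp_norm)
  qed
  also have "(u3 ^ b3 * u1 ^ b3) * (u2 ^ (2 * x) * ((u2 ^ b0 * u0 ^ b0) * u1 ^ (2 * y)))
     = (\<Sum>k\<le>b3. \<Sum>l\<le>b0. s (f k 0 * f' 0 l * qpow 0) * MM (b3 + x) (b0 + y) (x + k) (y + l))"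
    unfolding f f' comb_rows sum_distrib_left sum_distrib_right
  proof (subst sum.swap, intro sum.cong refl)
    fix k l
    show "s (f k 0) * (P1 ^ (b3 - k) * u2 ^ (2 * k)) * (u2 ^ (2 * x) * (s (f' 0 l) * (u1 ^ (2 * l) * P0 ^ (b0 - l)) * u1 ^ (2 * y)))
      = s (f k 0 * f' 0 l * qpow 0) * MM (b3 + x) (b0 + y) (x + k) (y + l)"
      by (simp add: MM_def mult.assoc s_out s_merge power_swap power_merge algebra_simps)
  qed
  finally have "u2 ^ (b0 + y) * (pbw b3 b2 b1 b0 * u1 ^ (b3 + x)) = qs (int (bexp (b3, b2, b1, b0)) + ?e) *
     (\<Sum>k\<le>b3. \<Sum>l\<le>b0. s (f k 0 * f' 0 l * qpow 0) * MM (b3 + x) (b0 + y) (x + k) (y + l))"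
    by (simp add: pbw_def qp_norm)
  moreover have "leading (b3 + x) (b0 + y) x y (int b3 * (int b3 - 1) + int b0 * (int b0 - 1))
     (\<Sum>k\<le>b3. \<Sum>l\<le>b0. s (f k 0 * f' 0 l * qpow 0) * MM (b3 + x) (b0 + y) (x + k) (y + l))"
    by (rule leadingI[where \<phi> = "\<lambda>_ _. 0" and f = f and f' = f', OF f(2) f'(2) refl]) simp
  from leading_scale[OF this, of "int (bexp (b3, b2, b1, b0)) + ?e"]
  have "leading (b3 + x) (b0 + y) x y (topexp b3 b2 b1 b0) (qs (int (bexp (b3, b2, b1, b0)) + ?e) *
     (\<Sum>k\<le>b3. \<Sum>l\<le>b0. s (f k 0 * f' 0 l * qpow 0) * MM (b3 + x) (b0 + y) (x + k) (y + l)))"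
    by (simp add: topexp_def algebra_simps)
  ultimately show ?thesis by simp
qed

lemma int_choose_two: "2 * int (n choose 2) = int n * (int n - 1)"
  by (induction n) (simp_all add: choose_two_0 choose_two_Suc algebra_simps)

text \<open>In reversed order the paired factors already stand side by side, and only the resulting
  cluster monomials must be sorted. The leading exponent then differs from that of
  \<open>pbw\<close> by precisely N, which makes the invariance condition comparable at the leading
  index.\<close>

lemma leading_rpbw:
  assumes e2: "b2 + y = 2 * x" and e1: "b1 + x = 2 * y"
  shows "leading (b3 + x) (b0 + y) x y (topexp b3 b2 b1 b0 - Nexp (b3, b2, b1, b0))
     (u2 ^ (b0 + y) * (rpbw b3 b2 b1 b0 * u1 ^ (b3 + x)))"
proof -
  obtain f where f: "u3 ^ b3 * u1 ^ b3 = comb b3 0 f" "f 0 0 = qpow (int b3 * (int b3 - 1))" using ex_u3_u1 by blast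
  obtain f' where f': "u2 ^ b0 * u0 ^ b0 = comb 0 b0 f'" "f' 0 0 = qpow (int b0 * (int b0 - 1))" using ex_u2_u0 by blast
  \<comment> \<open>The powers of q from sorting u1 and \<open>P0\<close> past \<open>P1\<close> and
    u2. They vary with k and l, but only the value at (0, 0) enters the leading exponent.\<close>
  define \<phi> where "\<phi> k l = - 2 * int b1 * int (b3 - k) - 4 * int (b0 - l) * int (b3 - k) - 4 * int l * int (b3 - k)
    - 2 * int (b0 - l) * int (b2 + 2 * k) - 2 * int b1 * int (b2 + 2 * k) - 4 * int l * int (b2 + 2 * k)" for k l :: nat
  let ?S = "\<Sum>k\<le>b3. \<Sum>l\<le>b0. s (f k 0 * f' 0 l * qpow (\<phi> k l)) * MM (b3 + x) (b0 + y) (x + k) (y + l)"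
  have "u2 ^ (b0 + y) * (u0 ^ b0 * (u1 ^ b1 * (u2 ^ b2 * (u3 ^ b3 * u1 ^ (b3 + x)))))
    = u2 ^ y * ((u2 ^ b0 * u0 ^ b0) * (u1 ^ b1 * (u2 ^ b2 * ((u3 ^ b3 * u1 ^ b3) * u1 ^ x))))"
    by (simp add: power_add mult.assoc add.commute[of b0])
  also have "\<dots> = ?S"
    unfolding f f' comb_rows sum_distrib_left sum_distrib_right
  proof (intro sum.cong refl)
    fix k l
    have a: "y + (b2 + 2 * k) = 2 * (x + k)" "2 * l + (b1 + x) = 2 * (y + l)" using e1 e2 by simp_all
    have "u2 ^ y * ((u1 ^ (2 * l) * P0 ^ (b0 - l)) * (u1 ^ b1 * (u2 ^ b2 * ((P1 ^ (b3 - k) * u2 ^ (2 * k)) * u1 ^ x))))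
      = u2 ^ y * (u1 ^ (2 * l) * (P0 ^ (b0 - l) * (u1 ^ b1 * (P1 ^ (b3 - k) * (u2 ^ (b2 + 2 * k) * u1 ^ x)))))"
      by (simp add: mult.assoc power_swap_left(3) power_merge)
    also have "\<dots> = qs (\<phi> k l) * (P1 ^ (b3 - k) * (u2 ^ (y + (b2 + 2 * k)) * (u1 ^ (2 * l + (b1 + x)) * P0 ^ (b0 - l))))"
      by (simp add: power_swap_left power_swap power_merge qp_norm) (rule qp_cong; simp add: \<phi>_def algebra_simps)
    also have "\<dots> = qs (\<phi> k l) * MM (b3 + x) (b0 + y) (x + k) (y + l)"
      unfolding a by (simp add: MM_def)
    finally show "u2 ^ y * (s (f' 0 l) * (u1 ^ (2 * l) * P0 ^ (b0 - l)) * (u1 ^ b1 * (u2 ^ b2 * (s (f k 0) * (P1 ^ (b3 - k) * u2 ^ (2 * k)) * u1 ^ x))))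
       = s (f k 0 * f' 0 l * qpow (\<phi> k l)) * MM (b3 + x) (b0 + y) (x + k) (y + l)"
      by (simp add: mult.assoc s_out s_merge) (simp add: s_merge[symmetric] mult.commute[of "f' 0 l"] mult.assoc)
  qed
  finally have "u2 ^ (b0 + y) * (rpbw b3 b2 b1 b0 * u1 ^ (b3 + x)) =
     qs (- int (bexp (b3, b2, b1, b0)) + 2 * int b1 + 4 * int b2 + 6 * int b3) * ?S"
    by (simp add: rpbw_def qp_norm)
  moreover have "leading (b3 + x) (b0 + y) x y (int b3 * (int b3 - 1) + int b0 * (int b0 - 1) + \<phi> 0 0) ?S"
    by (rule leadingI[where \<phi> = \<phi> and f = f and f' = f', OF f(2) f'(2) refl]) simp
  from leading_scale[OF this, of "- int (bexp (b3, b2, b1, b0)) + 2 * int b1 + 4 * int b2 + 6 * int b3"]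
  have "leading (b3 + x) (b0 + y) x y (topexp b3 b2 b1 b0 - Nexp (b3, b2, b1, b0))
     (qs (- int (bexp (b3, b2, b1, b0)) + 2 * int b1 + 4 * int b2 + 6 * int b3) * ?S)"
  proof (rule back_subst[of "\<lambda>m. leading (b3 + x) (b0 + y) x y m _"])
    have "2 * int (bexp (b3, b2, b1, b0)) = int b3 * (int b3 - 1) + int b2 * (int b2 - 1) + int b1 * (int b1 - 1) + int b0 * (int b0 - 1)"
      by (simp add: int_choose_two[symmetric])
    then show "- int (bexp (b3, b2, b1, b0)) + 2 * int b1 + 4 * int b2 + 6 * int b3 + (int b3 * (int b3 - 1) + int b0 * (int b0 - 1) + \<phi> 0 0)
      = topexp b3 b2 b1 b0 - Nexp (b3, b2, b1, b0)"
      unfolding topexp_def \<phi>_def Nexp.simps by (simp add: algebra_simps power2_eq_square del: bexp.simps)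
  qed
  ultimately show ?thesis by simp
qed

end

lemma finite_idx [simp]: "finite (idx A C)"
  by (rule finite_subset[of _ "{..A} \<times> {..C}"]) (auto simp: idx_def)

context kron_alg begin

text \<open>Eigenvalue separation without inverses: for a relation R = 0, the element w R - q^t0 R w
  loses the terms of exponent t0, and every other term is multiplied by a nonzero scalar and by w on
  the right. The induction counts the exponents still to be removed.\<close>

lemma qcomm_separate:
  assumes "finite I" "\<And>i. i \<in> I \<Longrightarrow> w * X i = qs (\<phi> i) * (X i * w)" "(\<Sum>i\<in>I. s (f i) * X i) = 0"
  shows "\<exists>N. (\<Sum>i\<in>{i \<in> I. \<phi> i = t}. s (f i) * X i) * w ^ N = 0"
  using assms
proof (induction "card (\<phi> ` I - {t})" arbitrary: I X f)
  case 0
  then have "{i \<in> I. \<phi> i = t} = I" by auto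
  then show ?case using 0 by (intro exI[of _ 0]) simp
next
  case (Suc n)
  then obtain t0 where t0: "t0 \<in> \<phi> ` I" "t0 \<noteq> t"
    by (metis Diff_iff card.empty equals0I insertI1 old.nat.distinct(2))
  define I' where "I' = {i \<in> I. \<phi> i \<noteq> t0}"
  define f' where "f' i = f i * (qpow (\<phi> i) - qpow t0)" for i
  have im: "\<phi> ` I' - {t} = (\<phi> ` I - {t}) - {t0}" by (auto simp: I'_def)
  have "card (\<phi> ` I' - {t}) = n"
    unfolding im using Suc(2) t0 Suc(3) by (simp add: card_Diff_singleton_if)
  moreover have "finite I'" using Suc(3) by (simp add: I'_def)
  moreover have "w * (X i * w) = qs (\<phi> i) * (X i * w * w)" if "i \<in> I'" for i
    using Suc(4)[of i] that by (simp add: I'_def mult.assoc[symmetric])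
  moreover have "(\<Sum>i\<in>I'. s (f' i) * (X i * w)) = 0"
  proof -
    have "(\<Sum>i\<in>I'. s (f' i) * (X i * w)) = (\<Sum>i\<in>I. s (f' i) * (X i * w))"
      using Suc(3) by (intro sum.mono_neutral_left) (auto simp: I'_def f'_def)
    also have "\<dots> = (\<Sum>i\<in>I. w * (s (f i) * X i) - qs t0 * (s (f i) * X i) * w)"
    proof (rule sum.cong[OF refl])
      fix i assume "i \<in> I"
      then have "w * (s (f i) * X i) = s (f i) * (qs (\<phi> i) * (X i * w))"
        using Suc(4) by (metis s_comm mult.assoc)
      then show "s (f' i) * (X i * w) = w * (s (f i) * X i) - qs t0 * (s (f i) * X i) * w"
        by (simp add: f'_def s_mult s_diff algebra_simps)
    qed
    also have "\<dots> = w * (\<Sum>i\<in>I. s (f i) * X i) - qs t0 * (\<Sum>i\<in>I. s (f i) * X i) * w"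
      by (simp add: sum_subtractf sum_distrib_left sum_distrib_right)
    also have "\<dots> = 0" unfolding Suc(5) by simp
    finally show ?thesis .
  qed
  ultimately obtain N where N: "(\<Sum>i\<in>{i \<in> I'. \<phi> i = t}. s (f' i) * (X i * w)) * w ^ N = 0"
    using Suc(1)[of I' "\<lambda>i. X i * w" f'] by auto
  define c where "c = qpow t - qpow t0"
  have c: "c \<noteq> 0" using t0(2) by (simp add: c_def qpow_inj)
  have "(\<Sum>i\<in>{i \<in> I'. \<phi> i = t}. s (f' i) * (X i * w)) = s c * ((\<Sum>i\<in>{i \<in> I. \<phi> i = t}. s (f i) * X i) * w)"
    unfolding sum_distrib_left sum_distrib_right
  proof (rule sum.cong)
    show "{i \<in> I'. \<phi> i = t} = {i \<in> I. \<phi> i = t}" using t0(2) by (auto simp: I'_def)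
    fix i assume "i \<in> {i \<in> I. \<phi> i = t}"
    then have "f' i = c * f i" by (simp add: f'_def c_def)
    then show "s (f' i) * (X i * w) = s c * (s (f i) * X i * w)" by (simp add: s_mult mult.assoc)
  qed
  with N have "s c * ((\<Sum>i\<in>{i \<in> I. \<phi> i = t}. s (f i) * X i) * w ^ Suc N) = 0"
    by (simp add: mult.assoc)
  then have "s (inverse c) * (s c * ((\<Sum>i\<in>{i \<in> I. \<phi> i = t}. s (f i) * X i) * w ^ Suc N)) = 0" by simp
  then show ?case unfolding s_merge using c by (intro exI[of _ "Suc N"]) simp
qed

lemma u1_MM: "k \<le> A \<Longrightarrow> u1 * MM A C k l = qs (- 2 * int A - 2 * int k) * (MM A C k l * u1)"
proof -
  assume k: "k \<le> A"
  have "u1 * MM A C k l = u1 ^ 1 * MM A C k l" by simp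
  also have "\<dots> = qs (- 2 * int A - 2 * int k) * (MM A C k l * u1 ^ 1)"
    unfolding MM_def mult.assoc power_swap power_swap_left
    using k by (simp add: qp_norm power_commutes_left[of u1] of_nat_diff) (rule qp_cong; simp)
  finally show ?thesis by simp
qed

lemma u2_MM: "l \<le> C \<Longrightarrow> u2 * MM A C k l = qs (2 * int C + 2 * int l) * (MM A C k l * u2)"
proof -
  assume l: "l \<le> C"
  have "MM A C k l * u2 ^ 1 = P1 ^ (A - k) * (u2 ^ (2 * k) * (u1 ^ (2 * l) * (P0 ^ (C - l) * u2 ^ 1)))"
    by (simp only: MM_def mult.assoc)
  also have "\<dots> = qs (- 2 * int C - 2 * int l) * (u2 ^ 1 * MM A C k l)"
    unfolding MM_def power_swap power_swap_left
    using l by (simp add: qp_norm power_swap_left power_swap_left(3)[of 1, simplified] power_swap power_commutes_left[of u2] of_nat_diff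
       power_swap_left(4)[of _ 1, simplified])
      (rule qp_cong; simp)
  finally show ?thesis by (simp add: qp_norm)
qed

text \<open>A hypothesis of the results that follow; for the quantum group it is established through
  the module of functions.\<close>

definition nonvanishing :: bool where
  "nonvanishing \<longleftrightarrow> (\<forall>c i j k l. s c * (P1 ^ i * (u2 ^ j * (u1 ^ k * P0 ^ l))) = 0 \<longrightarrow> c = 0)"

text \<open>The exponent with which u1 passes \<open>MM A C k l\<close> depends on k but not on l,
  that of u2 on l but not on k. Separating first by u1 and then by u2 isolates one monomial.\<close>

lemma comb_eq_0:
  assumes nonvanishing "comb A C f = 0" "k \<le> A" "l \<le> C"
  shows "f k l = 0"
proof -
  have "(\<Sum>(k, l)\<in>{..A} \<times> {..C}. s (f k l) * MM A C k l) = 0"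
    using assms(2) by (simp add: comb_def sum.cartesian_product)
  then have "(\<Sum>p\<in>{..A} \<times> {..C}. s (f (fst p) (snd p)) * MM A C (fst p) (snd p)) = 0"
    by (simp add: case_prod_unfold)
  from qcomm_separate[where w = u1 and X = "\<lambda>p. MM A C (fst p) (snd p)" and \<phi> = "\<lambda>p. - 2 * int A - 2 * int (fst p)"
      and f = "\<lambda>p. f (fst p) (snd p)" and t = "- 2 * int A - 2 * int k", OF _ _ this]
  obtain N where N: "(\<Sum>p\<in>{p \<in> {..A} \<times> {..C}. - 2 * int A - 2 * int (fst p) = - 2 * int A - 2 * int k}.
     s (f (fst p) (snd p)) * MM A C (fst p) (snd p)) * u1 ^ N = 0"
    by (auto simp: u1_MM)
  have "{p \<in> {..A} \<times> {..C}. - 2 * int A - 2 * int (fst p) = - 2 * int A - 2 * int k} = Pair k ` {..C}"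
    using assms(3) by auto
  with N have N: "(\<Sum>l\<le>C. s (f k l) * (MM A C k l * u1 ^ N)) = 0"
    by (simp add: sum.reindex inj_on_def sum_distrib_right mult.assoc)
  have "u2 * (MM A C k l * u1 ^ N) = qs (2 * int C + 2 * int l + 2 * int N) * (MM A C k l * u1 ^ N * u2)" if "l \<le> C" for l
  proof -
    have "u2 * u1 ^ N = qs (2 * int N) * (u1 ^ N * u2)"
      using qcomm_sym[OF power_swap(4)[of N 1]] by simp
    then show ?thesis using u2_MM[OF that, of A k]
      by (simp add: mult.assoc[symmetric]) (simp add: qp_norm)
  qed
  from qcomm_separate[where w = u2 and X = "\<lambda>l. MM A C k l * u1 ^ N" and \<phi> = "\<lambda>l. 2 * int C + 2 * int l + 2 * int N"
      and f = "\<lambda>l. f k l" and I = "{..C}" and t = "2 * int C + 2 * int l + 2 * int N", OF _ this N]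
  obtain N' where N': "(\<Sum>l'\<in>{l' \<in> {..C}. 2 * int C + 2 * int l' + 2 * int N = 2 * int C + 2 * int l + 2 * int N}.
     s (f k l') * (MM A C k l' * u1 ^ N)) * u2 ^ N' = 0" by auto
  have "{l' \<in> {..C}. 2 * int C + 2 * int l' + 2 * int N = 2 * int C + 2 * int l + 2 * int N} = {l}"
    using assms(4) by auto
  with N' have "s (f k l) * (MM A C k l * (u1 ^ N * u2 ^ N')) = 0" by (simp add: mult.assoc)
  moreover have "\<exists>e i j. MM A C k l * (u1 ^ N * u2 ^ N') = qs e * (P1 ^ (A - k) * (u2 ^ i * (u1 ^ j * P0 ^ (C - l))))"
    by (simp add: MM_def mult.assoc power_swap power_swap_left power_merge qp_norm) blast
  ultimately obtain e i j where "s (f k l * qpow e) * (P1 ^ (A - k) * (u2 ^ i * (u1 ^ j * P0 ^ (C - l)))) = 0"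
    by (auto simp: s_merge)
  then have "f k l * qpow e = 0" using assms(1) unfolding nonvanishing_def by blast
  then show ?thesis by simp
qed

lemma leading_EE:
  assumes "(x, y) \<in> idx A C"
  shows "\<exists>m. leading A C x y m (u2 ^ C * (EE A C x y * u1 ^ A))
     \<and> leading A C x y (m - Nexp (A, 0, 0, C)) (u2 ^ C * (RE A C x y * u1 ^ A))"
proof -
  have xy: "x \<le> A" "y \<le> C" "y \<le> 2 * x" "x \<le> 2 * y" using assms by (auto simp: idx_def)
  let ?b3 = "A - x" and ?b2 = "2 * x - y" and ?b1 = "2 * y - x" and ?b0 = "C - y"
  have e: "?b2 + y = 2 * x" "?b1 + x = 2 * y" "?b3 + x = A" "?b0 + y = C" using xy by simp_all
  \<comment> \<open>Both generating steps of the order preserve the sum of the entries and the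
    weight 7 a3 + 5 a2 + 3 a1 + a0, hence also N.\<close>
  have "Nexp (A, 0, 0, C) = Nexp (?b3, ?b2, ?b1, ?b0)"
    using xy by (simp add: of_nat_diff algebra_simps)
  with leading_pbw[OF e(1,2), of ?b3 ?b0] leading_rpbw[OF e(1,2), of ?b3 ?b0] show ?thesis
    unfolding e EE_def RE_def by auto
qed

text \<open>\<open>d'\<close> stands for the conjugate of \<open>d\<close>. At the index (x, y),
  smaller terms vanish by induction and the remaining ones do not reach (x, y), so the equation
  reduces to d' = d there; \<open>self\<close> expresses that no nonzero element of q Z[q] is fixed
  by conjugation.\<close>

theorem bar_invariant_eq_0:
  assumes nonvanishing
    and inv: "(\<Sum>(x, y)\<in>idx A C. s (d' x y) * RE A C x y)
       = qs (- Nexp (A, 0, 0, C)) * (\<Sum>(x, y)\<in>idx A C. s (d x y) * EE A C x y)"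
    and self: "\<And>x y. d' x y = d x y \<Longrightarrow> d x y = 0"
    and zero: "\<And>x y. d x y = 0 \<Longrightarrow> d' x y = 0"
    and "(x, y) \<in> idx A C"
  shows "d x y = 0"
  using assms(5)
proof (induction "x + y" arbitrary: x y rule: less_induct)
  case less
  let ?N = "Nexp (A, 0, 0, C)"
  define L where "L x y m g g' \<longleftrightarrow>
      u2 ^ C * (EE A C x y * u1 ^ A) = comb A C g \<and> (\<forall>k l. \<not> (x \<le> k \<and> y \<le> l) \<longrightarrow> g k l = 0) \<and> g x y = qpow m
    \<and> u2 ^ C * (RE A C x y * u1 ^ A) = comb A C g' \<and> (\<forall>k l. \<not> (x \<le> k \<and> y \<le> l) \<longrightarrow> g' k l = 0) \<and> g' x y = qpow (m - ?N)"
    for x y m g g'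
  have "\<exists>m g g'. L (fst p) (snd p) m g g'" if "p \<in> idx A C" for p
  proof -
    have "(fst p, snd p) \<in> idx A C" using that by simp
    from leading_EE[OF this] show ?thesis unfolding leading_def L_def
      by (elim exE conjE) (intro exI conjI; assumption)
  qed
  then obtain m g g' where L: "\<And>p. p \<in> idx A C \<Longrightarrow> L (fst p) (snd p) (m p) (g p) (g' p)"
    by metis
  note g = L[unfolded L_def]
  have gE: "comb A C (g p) = u2 ^ C * (EE A C (fst p) (snd p) * u1 ^ A)"
    and gR: "comb A C (g' p) = u2 ^ C * (RE A C (fst p) (snd p) * u1 ^ A)" if "p \<in> idx A C" for p
    using g[OF that] by simp_all
  have D: "u2 ^ C * ((\<Sum>(x, y)\<in>idx A C. s (d x y) * EE A C x y) * u1 ^ A)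
     = comb A C (\<lambda>k l. \<Sum>p\<in>idx A C. d (fst p) (snd p) * g p k l)"
    unfolding comb_sum[symmetric] comb_scale[symmetric] sum_distrib_left sum_distrib_right
    by (rule sum.cong) (auto simp: gE mult.assoc s_out case_prod_unfold)
  have D': "u2 ^ C * ((\<Sum>(x, y)\<in>idx A C. s (d' x y) * RE A C x y) * u1 ^ A)
     = comb A C (\<lambda>k l. \<Sum>p\<in>idx A C. d' (fst p) (snd p) * g' p k l)"
    unfolding comb_sum[symmetric] comb_scale[symmetric] sum_distrib_left sum_distrib_right
    by (rule sum.cong) (auto simp: gR mult.assoc s_out case_prod_unfold)
  have "comb A C (\<lambda>k l. \<Sum>p\<in>idx A C. d' (fst p) (snd p) * g' p k l)
     = qs (- ?N) * comb A C (\<lambda>k l. \<Sum>p\<in>idx A C. d (fst p) (snd p) * g p k l)"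
    unfolding D[symmetric] D'[symmetric] inv mult.assoc by (simp add: s_out)
  then have "comb A C (\<lambda>k l. (\<Sum>p\<in>idx A C. d' (fst p) (snd p) * g' p k l)
     - qpow (- ?N) * (\<Sum>p\<in>idx A C. d (fst p) (snd p) * g p k l)) = 0"
    unfolding comb_scale comb_diff[symmetric] by simp
  from comb_eq_0[OF assms(1) this, of x y] less.prems
  have eq: "(\<Sum>p\<in>idx A C. d' (fst p) (snd p) * g' p x y) = qpow (- ?N) * (\<Sum>p\<in>idx A C. d (fst p) (snd p) * g p x y)"
    by (auto simp: idx_def)
  have others: "d (fst p) (snd p) = 0 \<or> g p x y = 0 \<and> g' p x y = 0" if "p \<in> idx A C" "p \<noteq> (x, y)" for p
  proof (cases "fst p \<le> x \<and> snd p \<le> y")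
    case True
    then have "fst p + snd p < x + y" using that(2) by (cases p) auto
    then show ?thesis using less.hyps[of "fst p" "snd p"] that(1) by simp
  next
    case False
    then show ?thesis using g[OF that(1)] by blast
  qed
  have single: "(\<Sum>p\<in>idx A C. h p) = h (x, y)" if "\<And>p. p \<in> idx A C \<Longrightarrow> p \<noteq> (x, y) \<Longrightarrow> h p = 0" for h :: "nat \<times> nat \<Rightarrow> K"
    using sum.mono_neutral_right[of "idx A C" "{(x, y)}" h] that less.prems by simp
  have "(\<Sum>p\<in>idx A C. d (fst p) (snd p) * g p x y) = d x y * qpow (m (x, y))"
    using g[OF less.prems] by (subst single) (auto dest: others)
  moreover have "(\<Sum>p\<in>idx A C. d' (fst p) (snd p) * g' p x y) = d' x y * qpow (m (x, y) - ?N)"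
    using g[OF less.prems] by (subst single) (auto dest: others simp: zero)
  ultimately have "d' x y * qpow (m (x, y) - ?N) = d x y * qpow (m (x, y) - ?N)"
    using eq by (simp add: qpow_merge mult.left_commute del: Nexp.simps)
  then have "d' x y = d x y" by simp
  then show ?case by (rule self)
qed

end

section \<open>Relations between root vectors\<close>

text \<open>The Serre relations in factored form: with d = y x - q^-2 x y they say that [d, x]
  q-commutes with x and [y, d] with y.\<close>

locale uq_plus = scalars s for s :: "K \<Rightarrow> 'a::ring_1" +
  fixes x y :: 'a
  assumes serre_x: "((y * x - qs (-2) * (x * y)) * x - x * (y * x - qs (-2) * (x * y))) * x
      = qs 2 * (x * ((y * x - qs (-2) * (x * y)) * x - x * (y * x - qs (-2) * (x * y))))"
    and serre_y: "y * (y * (y * x - qs (-2) * (x * y)) - (y * x - qs (-2) * (x * y)) * y)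
      = qs 2 * ((y * (y * x - qs (-2) * (x * y)) - (y * x - qs (-2) * (x * y)) * y) * y)"
begin

text \<open>Up to scaling, \<open>d\<close> and \<open>psi\<close> are imaginary root vectors of
  weight alpha_1 + alpha_2 and twice that. The multiple of d^2 in \<open>h\<close> symmetrises 2
  [psi, x] into (q^2 + q^-2) [d, [d, x]], the behaviour of a Heisenberg generator.\<close>

definition d where "d = y * x - qs (-2) * (x * y)"
definition \<delta> where "\<delta> z = d * z - z * d"
definition psi where "psi = y * \<delta> x - qs (-2) * (\<delta> x * y)"
definition h where "h = psi + psi - (qs 2 - qs (-2)) * (d * d)"
definition \<eta> where "\<eta> z = h * z - z * h"

lemma \<delta>_rules: "\<delta> (a + b) = \<delta> a + \<delta> b" "\<delta> (a - b) = \<delta> a - \<delta> b" "\<delta> (qs m * a) = qs m * \<delta> a"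
  "\<delta> (a * b) = \<delta> a * b + a * \<delta> b" "\<delta> d = 0" "\<delta> (qs m) = 0" "\<delta> 0 = 0"
  by (simp_all add: \<delta>_def algebra_simps qp_norm)

lemma \<eta>_rules: "\<eta> (a + b) = \<eta> a + \<eta> b" "\<eta> (a - b) = \<eta> a - \<eta> b" "\<eta> (qs m * a) = qs m * \<eta> a"
  "\<eta> (a * b) = \<eta> a * b + a * \<eta> b" "\<eta> (qs m) = 0"
  by (simp_all add: \<eta>_def algebra_simps qp_norm)

lemma R01: "\<delta> x * x = qs 2 * (x * \<delta> x)"
  using serre_x by (simp only: \<delta>_def d_def)

lemma R01_y: "y * \<delta> y = qs 2 * (\<delta> y * y)"
proof -
  have "y * (- \<delta> y) = qs 2 * ((- \<delta> y) * y)"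
    using serre_y unfolding \<delta>_def d_def by simp
  then show ?thesis by simp
qed

lemma yx: "y * x = d + qs (-2) * (x * y)" "y * (x * z) = d * z + qs (-2) * (x * (y * z))"
  by (simp_all add: d_def algebra_simps)

text \<open>Applying the derivation \<open>\<delta>\<close> to d = y x - q^-2 x y gives 0, which
  trades \<open>\<delta> x\<close> for \<open>\<delta> y\<close>.\<close>

lemma psi_alt: "psi = qs (-2) * (x * \<delta> y) - \<delta> y * x"
proof -
  have "\<delta> d = 0" by (simp add: \<delta>_def)
  then have "\<delta> (y * x - qs (-2) * (x * y)) = 0" by (simp only: d_def)
  then show ?thesis by (simp add: \<delta>_rules psi_def algebra_simps)
qed

lemma psi_x: "psi * x - x * psi = qs 2 * (d * \<delta> x) - qs (-2) * (\<delta> x * d)"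
proof -
  have xa: "x * \<delta> x = qs (-2) * (\<delta> x * x)" unfolding R01 by (simp add: qp_norm)
  have "psi * x = y * (\<delta> x * x) - qs (-2) * (\<delta> x * (y * x))"
    by (simp add: psi_def algebra_simps qp_norm)
  also have "y * (\<delta> x * x) = qs 2 * ((y * x) * \<delta> x)" unfolding R01 by (simp add: qp_norm)
  finally have 1: "psi * x = qs 2 * ((y * x) * \<delta> x) - qs (-2) * (\<delta> x * (y * x))" .
  have 2: "x * psi = x * (y * \<delta> x) - qs (-2) * ((x * \<delta> x) * y)"
    by (simp add: psi_def algebra_simps qp_norm)
  show ?thesis unfolding 1 2 xa yx(1) by (simp add: algebra_simps qp_norm)
qed

lemma psi_y: "psi * y - y * psi = qs 2 * (\<delta> y * d) - qs (-2) * (d * \<delta> y)"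
proof -
  have xa: "\<delta> y * y = qs (-2) * (y * \<delta> y)" unfolding R01_y by (simp add: qp_norm)
  have 1: "psi * y = qs (-2) * (x * (\<delta> y * y)) - \<delta> y * (x * y)"
    by (simp add: psi_alt algebra_simps qp_norm)
  have 2: "y * psi = qs (-2) * ((y * x) * \<delta> y) - (y * \<delta> y) * x"
    by (simp add: psi_alt algebra_simps qp_norm)
  have xy: "x * y = qs 2 * (y * x) - qs 2 * d" by (simp add: d_def algebra_simps qp_norm)
  have "(y * \<delta> y) * x = qs 2 * (\<delta> y * (y * x))" unfolding R01_y by (simp add: qp_norm)
  then show ?thesis unfolding 1 2 xa using yx by (simp add: algebra_simps qp_norm)
qed

abbreviation "bt \<equiv> qpow 2 + qpow (-2)"

lemma \<eta>_x: "\<eta> x = s bt * \<delta> (\<delta> x)"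
proof -
  have "\<eta> x = (psi * x - x * psi) + (psi * x - x * psi) - (qs 2 - qs (-2)) * (d * \<delta> x + \<delta> x * d)"
    by (simp add: \<eta>_def h_def \<delta>_def algebra_simps qp_norm)
  also have "\<dots> = s bt * \<delta> (\<delta> x)"
    unfolding psi_x \<delta>_def[of "\<delta> x"] by (simp add: s_add algebra_simps)
  finally show ?thesis .
qed

lemma \<eta>_y: "\<eta> y = - (s bt * \<delta> (\<delta> y))"
proof -
  have "\<eta> y = (psi * y - y * psi) + (psi * y - y * psi) - (qs 2 - qs (-2)) * (d * \<delta> y + \<delta> y * d)"
    by (simp add: \<eta>_def h_def \<delta>_def algebra_simps qp_norm)
  also have "\<dots> = - (s bt * \<delta> (\<delta> y))"
    unfolding psi_y \<delta>_def[of "\<delta> y"] by (simp add: s_add algebra_simps)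
  finally show ?thesis .
qed

text \<open>[h, d] is computed twice. As a derivation applied to the two products in d it is (q^2 +
  q^-2)(P + Q); by the definition of h it is -2 [d, psi] = -(P + Q). Hence [3] (P + Q) = 0, and [3]
  is invertible.\<close>

lemma \<eta>_d: "\<eta> d = 0"
proof -
  define P where "P = y * \<delta> (\<delta> x) - qs (-2) * (\<delta> (\<delta> x) * y)"
  define Q where "Q = qs (-2) * (x * \<delta> (\<delta> y)) - \<delta> (\<delta> y) * x"
  have "\<eta> d = \<eta> y * x + y * \<eta> x - qs (-2) * (\<eta> x * y + x * \<eta> y)"
    unfolding d_def by (simp add: \<eta>_rules algebra_simps)
  also have "\<dots> = s bt * (P + Q)"
    unfolding \<eta>_x \<eta>_y P_def Q_def by (simp add: s_add algebra_simps qp_norm)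
  finally have 1: "\<eta> d = s bt * (P + Q)" .
  have p: "\<delta> psi = P + (\<delta> y * \<delta> x - qs (-2) * (\<delta> x * \<delta> y))"
    unfolding psi_def P_def by (simp add: \<delta>_rules algebra_simps)
  have q: "\<delta> psi = Q + (qs (-2) * (\<delta> x * \<delta> y) - \<delta> y * \<delta> x)"
    unfolding psi_alt Q_def by (simp add: \<delta>_rules algebra_simps)
  have "\<delta> psi + \<delta> psi = P + Q" by (subst p, subst q) simp
  moreover have "\<eta> d = - (\<delta> psi + \<delta> psi)"
    by (simp add: \<eta>_def h_def \<delta>_def algebra_simps qp_norm)
  ultimately have 2: "\<eta> d = - (P + Q)" by simp
  have "s (bt + 1) * (P + Q) = 0"
    unfolding s_add[of bt] s_1 distrib_right mult_1 1[symmetric] 2 by simp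
  moreover have "bt + 1 = qint 3"
    unfolding qint_3 by simp
  then have "bt + 1 \<noteq> 0" by (simp add: qint_eq_0)
  ultimately have "P + Q = 0" by (rule s_eq_0[rotated])
  then show ?thesis using 2 by simp
qed

lemma bt_nz: "bt \<noteq> 0"
proof
  assume "bt = 0"
  then have "qpow 2 * qpow 2 = - 1" by (simp add: qpow_minus field_simps eq_neg_iff_add_eq_0)
  then have "(qpow 2 * qpow 2) * (qpow 2 * qpow 2) = 1" by simp
  then have "qpow 8 = 1" by (simp add: qpow_merge)
  then show False by (simp add: qpow_eq_1)
qed

fun a :: "nat \<Rightarrow> 'a" where "a 0 = x" | "a (Suc n) = \<delta> (a n)"

text \<open>Since h commutes with d, the derivation [h, .] commutes with [d, .], so the formula for
  x carries over to all its iterated commutators.\<close>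

lemma \<eta>_a: "\<eta> (a n) = s bt * a (n + 2)"
proof (induction n)
  case 0 show ?case by (simp add: \<eta>_x numeral_2_eq_2)
next
  case (Suc n)
  have o: "z * (s bt * z') = s bt * (z * z')" for z z' by (metis s_comm mult.assoc)
  have "\<eta> (\<delta> (a n)) = \<eta> d * a n + d * \<eta> (a n) - (\<eta> (a n) * d + a n * \<eta> d)"
    unfolding \<delta>_def \<eta>_rules ..
  also have "\<dots> = \<delta> (\<eta> (a n))" unfolding \<eta>_d by (simp add: \<delta>_def)
  also have "\<dots> = s bt * \<delta> (a (n + 2))" 
    unfolding Suc \<delta>_def o by (simp add: right_diff_distrib mult.assoc del: a.simps)
  finally show ?case by simp
qed

text \<open>One application of \<open>\<delta>\<close> gives the relation at distance two, and
  \<open>\<eta>\<close> the one at distance three. Substituting the latter into the second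
  \<open>\<delta>\<close>-derivative leaves twice the q-commutation of the next two neighbours, so
  the hypothesis propagates.\<close>

lemma gap_one: "a (Suc n) * a n = qs 2 * (a n * a (Suc n)) \<Longrightarrow>
   a (Suc (Suc n)) * a n = qs 2 * (a n * a (Suc (Suc n))) + qs 2 * (a (Suc n) * a (Suc n)) - a (Suc n) * a (Suc n)"
  "a (Suc n) * a n = qs 2 * (a n * a (Suc n)) \<Longrightarrow>
   a (Suc (Suc n)) * a (Suc n) = qs 2 * (a (Suc n) * a (Suc (Suc n)))"
  "a (Suc n) * a n = qs 2 * (a n * a (Suc n)) \<Longrightarrow>
   a (Suc (Suc (Suc n))) * a n = qs 2 * (a n * a (Suc (Suc (Suc n)))) + qs 2 * (a (Suc (Suc n)) * a (Suc n)) - a (Suc n) * a (Suc (Suc n))"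
proof -
  assume r: "a (Suc n) * a n = qs 2 * (a n * a (Suc n))"
  have 1: "\<delta> (a (Suc n) * a n) = \<delta> (qs 2 * (a n * a (Suc n)))" and
    2: "\<delta> (\<delta> (a (Suc n) * a n)) = \<delta> (\<delta> (qs 2 * (a n * a (Suc n))))" and
    3: "\<eta> (a (Suc n) * a n) = \<eta> (qs 2 * (a n * a (Suc n)))" using r by simp_all
  from 1 show "a (Suc (Suc n)) * a n = qs 2 * (a n * a (Suc (Suc n))) + qs 2 * (a (Suc n) * a (Suc n)) - a (Suc n) * a (Suc n)"
    unfolding \<delta>_rules by (simp add: algebra_simps)
  have "s bt * (a (Suc (Suc (Suc n))) * a n + a (Suc n) * a (Suc (Suc n))) = s bt * (qs 2 * (a n * a (Suc (Suc (Suc n))) + a (Suc (Suc n)) * a (Suc n)))"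
  proof -
    have o: "z * (s bt * z') = s bt * (z * z')" for z z' by (metis s_comm mult.assoc)
    show ?thesis using 3 unfolding \<eta>_rules \<eta>_a
      by (simp add: o distrib_left mult.assoc numeral_2_eq_2 add.commute del: a.simps)
  qed
  from s_cancel[OF bt_nz this]
  have 3: "a (Suc (Suc (Suc n))) * a n = qs 2 * (a n * a (Suc (Suc (Suc n)))) + qs 2 * (a (Suc (Suc n)) * a (Suc n)) - a (Suc n) * a (Suc (Suc n))"
    by (simp add: algebra_simps)
  then show "a (Suc (Suc (Suc n))) * a n = qs 2 * (a n * a (Suc (Suc (Suc n)))) + qs 2 * (a (Suc (Suc n)) * a (Suc n)) - a (Suc n) * a (Suc (Suc n))" .
  have "a (Suc (Suc n)) * a (Suc n) + a (Suc (Suc n)) * a (Suc n) = qs 2 * (a (Suc n) * a (Suc (Suc n))) + qs 2 * (a (Suc n) * a (Suc (Suc n)))"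
  proof -
    let ?l = "a (Suc n) * a (Suc (Suc n)) + a (Suc (Suc (Suc n))) * a n"
    let ?r = "qs 2 * (a n * a (Suc (Suc (Suc n)))) + qs 2 * (a (Suc (Suc n)) * a (Suc n))"
    let ?B = "a (Suc (Suc n)) * a (Suc n)" and ?C = "qs 2 * (a (Suc n) * a (Suc (Suc n)))"
    have "?l + (?B + ?B) = ?r + (?C + ?C)"
      using 2 by (simp add: \<delta>_rules distrib_left add_ac)
    moreover have "?l = ?r" unfolding 3 by simp
    ultimately show ?thesis by simp
  qed
  then show "a (Suc (Suc n)) * a (Suc n) = qs 2 * (a (Suc n) * a (Suc (Suc n)))"
    by (rule two_cancel)
qed

end

context uq_plus begin

lemma R: "a (Suc n) * a n = qs 2 * (a n * a (Suc n))"
proof (induction n)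
  case 0 show ?case using R01 by simp
next
  case (Suc n) then show ?case by (rule gap_one(2))
qed

text \<open>The relations are homogeneous in the sum of the indices, so scaling the k-th vector by
  c^k preserves them; c = \<open>cu\<close> will give u_k.\<close>

definition w :: "K \<Rightarrow> nat \<Rightarrow> 'a" where "w c k = s (c ^ k) * a k"

lemma w_mult: "w c j * w c k = s (c ^ (j + k)) * (a j * a k)"
  unfolding w_def by (simp only: mult.assoc power_add s_mult) (metis s_comm mult.assoc)

lemma kron_w: "kron (\<lambda>m. qs m) (w c 0) (w c 1) (w c 2) (w c 3)"
proof -
  have 1: "a j * a (Suc j) = qs (-2) * (a (Suc j) * a j)" for j
    unfolding R by (simp add: qp_norm)
  have 2: "a j * a (Suc (Suc j)) = qs (-2) * (a (Suc (Suc j)) * a j) - a (Suc j) * a (Suc j) + qs (-2) * (a (Suc j) * a (Suc j))" for j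
    unfolding gap_one(1)[OF R] by (simp add: qp_norm algebra_simps del: a.simps)
  have 3: "a j * a (Suc (Suc (Suc j))) = qs (-2) * (a (Suc (Suc (Suc j))) * a j) - a (Suc (Suc j)) * a (Suc j) + qs (-4) * (a (Suc (Suc j)) * a (Suc j))" for j
    unfolding gap_one(3)[OF R] 1[of "Suc j"] by (simp add: qp_norm algebra_simps del: a.simps)
  have o: "qs m * (s e * z) = s e * (qs m * z)" for m e z by (metis s_comm mult.assoc)
  show ?thesis
  proof
    show "w c 0 * w c 1 = qs (- 2) * (w c 1 * w c 0)" using 1[of 0] by (simp add: w_mult o del: a.simps)
    show "w c 1 * w c 2 = qs (- 2) * (w c 2 * w c 1)" using 1[of 1] by (simp add: w_mult o numeral_2_eq_2 del: a.simps)
    show "w c 2 * w c 3 = qs (- 2) * (w c 3 * w c 2)" using 1[of 2] by (simp add: w_mult o numeral_2_eq_2 numeral_3_eq_3 del: a.simps)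
    show "w c 0 * w c 2 = qs (- 2) * (w c 2 * w c 0) - w c 1 * w c 1 + qs (- 2) * (w c 1 * w c 1)"
      using 2[of 0] by (simp add: w_mult o numeral_2_eq_2 distrib_left right_diff_distrib del: a.simps)
    show "w c 1 * w c 3 = qs (- 2) * (w c 3 * w c 1) - w c 2 * w c 2 + qs (- 2) * (w c 2 * w c 2)"
      using 2[of 1] by (simp add: w_mult o numeral_2_eq_2 numeral_3_eq_3 distrib_left right_diff_distrib del: a.simps)
    show "w c 0 * w c 3 = qs (- 2) * (w c 3 * w c 0) - w c 2 * w c 1 + qs (- 4) * (w c 2 * w c 1)"
      using 3[of 0] by (simp add: w_mult o numeral_2_eq_2 numeral_3_eq_3 distrib_left right_diff_distrib del: a.simps)
  qed
qed

end

section \<open>The whole quantum group: commutators with the negative half\<close>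

locale uq_full = uq_plus s x y for s :: "K \<Rightarrow> 'a::ring_1" and x y +
  fixes f1 f2 k1 k2 l1 l2 :: 'a
  assumes kk: "k2 * k1 = k1 * k2"
    and kl: "k1 * l1 = 1" "l1 * k1 = 1" "k2 * l2 = 1" "l2 * k2 = 1"
    and kE: "k1 * x = qs 2 * (x * k1)" "k1 * y = qs (-2) * (y * k1)"
      "k2 * x = qs (-2) * (x * k2)" "k2 * y = qs 2 * (y * k2)"
    and kF: "k1 * f1 = qs (-2) * (f1 * k1)" "k1 * f2 = qs 2 * (f2 * k1)"
      "k2 * f1 = qs 2 * (f1 * k2)" "k2 * f2 = qs (-2) * (f2 * k2)"
    and EF: "x * f1 = f1 * x + s (inverse (qq - inverse qq)) * (k1 - l1)"
      "y * f2 = f2 * y + s (inverse (qq - inverse qq)) * (k2 - l2)"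
      "x * f2 = f2 * x" "y * f1 = f1 * y"
begin

definition e where "e = s (inverse (qq - inverse qq))"

lemma move_inv:
  assumes "k * l = 1" "l * k = 1" "k * z = qs m * (z * k)"
  shows "l * z = qs (- m) * (z * l)"
proof -
  have "qs m * (l * z) = l * (qs m * (z * k)) * l" using assms(1) by (simp add: qp_norm)
  also have "\<dots> = l * (k * z) * l" unfolding assms(3) ..
  also have "\<dots> = z * l" using assms(2) by (simp add: mult.assoc[symmetric])
  finally show ?thesis by (simp add: qp_solve qp_norm)
qed

lemmas lE = move_inv[OF kl(1,2) kE(1)] move_inv[OF kl(1,2) kE(2)] move_inv[OF kl(3,4) kE(3)] move_inv[OF kl(3,4) kE(4)]
lemmas lF = move_inv[OF kl(1,2) kF(1)] move_inv[OF kl(1,2) kF(2)] move_inv[OF kl(3,4) kF(3)] move_inv[OF kl(3,4) kF(4)]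

lemma k_order: "k2 * l1 = l1 * k2" "l2 * k1 = k1 * l2" "l2 * l1 = l1 * l2"
proof -
  have 1: "k1 * k2 = qs 0 * (k2 * k1)" "k2 * k1 = qs 0 * (k1 * k2)" using kk by simp_all
  show a: "k2 * l1 = l1 * k2" using move_inv[OF kl(1,2) 1(1)] by simp
  show "l2 * k1 = k1 * l2" using move_inv[OF kl(3,4) 1(2)] by simp
  have "k2 * l1 = qs 0 * (l1 * k2)" using a by simp
  from move_inv[OF kl(3,4) this] show "l2 * l1 = l1 * l2" by simp
qed

lemmas norm0 = kk kl kE kF EF[folded e_def] lE[simplified] lF[simplified] k_order

lemma norm1:
  "k2 * (k1 * z) = k1 * (k2 * z)" "k1 * (l1 * z) = z" "l1 * (k1 * z) = z" "k2 * (l2 * z) = z" "l2 * (k2 * z) = z"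
  "k2 * (l1 * z) = l1 * (k2 * z)" "l2 * (k1 * z) = k1 * (l2 * z)" "l2 * (l1 * z) = l1 * (l2 * z)"
  "k1 * (x * z) = qs 2 * (x * (k1 * z))" "k1 * (y * z) = qs (-2) * (y * (k1 * z))"
  "k2 * (x * z) = qs (-2) * (x * (k2 * z))" "k2 * (y * z) = qs 2 * (y * (k2 * z))"
  "l1 * (x * z) = qs (-2) * (x * (l1 * z))" "l1 * (y * z) = qs 2 * (y * (l1 * z))"
  "l2 * (x * z) = qs 2 * (x * (l2 * z))" "l2 * (y * z) = qs (-2) * (y * (l2 * z))"
  "k1 * (f1 * z) = qs (-2) * (f1 * (k1 * z))" "k1 * (f2 * z) = qs 2 * (f2 * (k1 * z))"
  "k2 * (f1 * z) = qs 2 * (f1 * (k2 * z))" "k2 * (f2 * z) = qs (-2) * (f2 * (k2 * z))"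
  "l1 * (f1 * z) = qs 2 * (f1 * (l1 * z))" "l1 * (f2 * z) = qs (-2) * (f2 * (l1 * z))"
  "l2 * (f1 * z) = qs (-2) * (f1 * (l2 * z))" "l2 * (f2 * z) = qs 2 * (f2 * (l2 * z))"
  "x * (f1 * z) = f1 * (x * z) + e * ((k1 - l1) * z)" "y * (f2 * z) = f2 * (y * z) + e * ((k2 - l2) * z)"
  "x * (f2 * z) = f2 * (x * z)" "y * (f1 * z) = f1 * (y * z)"
  by (simp_all only: mult.assoc[symmetric] norm0 distrib_right mult_1)

lemma e_comm: "x * e = e * x" "y * e = e * y" "f1 * e = e * f1" "f2 * e = e * f2" "k1 * e = e * k1" "k2 * e = e * k2" "l1 * e = e * l1" "l2 * e = e * l2"
  "d * e = e * d"
  unfolding e_def by (rule s_comm[symmetric])+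
lemma e_left: "x * (e * z) = e * (x * z)" "y * (e * z) = e * (y * z)" "f1 * (e * z) = e * (f1 * z)" "f2 * (e * z) = e * (f2 * z)"
   "k1 * (e * z) = e * (k1 * z)" "k2 * (e * z) = e * (k2 * z)" "l1 * (e * z) = e * (l1 * z)" "l2 * (e * z) = e * (l2 * z)" "d * (e * z) = e * (d * z)"
  unfolding e_def by (metis s_comm mult.assoc)+

lemmas norms = qp_norm norm0 norm1 e_comm e_left algebra_simps

text \<open>The negative counterpart of \<open>d\<close>, up to scaling; its commutator
  \<open>M2\<close> with f1 is [2] times T_1(F_2).\<close>

definition m where "m = f1 * f2 - qs 2 * (f2 * f1)"

lemma d_f1: "d * f1 = f1 * d + e * (y * k1) - e * (qs (-4) * (y * k1))"
  by (simp add: d_def norms)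
lemma d_f2: "d * f2 = f2 * d + e * (qs (-2) * (x * l2)) - e * (qs 2 * (x * l2))"
  by (simp add: d_def norms)
lemma a1_f1: "a 1 * f1 = f1 * a 1 + e * (qs 2 * (d * k1)) - e * (qs (-2) * (d * k1))"
  by (simp add: \<delta>_def d_def norms)
lemma d_m: "d * m = m * d + e * (e * ((qs 2 - qs (-2)) * (k1 * k2 - l1 * l2)))"
  by (simp add: d_def m_def norms)
lemma y_m: "y * m = m * y + e * (f1 * k2) - e * (qs 4 * (f1 * k2))"
  by (simp add: m_def norms)
lemma x_m: "x * m = m * x + e * (qs 2 * (f2 * l1)) - e * (qs (-2) * (f2 * l1))"
  by (simp add: m_def norms)

end

context uq_full begin

definition M2 where "M2 = f1 * m - m * f1"
definition g1 where "g1 = qs 2 - qs (-2)"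

lemma left_of: "p * q = r \<Longrightarrow> p * (q * z) = r * (z::'a)"
  by (simp add: mult.assoc[symmetric])

lemma k_d: "k1 * d = d * k1" "k2 * d = d * k2" "l1 * d = d * l1" "l2 * d = d * l2"
  by (simp_all add: d_def norms)
lemma k_a1: "k1 * a 1 = qs 2 * (a 1 * k1)" "k2 * a 1 = qs (-2) * (a 1 * k2)" "l1 * a 1 = qs (-2) * (a 1 * l1)" "l2 * a 1 = qs 2 * (a 1 * l2)"
  by (simp_all add: \<delta>_def norms k_d k_d[THEN left_of])
lemma k_a2: "l1 * a 2 = qs (-2) * (a 2 * l1)" "l2 * a 2 = qs 2 * (a 2 * l2)"
  using k_a1 by (simp_all add: \<delta>_def norms k_d k_d[THEN left_of] numeral_2_eq_2)
lemma e_m: "m * e = e * m" "m * (e * z) = e * (m * z)"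
  unfolding e_def by (metis s_comm mult.assoc)+
lemma k_m: "k1 * m = m * k1" "k2 * m = m * k2" "l1 * m = m * l1" "l2 * m = m * l2"
  by (simp_all add: m_def norms)

lemma d_M2: "d * M2 = M2 * d - e * (e * (g1 * (g1 * (f1 * (k1 * k2)))))"
  unfolding M2_def g1_def
  by (simp add: norms e_m d_f1 d_m d_f1[THEN left_of] d_m[THEN left_of] y_m y_m[THEN left_of] k_m k_m[THEN left_of])

lemma a1_m: "a 1 * m = m * a 1 - e * (e * (g1 * (g1 * (x * (l1 * l2)))))"
  unfolding g1_def
  by (simp add: \<delta>_def norms d_m d_m[THEN left_of] x_m x_m[THEN left_of] d_f2 d_f2[THEN left_of] k_d k_d[THEN left_of])

lemma a1_M2: "a 1 * M2 = M2 * a 1 + e * (e * (e * (g1 * (g1 * (k1 * (k1 * k2) - l1 * (l1 * l2))))))"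
  unfolding M2_def right_diff_distrib left_diff_distrib mult.assoc a1_m a1_f1 a1_m[THEN left_of] a1_f1[THEN left_of]
  unfolding g1_def
  by (simp add: norms e_m a1_f1 a1_m d_m d_m[THEN left_of] k_m k_m[THEN left_of] a1_f1[unfolded One_nat_def] a1_m[unfolded One_nat_def g1_def] del: a.simps)

text \<open>Jacobi identity for a_2 = [d, a_1]: the commutator [a_1, M2] lies in the torus part and
  commutes with d, so only [a_1, H] survives. There k1 k2 commutes with a_1, and [a_1, f1] produces
  d k1.\<close>

lemma a2_M2: "a 2 * M2 = M2 * a 2 + e * (e * (e * (g1 * (g1 * (g1 * (d * (k1 * (k1 * k2))))))))"
proof -
  define G where "G = e * (e * (e * (g1 * (g1 * (k1 * (k1 * k2) - l1 * (l1 * l2))))))"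
  define H where "H = e * (e * (g1 * (g1 * (f1 * (k1 * k2)))))"
  have G: "d * G = G * d"
    unfolding G_def g1_def by (simp add: norms k_d k_d[THEN left_of])
  have a2: "a 2 = d * a 1 - a 1 * d" by (simp add: \<delta>_def numeral_2_eq_2)
  have dM: "d * M2 = M2 * d - H" and aM: "a 1 * M2 = M2 * a 1 + G"
    unfolding H_def G_def by (rule d_M2, rule a1_M2)
  have "a 2 * M2 = M2 * a 2 + (a 1 * H - H * a 1)"
    unfolding a2 using G by (simp add: left_diff_distrib right_diff_distrib distrib_left distrib_right mult.assoc dM aM dM[THEN left_of] aM[THEN left_of] del: a.simps One_nat_def)
  also have "a 1 * H - H * a 1 = e * (e * (e * (g1 * (g1 * (g1 * (d * (k1 * (k1 * k2))))))))"
  proof -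
    have o: "a 1 * (e * z) = e * (a 1 * z)" "a 1 * (g1 * z) = g1 * (a 1 * z)" for z
      unfolding e_def g1_def s_diff[symmetric] by (metis s_comm mult.assoc)+
    have "H * a 1 = e * (e * (g1 * (g1 * (f1 * (a 1 * (k1 * k2))))))"
      unfolding H_def mult.assoc k_a1 by (simp add: qp_norm k_a1 k_a1[THEN left_of] del: a.simps One_nat_def)
    moreover have "a 1 * H = e * (e * (g1 * (g1 * ((a 1 * f1) * (k1 * k2)))))"
      unfolding H_def by (simp only: o mult.assoc)
    moreover have "a 1 * f1 = f1 * a 1 + e * (g1 * (d * k1))"
      unfolding a1_f1 g1_def by (simp add: algebra_simps)
    ultimately show ?thesis
      by (simp add: distrib_left distrib_right mult.assoc e_left del: a.simps One_nat_def)
        (simp add: e_def g1_def s_diff[symmetric] s_merge mult.commute mult.left_commute mult.assoc)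
  qed
  finally show ?thesis .
qed

end

section \<open>The braid formulas as commutators with \<open>d\<close>\<close>

context uq_full begin

abbreviation "t2 \<equiv> inverse (qint 2)"

definition braid :: "'a \<Rightarrow> 'a \<Rightarrow> 'a" where
  "braid z g = s t2 * (g * (z * z)) - qs (-1) * (z * (g * z)) + qs (-2) * (s t2 * (z * (z * g)))"

lemma qint_2: "qint 2 = qpow 1 + qpow (-1)"
  using qint_split[of 1 1] by (simp add: qint_1)

lemma qint_2_nz: "qint 2 \<noteq> 0" by (simp add: qint_eq_0)

lemmas s_norm = s_out s_merge mult.assoc

lemma a_2: "a 2 = d * a 1 - a 1 * d" and a_3: "a 3 = d * a 2 - a 2 * d"
  by (simp_all add: \<delta>_def numeral_2_eq_2 numeral_3_eq_3)

text \<open>Because q^-1 = (1 + q^-2) / [2], the cubic braid polynomial factors into an ordinary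
  commutator with z of the q-commutator of X and z.\<close>

lemma braid_comm:
  assumes "X * z - qs (-2) * (z * X) = g"
  shows "braid z X = s t2 * (g * z - z * g)"
proof -
  have "qpow (-1) = t2 * (1 + qpow (-2))"
    using qint_2_nz unfolding qint_2 by (simp add: field_simps qpow_merge)
  then have "qs (-1) * (z * (X * z)) = s t2 * (z * (X * z) + qs (-2) * (z * (X * z)))"
    by (simp add: s_mult s_add distrib_left distrib_right mult.assoc)
  moreover have "qs (-2) * (s t2 * (z * (z * X))) = s t2 * (qs (-2) * (z * (z * X)))"
    by (rule s_pull)
  ultimately show ?thesis
    unfolding braid_def assms[symmetric]
    by (simp only: right_diff_distrib left_diff_distrib distrib_left mult.assoc s_pull[of z "qpow (-2)"]) simp
qed

lemma braid_v1: "braid x y = s t2 * a 1"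
  by (subst braid_comm[of y x d]) (simp_all add: d_def \<delta>_def)

lemma e_g1: "e * g1 = s (qint 2)"
proof -
  have "qint 2 = inverse (qq - inverse qq) * (qpow 2 - qpow (-2))" by (simp add: qint_def divide_inverse mult.commute)
  then show ?thesis by (simp add: e_def g1_def s_mult s_diff)
qed

lemma e_g1': "e * (g1 * z) = s (qint 2) * z"
  unfolding e_g1[symmetric] by (simp add: mult.assoc)

lemma a1_f1': "a 1 * f1 - f1 * a 1 = s (qint 2) * (d * k1)"
proof -
  have "a 1 * f1 - f1 * a 1 = e * (g1 * (d * k1))" unfolding a1_f1 g1_def by (simp add: algebra_simps)
  then show ?thesis by (simp only: e_g1')
qed

lemma t2_cancel: "s t2 * (s (qint 2) * z) = z"
  using qint_2_nz by (simp add: s_merge)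

text \<open>The inner q-commutator is again d: [a_1, F_1] = [2] d K_1, where [2] cancels the scalar
  of v_1 and K_1 cancels the K_1^-1 of T_1(E_1).\<close>

lemma braid_v2: "braid (s t2 * a 1) (- (l1 * f1)) = s (t2 ^ 2) * a 2"
proof -
  have k: "a 1 * l1 = qs 2 * (l1 * a 1)" unfolding k_a1 by (simp add: qp_norm)
  have "- (l1 * f1) * (s t2 * a 1) - qs (-2) * (s t2 * a 1 * - (l1 * f1))
     = s t2 * (qs (-2) * ((a 1 * l1) * f1) - l1 * (f1 * a 1))"
    by (simp add: s_norm right_diff_distrib mult.commute mult.left_commute del: a.simps One_nat_def)
  also have "qs (-2) * ((a 1 * l1) * f1) - l1 * (f1 * a 1) = l1 * (a 1 * f1 - f1 * a 1)"
    unfolding k by (simp add: qp_norm right_diff_distrib del: a.simps One_nat_def)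
  also have "\<dots> = s (qint 2) * (d * (l1 * k1))"
    unfolding a1_f1' by (simp add: k_d[THEN left_of] s_norm)
  also have "s t2 * \<dots> = d" unfolding t2_cancel by (simp add: kl)
  finally have "braid (s t2 * a 1) (- (l1 * f1)) = s t2 * (d * (s t2 * a 1) - s t2 * a 1 * d)"
    by (rule braid_comm)
  also have "\<dots> = s (t2 ^ 2) * a 2"
    unfolding a_2 by (simp add: s_norm right_diff_distrib[symmetric] power2_eq_square del: One_nat_def a.simps)
  finally show ?thesis .
qed

definition Ym where "Ym = s t2 * (f1 * (f1 * f2)) - qs 1 * (f1 * (f2 * f1)) + qs 2 * (s t2 * (f2 * (f1 * f1)))"

lemma Ym_M2: "Ym = s t2 * M2"
proof -
  have "qpow 1 = t2 * (1 + qpow 2)"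
    using qint_2_nz unfolding qint_2 by (simp add: field_simps qpow_merge)
  then have "qs 1 * (f1 * (f2 * f1)) = s t2 * (f1 * (f2 * f1) + qs 2 * (f1 * (f2 * f1)))"
    by (simp add: s_mult s_add distrib_left distrib_right mult.assoc)
  moreover have "qs 2 * (s t2 * (f2 * (f1 * f1))) = s t2 * (qs 2 * (f2 * (f1 * f1)))"
    by (rule s_pull)
  ultimately show ?thesis
    unfolding Ym_def M2_def m_def
    by (simp only: right_diff_distrib left_diff_distrib distrib_left mult.assoc s_pull[of f1 "qpow 2"]) simp
qed

text \<open>Once more the inner q-commutator is d. The factor [2]^3 of [a_2, M2] cancels two factors
  from v_2 and one from \<open>Ym\<close>, and k1 k1 k2 cancels the inverses from
  T_1(K_2^-1).\<close>

lemma braid_v3: "braid (s (t2 ^ 2) * a 2) (- (l2 * (l1 * (l1 * Ym)))) = s (t2 ^ 3) * a 3"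
proof -
  have k: "a 2 * (l2 * (l1 * (l1 * z))) = qs 2 * (l2 * (l1 * (l1 * (a 2 * z))))" for z
  proof -
    have "l2 * (l1 * (l1 * (a 2 * z))) = qs (-2) * (a 2 * (l2 * (l1 * (l1 * z))))"
      by (simp add: k_a2[THEN left_of] mult.assoc qp_norm)
    then show ?thesis by (simp add: qp_norm)
  qed
  have "- (l2 * (l1 * (l1 * Ym))) * (s (t2 ^ 2) * a 2) - qs (-2) * (s (t2 ^ 2) * a 2 * - (l2 * (l1 * (l1 * Ym))))
     = s (t2 ^ 2) * (s t2 * (qs (-2) * (a 2 * (l2 * (l1 * (l1 * M2)))) - l2 * (l1 * (l1 * (M2 * a 2)))))"
    unfolding Ym_M2
    by (simp add: s_norm right_diff_distrib mult.commute mult.left_commute del: a.simps One_nat_def)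
  also have "qs (-2) * (a 2 * (l2 * (l1 * (l1 * M2)))) - l2 * (l1 * (l1 * (M2 * a 2))) = l2 * (l1 * (l1 * (a 2 * M2 - M2 * a 2)))"
    unfolding k by (simp add: qp_norm right_diff_distrib)
  also have "a 2 * M2 - M2 * a 2 = s (qint 2) * (s (qint 2) * (s (qint 2) * (d * (k1 * (k1 * k2)))))"
  proof -
    have o: "e * (g1 * z) = g1 * (e * z)" "e * (s c * z) = s c * (e * z)" "g1 * (s c * z) = s c * (g1 * z)" for c z
      unfolding e_def g1_def s_diff[symmetric] by (rule s_pull)+
    have "a 2 * M2 - M2 * a 2 = e * (g1 * (e * (g1 * (e * (g1 * (d * (k1 * (k1 * k2))))))))"
      unfolding a2_M2 o by simp
    then show ?thesis unfolding e_g1' .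
  qed
  also have "l2 * (l1 * (l1 * (s (qint 2) * (s (qint 2) * (s (qint 2) * (d * (k1 * (k1 * k2))))))))
    = s (qint 2) * (s (qint 2) * (s (qint 2) * d))"
  proof -
    have "l2 * (l1 * (l1 * (d * (k1 * (k1 * k2))))) = d"
      by (simp add: k_d[THEN left_of] mult.assoc norms)
    then show ?thesis by (simp add: s_norm)
  qed
  also have "s (t2 ^ 2) * (s t2 * (s (qint 2) * (s (qint 2) * (s (qint 2) * d)))) = d"
    by (simp only: t2_cancel power2_eq_square s_mult mult.assoc)
  finally have "braid (s (t2 ^ 2) * a 2) (- (l2 * (l1 * (l1 * Ym)))) = s t2 * (d * (s (t2 ^ 2) * a 2) - s (t2 ^ 2) * a 2 * d)"
    by (rule braid_comm)
  also have "\<dots> = s (t2 ^ 3) * a 3"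
    unfolding a_3 by (simp add: s_norm right_diff_distrib[symmetric] power2_eq_square power3_eq_cube mult.left_commute mult.commute del: One_nat_def a.simps)
  finally show ?thesis .
qed

end

section \<open>A tensor product of two evaluation modules\<close>

lemma ncpoly_induct [case_names zero add]:
  fixes x :: ncpoly
  assumes "P 0" "\<And>x w c. P x \<Longrightarrow> P (x + Poly_Mapping.single w c)"
  shows "P x"
proof (induction x rule: update_induct)
  case (update f a b)
  have "Poly_Mapping.update a b f = f + Poly_Mapping.single a b"
    by (rule poly_mapping_eqI) (use update(1) in \<open>auto simp: lookup_update lookup_add lookup_single in_keys_iff\<close>)
  with assms(2)[OF update(3)] show ?case by simp
qed (rule assms(1))

lemma sc_comm: "sc c * x = x * sc c"
proof (induction x rule: ncpoly_induct)
  case (add x w d)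
  then show ?case
    by (simp add: sc_def distrib_left distrib_right mult_single mult.commute)
qed simp

lemma sc_add: "sc (a + b) = sc a + sc b" by (simp add: sc_def single_add)
lemma sc_mult: "sc (a * b) = sc a * sc b" by (simp add: sc_def mult_single)
lemma sc_1: "sc 1 = 1" by (simp add: sc_def)
lemma sc_0: "sc 0 = 0" by (simp add: sc_def)
lemma sc_minus: "sc (- a) = - sc a" by (simp add: sc_def single_uminus)
lemma word_plus: "w + w' = W (letters w @ letters w')" "0 = W []"
  by (cases w; cases w'; simp) (simp add: zero_word_def)

lemma keys_sum_add:
  assumes "\<And>w. h w 0 = (0::'a::comm_monoid_add)" "\<And>w a b. h w (a + b) = h w a + h w b"
  shows "(\<Sum>w\<in>Poly_Mapping.keys (x + y). h w (Poly_Mapping.lookup (x + y) w)) =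
    (\<Sum>w\<in>Poly_Mapping.keys x. h w (Poly_Mapping.lookup x w)) + (\<Sum>w\<in>Poly_Mapping.keys y. h w (Poly_Mapping.lookup y w))"
  by (rule setsum_keys_plus_distrib) (use assms in auto)

context fixes \<phi> :: "gen \<Rightarrow> ncpoly" begin

lemma ext_hom_add: "ext_hom \<phi> (x + y) = ext_hom \<phi> x + ext_hom \<phi> y"
  unfolding ext_hom_def by (rule keys_sum_add) (simp_all add: sc_0 sc_add distrib_right)

lemma ext_hom_single: "ext_hom \<phi> (Poly_Mapping.single w c) = sc c * prod_list (map \<phi> (letters w))"
  by (cases "c = 0") (simp_all add: ext_hom_def sc_0)

lemma ext_hom_0: "ext_hom \<phi> 0 = 0" by (simp add: ext_hom_def)

lemma ext_hom_sc: "ext_hom \<phi> (sc c) = sc c"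
  by (simp add: sc_def ext_hom_single[unfolded sc_def] word_plus(2))

lemma ext_hom_gn: "ext_hom \<phi> (gn g) = \<phi> g"
  by (simp add: gn_def ext_hom_single sc_1)

lemma ext_hom_mult: "ext_hom \<phi> (x * y) = ext_hom \<phi> x * ext_hom \<phi> y"
proof (induction x rule: ncpoly_induct)
  case (add x w c)
  have "ext_hom \<phi> (Poly_Mapping.single w c * y) = ext_hom \<phi> (Poly_Mapping.single w c) * ext_hom \<phi> y"
  proof (induction y rule: ncpoly_induct)
    case (add y w' c')
    have "p * (sc c' * r) = sc c' * (p * r)" for p r
      by (simp only: mult.assoc[symmetric] sc_comm[of c' p])
    then have "sc c * prod_list (map \<phi> (letters w)) * (sc c' * prod_list (map \<phi> (letters w')))
       = sc (c * c') * prod_list (map \<phi> (letters (w + w')))"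
      by (simp add: word_plus sc_mult mult.assoc)
    then show ?case using add
      by (simp add: distrib_left ext_hom_add mult_single ext_hom_single)
  qed (simp add: ext_hom_0)
  then show ?case using add by (simp add: distrib_right ext_hom_add)
qed (simp add: ext_hom_0)

lemma ext_hom_minus: "ext_hom \<phi> (- x) = - ext_hom \<phi> x"
  by (metis add.right_inverse add_eq_0_iff ext_hom_0 ext_hom_add)

lemma ext_hom_diff: "ext_hom \<phi> (x - y) = ext_hom \<phi> x - ext_hom \<phi> y"
  using ext_hom_add[of x "- y"] by (simp add: ext_hom_minus)

end

section \<open>The module of functions on pairs of spectral values\<close>

type_synonym vec = "int \<Rightarrow> int \<Rightarrow> K"

definition up :: "vec \<Rightarrow> vec \<Rightarrow> vec \<Rightarrow> vec" where
  "up a b f i j = a i j * f (i - 1) j + b i j * f i (j - 1)"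
definition dn :: "vec \<Rightarrow> vec \<Rightarrow> vec \<Rightarrow> vec" where
  "dn c d f i j = c i j * f (i + 1) j + d i j * f i (j + 1)"
definition dg :: "vec \<Rightarrow> vec \<Rightarrow> vec" where
  "dg k f i j = k i j * f i j"

text \<open>Even powers of q for one tensor factor and odd powers for the other: t - w, t - q^2 w
  and w - q^2 t then vanish at no lattice point, so all matrix coefficients are defined.\<close>

definition zt :: "int \<Rightarrow> K" where "zt i = qpow (2 * i)"
definition wt :: "int \<Rightarrow> K" where "wt j = qpow (2 * j + 1)"
definition ph :: "K \<Rightarrow> K \<Rightarrow> K" where "ph t w = 1 / (t - qq ^ 2 * w)"
text \<open>Adjusted to the commutators of E and F: in the first identity of \<open>ph_ga\<close>
  the term with t^3 yields the summand t w and the term with 1/t the summand 1/(t w), which are the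
  actions of K_1 and its inverse.\<close>

definition ga :: "K \<Rightarrow> K" where "ga t = (qq ^ 5 * t ^ 3 + qq / t) / (qq - 1 / qq) ^ 2"

text \<open>Vectors may have infinite support, since each value of the result uses at most two
  values of the argument. K_1 K_2 acts as the identity.\<close>

definition gact :: "gen \<Rightarrow> vec \<Rightarrow> vec" where
  "gact g = (case g of
     GE I1 \<Rightarrow> up (\<lambda>i j. ph (zt i) (wt j)) (\<lambda>i j. ph (wt j) (zt i))
   | GE I2 \<Rightarrow> dn (\<lambda>i j. ga (zt i) * ph (wt j) (zt i)) (\<lambda>i j. ga (wt j) * ph (zt i) (wt j))
   | GF I1 \<Rightarrow> dn (\<lambda>i j. ga (zt i) * wt j * ph (wt j) (zt i)) (\<lambda>i j. ga (wt j) * zt i * ph (zt i) (wt j))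
   | GF I2 \<Rightarrow> up (\<lambda>i j. wt j * ph (zt i) (wt j)) (\<lambda>i j. zt i * ph (wt j) (zt i))
   | GK I1 \<Rightarrow> dg (\<lambda>i j. zt i * wt j) | GKi I1 \<Rightarrow> dg (\<lambda>i j. 1 / (zt i * wt j))
   | GK I2 \<Rightarrow> dg (\<lambda>i j. 1 / (zt i * wt j)) | GKi I2 \<Rightarrow> dg (\<lambda>i j. zt i * wt j))"

lemma gact_lin: "gact g (\<lambda>i j. a * f i j + b * h i j) = (\<lambda>i j. a * gact g f i j + b * gact g h i j)"
  by (intro ext, cases g; rename_tac k, case_tac k)
    (simp_all add: gact_def up_def dn_def dg_def algebra_simps)

definition wact :: "word \<Rightarrow> vec \<Rightarrow> vec" where "wact w f = foldr gact (letters w) f"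

lemma foldr_gact_lin: "foldr gact gs (\<lambda>i j. a * f i j + b * h i j) = (\<lambda>i j. a * foldr gact gs f i j + b * foldr gact gs h i j)"
  by (induction gs) (simp_all add: gact_lin)

definition act :: "ncpoly \<Rightarrow> vec \<Rightarrow> vec" where
  "act x f i j = (\<Sum>w\<in>Poly_Mapping.keys x. Poly_Mapping.lookup x w * wact w f i j)"

lemma act_add: "act (x + y) f i j = act x f i j + act y f i j"
  unfolding act_def by (rule keys_sum_add) (simp_all add: distrib_right)

lemma act_0: "act 0 f i j = 0" by (simp add: act_def)

lemma act_single: "act (Poly_Mapping.single w c) f i j = c * wact w f i j"
  by (cases "c = 0") (simp_all add: act_def)

lemma act_lin: "act x (\<lambda>i j. a * f i j + b * h i j) i j = a * act x f i j + b * act x h i j"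
  by (simp add: act_def wact_def foldr_gact_lin distrib_left sum.distrib sum_distrib_left mult.left_commute)

lemma act_mult: "act (x * y) f = act x (act y f)"
proof (induction x rule: ncpoly_induct)
  case zero show ?case by (intro ext) (simp add: act_0)
next
  case (add x w c)
  have "act (Poly_Mapping.single w c * y) f = act (Poly_Mapping.single w c) (act y f)"
  proof (induction y rule: ncpoly_induct)
    case zero
    have "act x (\<lambda>i j. 0) i j = 0" for x i j
      using act_lin[of x 0 "\<lambda>_ _. 0" 0 "\<lambda>_ _. 0"] by simp
    moreover have "act 0 f = (\<lambda>i j. 0)" by (intro ext) (rule act_0)
    ultimately show ?case by (intro ext) simp
  next
    case (add y w' c')
    have e: "act (y + Poly_Mapping.single w' c') f = (\<lambda>i j. 1 * act y f i j + c' * wact w' f i j)"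
      by (intro ext) (simp add: act_add act_single)
    show ?case unfolding e
      by (intro ext) (simp add: act_lin[of _ 1, simplified] add[symmetric] distrib_left act_add mult_single act_single wact_def word_plus)
  qed
  then show ?case using add by (intro ext) (simp add: distrib_right act_add)
qed

lemma act_sc: "act (sc c) f i j = c * f i j"
  by (simp add: sc_def act_single wact_def word_plus(2))

lemma act_gn: "act (gn g) f = gact g f"
  by (intro ext) (simp add: gn_def act_single wact_def)

lemma act_1: "act 1 f = f" using act_sc[of 1] by (intro ext) (simp add: sc_1)

lemma act_minus: "act (- x) f i j = - act x f i j"
  using act_add[of x "- x" f i j] by (simp add: act_0 eq_neg_iff_add_eq_0 add.commute)

lemma act_diff: "act (x - y) f i j = act x f i j - act y f i j"
  using act_add[of x "- y"] by (simp add: act_minus)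

lemma zt_shift: "zt (i + 1) = qq ^ 2 * zt i" "zt (i - 1) = zt i / qq ^ 2"
  and wt_shift: "wt (j + 1) = qq ^ 2 * wt j" "wt (j - 1) = wt j / qq ^ 2"
proof -
  have 2: "qq ^ 2 = qpow 2" by (simp add: qpow_def)
  show "zt (i + 1) = qq ^ 2 * zt i" "wt (j + 1) = qq ^ 2 * wt j"
    "zt (i - 1) = zt i / qq ^ 2" "wt (j - 1) = wt j / qq ^ 2"
    unfolding 2 zt_def wt_def qpow_add[symmetric] qpow_diff[symmetric] by (simp_all add: algebra_simps)
qed

lemma zt_wt: "zt i \<noteq> wt j" "zt i \<noteq> qq ^ 2 * wt j" "wt j \<noteq> qq ^ 2 * zt i" "zt i \<noteq> 0" "wt j \<noteq> 0"
proof -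
  have 2: "qq ^ 2 = qpow 2" by (simp add: qpow_def)
  have "2 * i \<noteq> 2 * j + 1" "2 * i \<noteq> 2 + (2 * j + 1)" "2 * j + 1 \<noteq> 2 + 2 * i" by presburger+
  then show "zt i \<noteq> wt j" "zt i \<noteq> qq ^ 2 * wt j" "wt j \<noteq> qq ^ 2 * zt i" "zt i \<noteq> 0" "wt j \<noteq> 0"
    unfolding 2 zt_def wt_def qpow_add[symmetric] by (simp_all only: qpow_inj qpow_nz not_False_eq_True)
qed

abbreviation "cq \<equiv> (qq - 1 / qq) ^ 2"

lemma cq_nz: "cq \<noteq> 0" "qq - 1 / qq \<noteq> 0"
  using qq_diff_nz by (simp_all add: inverse_eq_divide)

lemma ph_shift:
  "ph (t / qq ^ 2) w = qq ^ 2 * ph t (qq ^ 2 * w)"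
  "ph w (t / qq ^ 2) = 1 / (w - t)"
  "ph (qq ^ 2 * t) w = 1 / (qq ^ 2 * (t - w))"
  "ph (qq ^ 2 * t) (qq ^ 2 * w) = ph t w / qq ^ 2"
  "ph (t / qq ^ 2) (w / qq ^ 2) = qq ^ 2 * ph t w"
proof -
  have "t / qq ^ 2 - qq ^ 2 * w = (t - qq ^ 2 * (qq ^ 2 * w)) / qq ^ 2"
    by (simp add: field_simps qq_nz)
  then show "ph (t / qq ^ 2) w = qq ^ 2 * ph t (qq ^ 2 * w)" by (simp add: ph_def)
  show "ph w (t / qq ^ 2) = 1 / (w - t)" by (simp add: ph_def qq_nz)
  show "ph (qq ^ 2 * t) w = 1 / (qq ^ 2 * (t - w))" by (simp add: ph_def right_diff_distrib)
  show "ph (qq ^ 2 * t) (qq ^ 2 * w) = ph t w / qq ^ 2"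
    unfolding ph_def right_diff_distrib[of "qq ^ 2" t, symmetric] by simp
  have "t / qq ^ 2 - qq ^ 2 * (w / qq ^ 2) = (t - qq ^ 2 * w) / qq ^ 2"
    by (simp add: diff_divide_distrib)
  then show "ph (t / qq ^ 2) (w / qq ^ 2) = qq ^ 2 * ph t w" by (simp add: ph_def)
qed

lemma up_up: "up a b (up a' b' f) i j = a i j * a' (i - 1) j * f (i - 1 - 1) j
   + (a i j * b' (i - 1) j + b i j * a' i (j - 1)) * f (i - 1) (j - 1) + b i j * b' i (j - 1) * f i (j - 1 - 1)"
  by (simp add: up_def algebra_simps)
lemma dn_dn: "dn c d (dn c' d' f) i j = c i j * c' (i + 1) j * f (i + 1 + 1) j
   + (c i j * d' (i + 1) j + d i j * c' i (j + 1)) * f (i + 1) (j + 1) + d i j * d' i (j + 1) * f i (j + 1 + 1)"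
  by (simp add: dn_def algebra_simps)
lemma up_dn: "up a b (dn c d f) i j = (a i j * c (i - 1) j + b i j * d i (j - 1)) * f i j
   + a i j * d (i - 1) j * f (i - 1) (j + 1) + b i j * c i (j - 1) * f (i + 1) (j - 1)"
  by (simp add: up_def dn_def algebra_simps)
lemma dn_up: "dn c d (up a b f) i j = (c i j * a (i + 1) j + d i j * b i (j + 1)) * f i j
   + d i j * a i (j + 1) * f (i - 1) (j + 1) + c i j * b (i + 1) j * f (i + 1) (j - 1)"
  by (simp add: up_def dn_def algebra_simps)

lemma ga_values:
  assumes "t \<noteq> 0" "w \<noteq> 0"
  shows "ga w = (qq ^ 5 * w ^ 3 + qq / w) / cq" "ga (t / qq ^ 2) = (t ^ 3 / qq + qq ^ 3 / t) / cq"
proof -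
  show "ga w = (qq ^ 5 * w ^ 3 + qq / w) / cq" by (simp add: ga_def)
  have "qq ^ 5 * (t / qq ^ 2) ^ 3 = t ^ 3 / qq" "qq / (t / qq ^ 2) = qq ^ 3 / t"
    using assms qq_nz by (simp_all add: field_simps eval_nat_numeral)
  then show "ga (t / qq ^ 2) = (t ^ 3 / qq + qq ^ 3 / t) / cq" by (simp add: ga_def)
qed

text \<open>At t = q^2 w the arguments w and t / q^2 of \<open>ga\<close> coincide and each bracket
  vanishes. It is therefore divisible by t - q^2 w, which cancels the denominator in
  \<open>ph\<close>.\<close>

lemma ph_ga:
  assumes t: "t \<noteq> 0" and w: "w \<noteq> 0" and nz: "t \<noteq> qq ^ 2 * w"
  shows "ph t w * (t * ga w / qq ^ 2 - w * ga (t / qq ^ 2)) = (t + qq ^ 2 * w) * (1 / (t * w) - t * w) / (qq * cq)"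
    "ph t w * (ga w - ga (t / qq ^ 2)) = (qq / (t * w) - (t ^ 2 + qq ^ 2 * t * w + qq ^ 4 * w ^ 2) / qq) / cq"
    "ph t w * (w ^ 2 * ga (t / qq ^ 2) - t ^ 2 * ga w / qq ^ 4) = (t ^ 2 * w ^ 2 / qq - (t ^ 2 + qq ^ 2 * t * w + qq ^ 4 * w ^ 2) / (qq ^ 3 * t * w)) / cq"
proof -
  have nz: "t - qq ^ 2 * w \<noteq> 0" using nz by simp
  have cancel: "ph t w * ((t - qq ^ 2 * w) * x) = x" for x
    using nz by (simp add: ph_def)
  have a: "t * ga w / qq ^ 2 - w * ga (t / qq ^ 2) = (t - qq ^ 2 * w) * ((t + qq ^ 2 * w) * (1 / (t * w) - t * w) / (qq * cq))"
    unfolding ga_values[OF t w] using t w qq_nz cq_nz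
    by (simp add: divide_simps) (simp add: algebra_simps eval_nat_numeral)
  have b: "ga w - ga (t / qq ^ 2) = (t - qq ^ 2 * w) * ((qq / (t * w) - (t ^ 2 + qq ^ 2 * t * w + qq ^ 4 * w ^ 2) / qq) / cq)"
    unfolding ga_values[OF t w] using t w qq_nz cq_nz
    by (simp add: divide_simps) (simp add: algebra_simps eval_nat_numeral)
  have c: "w ^ 2 * ga (t / qq ^ 2) - t ^ 2 * ga w / qq ^ 4 = (t - qq ^ 2 * w) * ((t ^ 2 * w ^ 2 / qq - (t ^ 2 + qq ^ 2 * t * w + qq ^ 4 * w ^ 2) / (qq ^ 3 * t * w)) / cq)"
    unfolding ga_values[OF t w] using t w qq_nz cq_nz
    by (simp add: divide_simps) (simp add: algebra_simps eval_nat_numeral)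
  show "ph t w * (t * ga w / qq ^ 2 - w * ga (t / qq ^ 2)) = (t + qq ^ 2 * w) * (1 / (t * w) - t * w) / (qq * cq)"
    unfolding a by (rule cancel)
  show "ph t w * (ga w - ga (t / qq ^ 2)) = (qq / (t * w) - (t ^ 2 + qq ^ 2 * t * w + qq ^ 4 * w ^ 2) / qq) / cq"
    unfolding b by (rule cancel)
  show "ph t w * (w ^ 2 * ga (t / qq ^ 2) - t ^ 2 * ga w / qq ^ 4) = (t ^ 2 * w ^ 2 / qq - (t ^ 2 + qq ^ 2 * t * w + qq ^ 4 * w ^ 2) / (qq ^ 3 * t * w)) / cq"
    unfolding c by (rule cancel)
qed

lemma half_sum:
  fixes x y c :: K
  assumes "w \<noteq> t" "x - y = (w - t) * c"
  shows "x / (w - t) + y / (t - w) = c"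
proof -
  have "x / (w - t) + y / (t - w) = (x - y) / (w - t)"
    using assms(1) by (simp add: divide_simps) (simp add: algebra_simps)
  then show ?thesis using assms by simp
qed

abbreviation "dl \<equiv> (1 - qq ^ 4) / (qq ^ 3 * cq)"

text \<open>The two summands are exchanged by swapping t and w. With \<open>ph_ga\<close> inserted,
  the difference of the numerators is a multiple of w - t, and \<open>half_sum\<close> removes the
  last denominator. These values give the diagonals of [E, F] and of \<open>DD\<close> and
  \<open>DF\<close>.\<close>

lemma diagonals:
  assumes t: "t \<noteq> 0" and w: "w \<noteq> 0" and n1: "t \<noteq> qq ^ 2 * w" and n2: "w \<noteq> qq ^ 2 * t" and n3: "t \<noteq> w"
  shows "ph t w * (t * ga w / qq ^ 2 - w * ga (t / qq ^ 2)) / (w - t) + ph w t * (w * ga t / qq ^ 2 - t * ga (w / qq ^ 2)) / (t - w)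
      = (1 / (t * w) - t * w) / (qq - 1 / qq)"
    "ph t w * (ga w - ga (t / qq ^ 2)) / (w - t) + ph w t * (ga t - ga (w / qq ^ 2)) / (t - w)
      = qq ^ 2 * dl * (t + w)"
    "ph t w * (w ^ 2 * ga (t / qq ^ 2) - t ^ 2 * ga w / qq ^ 4) / (w - t) + ph w t * (t ^ 2 * ga (w / qq ^ 2) - w ^ 2 * ga t / qq ^ 4) / (t - w)
      = dl * (1 / t + 1 / w)"
    unfolding ph_ga[OF t w n1] ph_ga[OF w t n2]
    apply (rule half_sum)
    subgoal using n3 by simp
    subgoal 
    proof -
      have "(1 / (t * w) - t * w) / (qq - 1 / qq) = (1 / (t * w) - t * w) * (qq - 1 / qq) / cq"
        using cq_nz by (simp add: power2_eq_square)
      then show ?thesis  using t w qq_nz cq_nz 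
        by (simp add: divide_simps) (simp add: algebra_simps eval_nat_numeral)
    qed
    apply (rule half_sum)
    subgoal using n3 by simp
    subgoal using t w qq_nz cq_nz 
        by (simp add: divide_simps) (simp add: algebra_simps eval_nat_numeral)
    apply (rule half_sum)
    subgoal using n3 by simp
    subgoal using t w qq_nz cq_nz 
        by (simp add: divide_simps) (simp add: algebra_simps eval_nat_numeral)
    done

definition DD :: ncpoly where "DD = E I2 * E I1 - sc (qpow (-2)) * (E I1 * E I2)"
definition DF :: ncpoly where "DF = F I2 * F I1 - sc (qpow (-2)) * (F I1 * F I2)"

lemma sc_left: "x * (sc c * y) = sc c * (x * y)"
  by (metis mult.assoc sc_comm)

text \<open>Turns the cubic relation into a q-commutation of x with [D, x]. On the module D is
  diagonal, so [D, x] only rescales the two shift coefficients of x.\<close>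

lemma serre_left:
  assumes "D = y * x - sc (qpow (-2)) * (x * y)"
  shows "serre x y = sc (qpow 2) * (x * (D * x - x * D)) - (D * x - x * D) * x"
proof -
  have n: "sc (qpow 2) * (sc (qpow (-2)) * z) = z" for z
    by (simp add: mult.assoc[symmetric] sc_mult[symmetric] qpow_merge sc_1)
  have o: "x * (sc c * z) = sc c * (x * z)" "y * (sc c * z) = sc c * (y * z)" for c z
    by (rule sc_left)+
  show ?thesis unfolding serre_def qint_3 assms sc_add sc_1
    by (simp add: algebra_simps o n power2_eq_square power3_eq_cube)
qed

lemma serre_right:
  assumes "D = x * y - sc (qpow (-2)) * (y * x)"
  shows "serre x y = x * (x * D - D * x) - sc (qpow 2) * ((x * D - D * x) * x)"
proof -
  have n: "sc (qpow 2) * (sc (qpow (-2)) * z) = z" for z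
    by (simp add: mult.assoc[symmetric] sc_mult[symmetric] qpow_merge sc_1)
  have o: "x * (sc c * z) = sc c * (x * z)" "y * (sc c * z) = sc c * (y * z)" for c z
    by (rule sc_left)+
  show ?thesis unfolding serre_def qint_3 assms sc_add sc_1
    by (simp add: algebra_simps o n power2_eq_square power3_eq_cube)
qed

lemmas act_simps = act_diff act_add act_mult act_sc act_gn

lemma q2: "qpow 2 = qq ^ 2" "qpow (-2) = 1 / qq ^ 2"
  by (simp_all add: qpow_def power_int_minus field_simps)

definition dq :: K where "dq = dl"

lemma act_DD: "act DD f i j = dq * (zt i + wt j) * f i j"
proof -
  have "act DD f i j = (1 / qq ^ 2) * (ph (zt i) (wt j) * (ga (wt j) - ga (zt i / qq ^ 2)) / (wt j - zt i)
     + ph (wt j) (zt i) * (ga (zt i) - ga (wt j / qq ^ 2)) / (zt i - wt j)) * f i j"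
    by (simp add: DD_def act_simps gact_def dn_up up_dn zt_shift wt_shift ph_shift q2)
      (use qq_nz zt_wt(1)[of i j] zt_wt(1)[of i j, symmetric] in \<open>simp add: divide_simps, simp add: algebra_simps\<close>)
  also have "\<dots> = dq * (zt i + wt j) * f i j"
    unfolding dq_def diagonals(2)[OF zt_wt(4,5,2,3,1)] using qq_nz by simp
  finally show ?thesis .
qed

lemma act_DF: "act DF f i j = dq * (1 / zt i + 1 / wt j) * f i j"
proof -
  have "act DF f i j = (ph (zt i) (wt j) * (wt j ^ 2 * ga (zt i / qq ^ 2) - zt i ^ 2 * ga (wt j) / qq ^ 4) / (wt j - zt i)
     + ph (wt j) (zt i) * (zt i ^ 2 * ga (wt j / qq ^ 2) - wt j ^ 2 * ga (zt i) / qq ^ 4) / (zt i - wt j)) * f i j"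
    by (simp add: DF_def act_simps gact_def dn_up up_dn zt_shift wt_shift ph_shift q2)
      (use qq_nz zt_wt(1)[of i j] zt_wt(1)[of i j, symmetric] in \<open>simp add: divide_simps, simp add: algebra_simps eval_nat_numeral\<close>)
  also have "\<dots> = dq * (1 / zt i + 1 / wt j) * f i j"
    unfolding dq_def diagonals(3)[OF zt_wt(4,5,2,3,1)] ..
  finally show ?thesis .
qed

definition ep :: K where "ep = dq * (1 - 1 / qq ^ 2)"

lemma comm_diag_up:
  assumes "\<And>f i j. act d f i j = h i j * f i j" "\<And>f. act x f = up a b f"
  shows "act (d * x - x * d) f = up (\<lambda>i j. (h i j - h (i - 1) j) * a i j) (\<lambda>i j. (h i j - h i (j - 1)) * b i j) f"
  by (intro ext) (simp add: act_simps assms up_def algebra_simps)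

lemma comm_diag_dn:
  assumes "\<And>f i j. act d f i j = h i j * f i j" "\<And>f. act x f = dn a b f"
  shows "act (d * x - x * d) f = dn (\<lambda>i j. (h i j - h (i + 1) j) * a i j) (\<lambda>i j. (h i j - h i (j + 1)) * b i j) f"
  by (intro ext) (simp add: act_simps assms dn_def algebra_simps)

lemma act_E1: "act (E I1) f = up (\<lambda>i j. ph (zt i) (wt j)) (\<lambda>i j. ph (wt j) (zt i)) f"
  and act_E2: "act (E I2) f = dn (\<lambda>i j. ga (zt i) * ph (wt j) (zt i)) (\<lambda>i j. ga (wt j) * ph (zt i) (wt j)) f"
  and act_F1: "act (F I1) f = dn (\<lambda>i j. ga (zt i) * wt j * ph (wt j) (zt i)) (\<lambda>i j. ga (wt j) * zt i * ph (zt i) (wt j)) f"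
  and act_F2: "act (F I2) f = up (\<lambda>i j. wt j * ph (zt i) (wt j)) (\<lambda>i j. zt i * ph (wt j) (zt i)) f"
  by (simp_all add: act_gn gact_def)

fun adD :: "nat \<Rightarrow> ncpoly" where
  "adD 0 = E I1"
| "adD (Suc k) = DD * adD k - adD k * DD"

lemma ep_diff: "dq * (t + w) - dq * (t / qq ^ 2 + w) = ep * t" "dq * (t + w) - dq * (t + w / qq ^ 2) = ep * w"
  by (simp_all add: ep_def algebra_simps)

lemma act_adD: "act (adD k) f = up (\<lambda>i j. (ep * zt i) ^ k * ph (zt i) (wt j)) (\<lambda>i j. (ep * wt j) ^ k * ph (wt j) (zt i)) f"
proof (induction k arbitrary: f)
  case 0
  show ?case by (simp add: act_E1)
next
  case (Suc k)
  show ?case unfolding adD.simps comm_diag_up[OF act_DD Suc]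
    by (simp add: zt_shift wt_shift ep_diff mult.assoc)
qed

lemma ph_rel:
  assumes "t \<noteq> qq ^ 2 * w" "w \<noteq> qq ^ 2 * t"
  shows "t * ph t w - w * ph w t = qq ^ 2 * (w * ph t w - t * ph w t)"
proof -
  have "(t - qq ^ 2 * w) * ph t w = 1" "(w - qq ^ 2 * t) * ph w t = 1" using assms by (simp_all add: ph_def)
  then show ?thesis by (simp add: algebra_simps)
qed

lemma lin3:
  fixes c :: K
  assumes "c * x1 = y1" "c * x2 = y2" "c * x3 = y3"
  shows "c * (x1 * f1 + x2 * f2 + x3 * f3) - (y1 * f1 + y2 * f2 + y3 * f3) = 0"
    "y1 * f1 + y2 * f2 + y3 * f3 - c * (x1 * f1 + x2 * f2 + x3 * f3) = 0"
  unfolding assms[symmetric] by (simp_all add: algebra_simps)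

text \<open>Governs the terms that shift i once and j once. The products of two E's, two F's, or E_i
  with F_j for distinct i and j all reduce to it; terms shifting one variable twice match
  separately.\<close>

lemma mixed:
  assumes "w \<noteq> t" "t \<noteq> qq ^ 2 * w" "w \<noteq> qq ^ 2 * t"
  shows "qq ^ 2 * (ph t w * (w / (w - t)) + ph w t * (t / (t - w))) = t * (ph t w / (w - t)) + w * (ph w t / (t - w))"
proof -
  have t: "t - w = - (w - t)" by simp
  have "qq ^ 2 * (ph t w * (w / (w - t)) + ph w t * (t / (t - w))) = qq ^ 2 * (w * ph t w - t * ph w t) / (w - t)"
    unfolding t divide_minus_right by (simp add: diff_divide_distrib algebra_simps)
  also have "\<dots> = (t * ph t w - w * ph w t) / (w - t)" unfolding ph_rel[OF assms(2,3)] ..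
  also have "\<dots> = t * (ph t w / (w - t)) + w * (ph w t / (t - w))"
    unfolding t divide_minus_right by (simp add: diff_divide_distrib)
  finally show ?thesis .
qed

lemmas mixed_ij = mixed[OF zt_wt(1)[symmetric] zt_wt(2,3)]
lemma act_serre_E: "act (serre (E I1) (E I2)) f i j = 0"
proof -
  have "serre (E I1) (E I2) = sc (qpow 2) * (E I1 * adD 1) - adD 1 * E I1"
    using serre_left[OF DD_def] by simp
  then have "act (serre (E I1) (E I2)) f i j = qq ^ 2 * act (E I1) (act (adD 1) f) i j - act (adD 1) (act (E I1) f) i j"
    by (simp add: act_simps q2)
  also have "\<dots> = 0"
    unfolding act_adD act_E1 up_up
  proof (rule lin3(1), goal_cases)
    case 1
    show ?case
      using qq_nz by (simp add: zt_shift)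
  next
    case 3
    show ?case
      using qq_nz by (simp add: wt_shift)
  next
    case 2
    have "ep * (qq ^ 2 * (ph (zt i) (wt j) * (wt j / (wt j - zt i)) + ph (wt j) (zt i) * (zt i / (zt i - wt j))))
      = ep * (zt i * (ph (zt i) (wt j) / (wt j - zt i)) + wt j * (ph (wt j) (zt i) / (zt i - wt j)))"
      unfolding mixed_ij ..
    then show ?case
      by (simp add: zt_shift wt_shift ph_shift algebra_simps)
  qed
  finally show ?thesis .
qed

lemma mult_eqI: "c = d \<Longrightarrow> (e::K) * c = e * d" by simp

lemma serre_right':
  assumes "D = x * y - sc (qpow (-2)) * (y * x)"
  shows "serre x y = sc (qpow 2) * ((D * x - x * D) * x) - x * (D * x - x * D)"
  unfolding serre_right[OF assms] by (simp add: algebra_simps)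

lemma act_serre_E': "act (serre (E I2) (E I1)) f i j = 0"
proof -
  define k where "k = dq * (1 - qq ^ 2)"
  have A: "act (DD * E I2 - E I2 * DD) f = dn (\<lambda>i j. k * zt i * (ga (zt i) * ph (wt j) (zt i))) (\<lambda>i j. k * wt j * (ga (wt j) * ph (zt i) (wt j))) f" for f
    unfolding comm_diag_dn[OF act_DD act_E2]
    by (intro arg_cong2[where f = "\<lambda>a b. dn a b f"] ext) (simp_all add: zt_shift wt_shift k_def algebra_simps)
  have "act (serre (E I2) (E I1)) f i j = qq ^ 2 * act (DD * E I2 - E I2 * DD) (act (E I2) f) i j - act (E I2) (act (DD * E I2 - E I2 * DD) f) i j"
    unfolding serre_right'[OF DD_def] by (simp add: act_diff[of "sc _ * _"] act_mult[of "sc _"] act_sc act_mult[of _ "E I2"] act_mult[of "E I2" "DD * E I2 - E I2 * DD"] q2)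
  also have "\<dots> = 0"
    unfolding A act_E2 dn_dn
  proof (rule lin3(1), goal_cases)
    case 1
    show ?case
      by (simp add: zt_shift)
  next
    case 3
    show ?case
      by (simp add: wt_shift)
  next
    case 2
    note mult_eqI[OF mixed_ij, of "k * ga (zt i) * ga (wt j) / qq ^ 2" i j]
    then show ?case
      unfolding zt_shift wt_shift ph_shift using qq_nz
      by (simp add: distrib_left mult.assoc mult.left_commute mult.commute) (simp add: algebra_simps)?
  qed
  finally show ?thesis .
qed

lemma act_serre_F: "act (serre (F I1) (F I2)) f i j = 0"
proof -
  define k where "k = dq * (1 - 1 / qq ^ 2)"
  have A: "act (DF * F I1 - F I1 * DF) f = dn (\<lambda>i j. k / zt i * (ga (zt i) * wt j * ph (wt j) (zt i))) (\<lambda>i j. k / wt j * (ga (wt j) * zt i * ph (zt i) (wt j))) f" for f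
    unfolding comm_diag_dn[OF act_DF act_F1]
    by (intro arg_cong2[where f = "\<lambda>a b. dn a b f"] ext) (simp_all add: zt_shift wt_shift k_def algebra_simps diff_divide_distrib)
  have "act (serre (F I1) (F I2)) f i j = qq ^ 2 * act (F I1) (act (DF * F I1 - F I1 * DF) f) i j - act (DF * F I1 - F I1 * DF) (act (F I1) f) i j"
    unfolding serre_left[OF DF_def] by (simp add: act_diff[of "sc _ * _"] act_mult[of "sc _"] act_sc act_mult[of _ "F I1"] act_mult[of "F I1" "DF * F I1 - F I1 * DF"] q2)
  also have "\<dots> = 0"
    unfolding A act_F1 dn_dn
  proof (rule lin3(1), goal_cases)
    case 1
    show ?case
      using qq_nz by (simp add: zt_shift)
  next
    case 3
    show ?case
      using qq_nz by (simp add: wt_shift)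
  next
    case 2
    note mult_eqI[OF mixed_ij, of "k * ga (zt i) * ga (wt j)" i j]
    then show ?case
      unfolding zt_shift wt_shift ph_shift using qq_nz zt_wt(4)[of i] zt_wt(5)[of j]
      by (simp add: distrib_left mult.assoc mult.left_commute mult.commute) (simp add: algebra_simps)?
  qed
  finally show ?thesis .
qed

lemma act_serre_F': "act (serre (F I2) (F I1)) f i j = 0"
proof -
  define k where "k = dq * (1 - qq ^ 2)"
  have A: "act (DF * F I2 - F I2 * DF) f = up (\<lambda>i j. k / zt i * (wt j * ph (zt i) (wt j))) (\<lambda>i j. k / wt j * (zt i * ph (wt j) (zt i))) f" for f
    unfolding comm_diag_up[OF act_DF act_F2]
    by (intro arg_cong2[where f = "\<lambda>a b. up a b f"] ext) (simp_all add: zt_shift wt_shift k_def algebra_simps diff_divide_distrib)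
  have "act (serre (F I2) (F I1)) f i j = qq ^ 2 * act (DF * F I2 - F I2 * DF) (act (F I2) f) i j - act (F I2) (act (DF * F I2 - F I2 * DF) f) i j"
    unfolding serre_right'[OF DF_def] by (simp add: act_diff[of "sc _ * _"] act_mult[of "sc _"] act_sc act_mult[of _ "F I2"] act_mult[of "F I2" "DF * F I2 - F I2 * DF"] q2)
  also have "\<dots> = 0"
    unfolding A act_F2 up_up
  proof (rule lin3(1), goal_cases)
    case 1
    show ?case
      using qq_nz by (simp add: zt_shift)
  next
    case 3
    show ?case
      using qq_nz by (simp add: wt_shift)
  next
    case 2
    note mult_eqI[OF mixed_ij, of "k / qq ^ 2" i j]
    then show ?case
      unfolding zt_shift wt_shift ph_shift using qq_nz zt_wt(4)[of i] zt_wt(5)[of j]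
      by (simp add: distrib_left mult.assoc mult.left_commute mult.commute) (simp add: algebra_simps)?
  qed
  finally show ?thesis .
qed

lemma lin3':
  fixes x1 :: K
  assumes "x1 = y1" "x2 = y2" "x3 = y3"
  shows "x1 * f1 + x2 * f2 + x3 * f3 - (y1 * f1 + y2 * f2 + y3 * f3) = 0"
  using assms by simp

lemma act_E1_F2: "act (E I1 * F I2 - F I2 * E I1) f i j = 0"
  unfolding act_diff act_mult act_E1 act_F2 up_up
proof (rule lin3', goal_cases)
  case 2
  note mult_eqI[OF mixed_ij, of "1 / qq ^ 2" i j]
  then show ?case
    unfolding zt_shift wt_shift ph_shift using qq_nz
    by (simp add: distrib_left mult.assoc mult.left_commute mult.commute) (simp add: algebra_simps)?
qed simp_all

lemma act_E2_F1: "act (E I2 * F I1 - F I1 * E I2) f i j = 0"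
  unfolding act_diff act_mult act_E2 act_F1 dn_dn
proof (rule lin3', goal_cases)
  case 2
  note mult_eqI[OF mixed_ij, of "ga (zt i) * ga (wt j) / qq ^ 2" i j]
  then show ?case
    unfolding zt_shift wt_shift ph_shift using qq_nz
    by (simp add: distrib_left mult.assoc mult.left_commute mult.commute) (simp add: algebra_simps)?
qed simp_all

lemma act_K:
  "act (KK I1) f i j = zt i * wt j * f i j" "act (Ki I1) f i j = 1 / (zt i * wt j) * f i j"
  "act (KK I2) f i j = 1 / (zt i * wt j) * f i j" "act (Ki I2) f i j = zt i * wt j * f i j"
  by (simp_all add: act_gn gact_def dg_def)

lemma act_EF_diag:
  "act (E I1 * F I1 - F I1 * E I1) f i j = (zt i * wt j - 1 / (zt i * wt j)) / (qq - 1 / qq) * f i j"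
  "act (E I2 * F I2 - F I2 * E I2) f i j = (1 / (zt i * wt j) - zt i * wt j) / (qq - 1 / qq) * f i j"
proof -
  note t = zt_wt(1)[of i j]
  have m: "x / (zt i - wt j) = - (x / (wt j - zt i))" for x
    by (metis minus_diff_eq divide_minus_right)
  have m': "1 / (c * (zt i - wt j)) = - (1 / (c * (wt j - zt i)))" for c
    by (metis minus_diff_eq mult_minus_right divide_minus_right)
  note d = diagonals(1)[OF zt_wt(4,5,2,3,1), of i j]
  have "act (E I1 * F I1 - F I1 * E I1) f i j = - (ph (zt i) (wt j) * (zt i * ga (wt j) / qq\<^sup>2 - wt j * ga (zt i / qq\<^sup>2)) / (wt j - zt i) +
     ph (wt j) (zt i) * (wt j * ga (zt i) / qq\<^sup>2 - zt i * ga (wt j / qq\<^sup>2)) / (zt i - wt j)) * f i j"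
    unfolding act_diff act_mult act_E1 act_F1 up_dn dn_up zt_shift wt_shift ph_shift
    using qq_nz by (simp add: m m') (simp add: algebra_simps diff_divide_distrib add_divide_distrib)
  then show "act (E I1 * F I1 - F I1 * E I1) f i j = (zt i * wt j - 1 / (zt i * wt j)) / (qq - 1 / qq) * f i j"
    unfolding d by (simp add: diff_divide_distrib)
  have "act (E I2 * F I2 - F I2 * E I2) f i j = (ph (zt i) (wt j) * (zt i * ga (wt j) / qq\<^sup>2 - wt j * ga (zt i / qq\<^sup>2)) / (wt j - zt i) +
     ph (wt j) (zt i) * (wt j * ga (zt i) / qq\<^sup>2 - zt i * ga (wt j / qq\<^sup>2)) / (zt i - wt j)) * f i j"
    unfolding act_diff act_mult act_E2 act_F2 up_dn dn_up zt_shift wt_shift ph_shift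
    using qq_nz by (simp add: m m') (simp add: algebra_simps diff_divide_distrib add_divide_distrib)
  then show "act (E I2 * F I2 - F I2 * E I2) f i j = (1 / (zt i * wt j) - zt i * wt j) / (qq - 1 / qq) * f i j"
    unfolding d .
qed

lemma act_Rels: "x \<in> Rels \<Longrightarrow> act x f i j = 0"
proof -
  have nz: "zt i * wt j \<noteq> 0" using zt_wt by simp
  have 1: "act (KK I1 * KK I2 - KK I2 * KK I1) f i j = 0"
    by (simp add: act_diff act_mult act_K)
  have 2: "act (KK k * Ki k - 1) f i j = 0" "act (Ki k * KK k - 1) f i j = 0" for k
    using nz by (cases k; simp add: act_diff act_mult act_K act_1)+
  have 3: "act (KK k * E l * Ki k - sc (qpow (cartan k l)) * E l) f i j = 0" for k l
    using nz qq_nz by (cases k; cases l; simp add: act_diff act_mult act_K act_sc act_E1 act_E2 up_def dn_def zt_shift wt_shift cartan_def q2)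
      (simp_all add: field_simps)
  have 4: "act (KK k * F l * Ki k - sc (qpow (- cartan k l)) * F l) f i j = 0" for k l
    using nz qq_nz by (cases k; cases l; simp add: act_diff act_mult act_K act_sc act_F1 act_F2 up_def dn_def zt_shift wt_shift cartan_def q2)
      (simp_all add: field_simps)
  have 5: "act (E k * F l - F l * E k - (if k = l then sc (inverse (qq - inverse qq)) * (KK k - Ki k) else 0)) f i j = 0" for k l
  proof (cases "k = l")
    case True
    then show ?thesis
      by (cases l; simp add: act_diff[of "_ - _"] act_EF_diag act_mult[of "sc _"] act_sc)
        (simp_all add: act_diff act_K divide_simps, simp_all add: algebra_simps)
  next
    case False
    then show ?thesis by (cases k; cases l; simp add: act_E1_F2 act_E2_F1)
  qed
  have 6: "act (serre (E k) (E (other k))) f i j = 0" "act (serre (F k) (F (other k))) f i j = 0" for k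
    by (cases k; simp add: other_def act_serre_E act_serre_E' act_serre_F act_serre_F')+
  assume "x \<in> Rels"
  then show ?thesis unfolding Rels_def using 1 2 3 4 5 6 by blast
qed

lemma act_Ideal: "x \<in> Ideal \<Longrightarrow> act x f i j = 0"
proof (induction arbitrary: f i j rule: Ideal.induct)
  case (gen r) then show ?case by (rule act_Rels)
next
  case zero show ?case by (rule act_0)
next
  case (add a b) then show ?case by (simp add: act_add)
next
  case (mult a x y)
  have "act a (act y f) = (\<lambda>i j. 0)" using mult.IH by (intro ext)
  then have "act (x * a * y) f i j = act x (\<lambda>i j. 0) i j" by (simp add: act_mult)
  also have "\<dots> = 0" using act_lin[of x 0 "\<lambda>_ _. 0" 0 "\<lambda>_ _. 0"] by simp
  finally show ?case .
qed

text \<open>Supplies 0 distinct from 1 in the quotient, as the class \<open>ring_1\<close>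
  demands.\<close>

lemma one_notin_Ideal: "1 \<notin> Ideal"
  using act_Ideal[of 1 "\<lambda>_ _. 1" 0 0] by (auto simp: act_1)

lemma dq_nz: "dq \<noteq> 0" "ep \<noteq> 0"
proof -
  have "qq ^ 4 \<noteq> 1" "qq ^ 2 \<noteq> 1"
    using qpow_eq_1[of 4] qpow_eq_1[of 2] by (simp_all add: qpow_def)
  then show "dq \<noteq> 0" "ep \<noteq> 0" using qq_nz cq_nz by (simp_all add: ep_def dq_def)
qed

definition adP0 :: ncpoly where "adP0 = adD 2 * adD 0 - sc (qpow 2) * (adD 1 * adD 1)"
definition adP1 :: ncpoly where "adP1 = adD 3 * adD 1 - sc (qpow 2) * (adD 2 * adD 2)"

text \<open>In both quadratic expressions the terms shifting one variable twice cancel, leaving one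
  diagonal shift with a nonzero coefficient.\<close>

lemma act_P:
  "act adP0 f i j = - (ep ^ 2 * f (i - 1) (j - 1))"
  "act adP1 f i j = - (ep ^ 4 * zt i * wt j * f (i - 1) (j - 1))"
proof -
  have r: "(zt i - qq ^ 2 * wt j) * ph (zt i) (wt j) = 1" "(wt j - qq ^ 2 * zt i) * ph (wt j) (zt i) = 1"
    using zt_wt(2)[of i j] zt_wt(3)[of j i] by (simp_all add: ph_def)
  have "(zt i * ((zt i - qq ^ 2 * wt j) * ph (zt i) (wt j)) - wt j * ((wt j - qq ^ 2 * zt i) * ph (wt j) (zt i))) / (wt j - zt i) = - 1"
    unfolding r using zt_wt(1)[of i j] by (simp add: divide_simps)
  then have m: "(zt i ^ 2 * ph (zt i) (wt j) - wt j ^ 2 * ph (wt j) (zt i) - qq ^ 2 * (zt i * wt j * ph (zt i) (wt j) - zt i * wt j * ph (wt j) (zt i))) / (wt j - zt i) = - 1"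
    by (simp add: algebra_simps power2_eq_square)
  have d: "x / (zt i - wt j) = - (x / (wt j - zt i))" for x
    by (metis minus_diff_eq divide_minus_right)
  have "act adP0 f i j = ep ^ 2 * ((zt i ^ 2 * ph (zt i) (wt j) - wt j ^ 2 * ph (wt j) (zt i) - qq ^ 2 * (zt i * wt j * ph (zt i) (wt j) - zt i * wt j * ph (wt j) (zt i))) / (wt j - zt i)) * f (i - 1) (j - 1)"
    unfolding adP0_def adP1_def act_diff act_mult act_adD act_sc up_up zt_shift wt_shift ph_shift d q2
    using qq_nz by (simp add: algebra_simps power2_eq_square diff_divide_distrib add_divide_distrib)
  then show "act adP0 f i j = - (ep ^ 2 * f (i - 1) (j - 1))"
    unfolding m by simp
  have "act adP1 f i j = ep ^ 4 * zt i * wt j * ((zt i ^ 2 * ph (zt i) (wt j) - wt j ^ 2 * ph (wt j) (zt i) - qq ^ 2 * (zt i * wt j * ph (zt i) (wt j) - zt i * wt j * ph (wt j) (zt i))) / (wt j - zt i)) * f (i - 1) (j - 1)"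
    unfolding adP0_def adP1_def act_diff act_mult act_adD act_sc up_up zt_shift wt_shift ph_shift d q2
    using qq_nz by (simp add: algebra_simps eval_nat_numeral diff_divide_distrib add_divide_distrib)
  then show "act adP1 f i j = - (ep ^ 4 * zt i * wt j * f (i - 1) (j - 1))"
    unfolding m by simp
qed

section \<open>Lowest rows: no monomial acts as zero\<close>

definition low :: "int \<Rightarrow> vec \<Rightarrow> bool" where
  "low n f \<longleftrightarrow> (\<forall>i j. j < n \<longrightarrow> f i j = 0) \<and> (\<exists>i. f i n \<noteq> 0)"

text \<open>In the lowest row only the shift in i contributes, the other term coming from the zero
  row beneath; its coefficient has no zeros, so the row survives.\<close>

lemma low_adD:
  assumes "low n f" shows "low n (act (adD k) f)"
proof -
  obtain i where i: "f i n \<noteq> 0" using assms by (auto simp: low_def)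
  have z: "f i j = 0" if "j < n" for i j using assms that by (auto simp: low_def)
  have "ph (zt (i + 1)) (wt n) \<noteq> 0" using zt_wt(2)[of "i + 1" n] by (simp add: ph_def)
  with i have "act (adD k) f (i + 1) n \<noteq> 0"
    by (simp add: act_adD up_def z dq_nz zt_wt)
  moreover have "act (adD k) f i j = 0" if "j < n" for i j
    using that by (simp add: act_adD up_def z)
  ultimately show ?thesis by (auto simp: low_def)
qed

lemma low_P:
  assumes "low n f"
  shows "low (n + 1) (act adP0 f)"
    "low (n + 1) (act adP1 f)"
proof -
  obtain i where i: "f i n \<noteq> 0" using assms by (auto simp: low_def)
  have z: "f i j = 0" if "j < n" for i j using assms that by (auto simp: low_def)
  show "low (n + 1) (act adP0 f)"
    "low (n + 1) (act adP1 f)"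
    using i z by (auto simp: low_def act_P dq_nz zt_wt intro!: exI[of _ "i + 1"])
qed

lemma low_act_power:
  assumes "\<And>n f. low n f \<Longrightarrow> \<exists>m. low m (act x f)" "low n f"
  shows "\<exists>m. low m (act (x ^ k) f)"
  by (induction k) (use assms in \<open>auto simp: act_1 act_mult\<close>)

section \<open>The quotient algebra\<close>

lemma Ideal_uminus: "a \<in> Ideal \<Longrightarrow> - a \<in> Ideal"
  using Ideal.mult[of a "- 1" 1] by simp

lemma Ideal_diff: "a \<in> Ideal \<Longrightarrow> b \<in> Ideal \<Longrightarrow> a - b \<in> Ideal"
  using Ideal.add[OF _ Ideal_uminus] by fastforce

lemma equivp_Ueq: "equivp Ueq"
proof (rule equivpI)
  show "reflp Ueq" by (simp add: reflp_def Ueq_def Ideal.zero)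
  show "symp Ueq" by (metis Ideal_uminus Ueq_def minus_diff_eq sympI)
  show "transp Ueq"
  proof (rule transpI)
    fix x y z assume "x \<simeq> y" "y \<simeq> z"
    then have "(x - y) + (y - z) \<in> Ideal" unfolding Ueq_def by (rule Ideal.add)
    then show "x \<simeq> z" by (simp add: Ueq_def)
  qed
qed

quotient_type Uq = ncpoly / Ueq by (rule equivp_Ueq)

instantiation Uq :: ring_1
begin

lift_definition zero_Uq :: Uq is 0 .
lift_definition one_Uq :: Uq is 1 .
lift_definition plus_Uq :: "Uq \<Rightarrow> Uq \<Rightarrow> Uq" is "(+)"
  unfolding Ueq_def by (metis Ideal.add add_diff_add)
lift_definition minus_Uq :: "Uq \<Rightarrow> Uq \<Rightarrow> Uq" is "(-)"
proof -
  fix a b c d assume "a \<simeq> b" "c \<simeq> d"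
  then have "(a - b) - (c - d) \<in> Ideal" unfolding Ueq_def by (rule Ideal_diff)
  then show "a - c \<simeq> b - d" by (simp add: Ueq_def algebra_simps)
qed
lift_definition uminus_Uq :: "Uq \<Rightarrow> Uq" is "uminus"
  unfolding Ueq_def using Ideal_uminus by fastforce
lift_definition times_Uq :: "Uq \<Rightarrow> Uq \<Rightarrow> Uq" is "(*)"
proof -
  fix a b c d assume "a \<simeq> b" "c \<simeq> d"
  then have "1 * (a - b) * c + b * (c - d) * 1 \<in> Ideal"
    unfolding Ueq_def by (intro Ideal.add Ideal.mult)
  then show "a * c \<simeq> b * d" by (simp add: Ueq_def algebra_simps)
qed

instance
proof
  show "(0::Uq) \<noteq> 1"
    by transfer (use one_notin_Ideal Ideal_uminus[of "- 1"] in \<open>auto simp: Ueq_def\<close>)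
qed (transfer; simp add: equivp_reflp[OF equivp_Ueq] algebra_simps)+

end

lemma abs_Uq_hom:
  "abs_Uq (x + y) = abs_Uq x + abs_Uq y" "abs_Uq (x - y) = abs_Uq x - abs_Uq y"
  "abs_Uq (x * y) = abs_Uq x * abs_Uq y" "abs_Uq (- x) = - abs_Uq x" "abs_Uq 1 = 1" "abs_Uq 0 = 0"
  by (simp_all add: plus_Uq.abs_eq minus_Uq.abs_eq times_Uq.abs_eq uminus_Uq.abs_eq one_Uq.abs_eq zero_Uq.abs_eq)

lemma abs_Uq_power: "abs_Uq (x ^ n) = abs_Uq x ^ n"
  by (induction n) (simp_all add: abs_Uq_hom)

lemma abs_Uq_sum: "abs_Uq (sum h S) = (\<Sum>i\<in>S. abs_Uq (h i))"
  by (induction S rule: infinite_finite_induct) (simp_all add: abs_Uq_hom)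

lemma abs_Uq_eq: "abs_Uq x = abs_Uq y \<longleftrightarrow> x \<simeq> y"
  by (rule Uq.abs_eq_iff)

lemma abs_Uq_eq_0: "abs_Uq x = 0 \<longleftrightarrow> x \<in> Ideal"
  using abs_Uq_eq[of x 0] by (simp add: abs_Uq_hom Ueq_def)

lemma Rels_abs_Uq: "x - y \<in> Rels \<Longrightarrow> abs_Uq x = abs_Uq y"
  unfolding abs_Uq_eq Ueq_def by (rule Ideal.gen)

definition S :: "K \<Rightarrow> Uq" where "S c = abs_Uq (sc c)"

interpretation U: uq_full S "abs_Uq (E I1)" "abs_Uq (E I2)" "abs_Uq (F I1)" "abs_Uq (F I2)"
  "abs_Uq (KK I1)" "abs_Uq (KK I2)" "abs_Uq (Ki I1)" "abs_Uq (Ki I2)"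
proof -
  have serre: "abs_Uq (serre (E i) (E (other i))) = 0" for i
    unfolding abs_Uq_eq_0 by (rule Ideal.gen) (auto simp: Rels_def)
  have one: "S 1 = 1" by (simp add: S_def sc_1 abs_Uq_hom)
  have mult: "S (a * b) = S a * S b" for a b by (simp add: S_def sc_mult abs_Uq_hom)
  have comm: "S a * x = x * S a" for a x
    by (induction x rule: Uq.abs_induct) (simp add: S_def abs_Uq_hom[symmetric] sc_comm)
  have inv: "k * z * l = t \<Longrightarrow> l * k = 1 \<Longrightarrow> k * z = t * (k::Uq)" for k z l t
    by (metis mult.assoc mult.right_neutral)
  have kl: "abs_Uq (KK i) * abs_Uq (Ki i) = 1" "abs_Uq (Ki i) * abs_Uq (KK i) = 1" for i
    unfolding abs_Uq_hom(3,5)[symmetric] by (rule Rels_abs_Uq; auto simp: Rels_def)+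
  have kE: "abs_Uq (KK i) * abs_Uq (E j) = S (qpow (cartan i j)) * (abs_Uq (E j) * abs_Uq (KK i))" for i j
  proof -
    have "abs_Uq (KK i * E j * Ki i) = abs_Uq (sc (qpow (cartan i j)) * E j)"
      by (rule Rels_abs_Uq) (auto simp: Rels_def)
    from inv[OF this[unfolded abs_Uq_hom] kl(2)] show ?thesis by (simp add: S_def mult.assoc)
  qed
  have kF: "abs_Uq (KK i) * abs_Uq (F j) = S (qpow (- cartan i j)) * (abs_Uq (F j) * abs_Uq (KK i))" for i j
  proof -
    have "abs_Uq (KK i * F j * Ki i) = abs_Uq (sc (qpow (- cartan i j)) * F j)"
      by (rule Rels_abs_Uq) (auto simp: Rels_def)
    from inv[OF this[unfolded abs_Uq_hom] kl(2)] show ?thesis by (simp add: S_def mult.assoc)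
  qed
  have EF: "abs_Uq (E i) * abs_Uq (F j) = abs_Uq (F j) * abs_Uq (E i)
      + (if i = j then S (inverse (qq - inverse qq)) * (abs_Uq (KK i) - abs_Uq (Ki i)) else 0)" for i j
  proof -
    have "abs_Uq (E i * F j - F j * E i) = abs_Uq (if i = j then sc (inverse (qq - inverse qq)) * (KK i - Ki i) else 0)"
      by (rule Rels_abs_Uq) (unfold Rels_def, blast)
    then show ?thesis by (auto simp: abs_Uq_hom S_def algebra_simps split: if_splits)
  qed
  show "uq_full S (abs_Uq (E I1)) (abs_Uq (E I2)) (abs_Uq (F I1)) (abs_Uq (F I2))
    (abs_Uq (KK I1)) (abs_Uq (KK I2)) (abs_Uq (Ki I1)) (abs_Uq (Ki I2))"
  proof (unfold_locales)
    show "S (a + b) = S a + S b" for a b by (simp add: S_def sc_add abs_Uq_hom)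
    show "S (a * b) = S a * S b" for a b by (rule mult)
    show "S 1 = 1" by (rule one)
    show "S a * x = x * S a" for a x by (rule comm)
    let ?x = "abs_Uq (E I1)" and ?y = "abs_Uq (E I2)"
    show "((?y * ?x - S (qpow (-2)) * (?x * ?y)) * ?x - ?x * (?y * ?x - S (qpow (-2)) * (?x * ?y))) * ?x
      = S (qpow 2) * (?x * ((?y * ?x - S (qpow (-2)) * (?x * ?y)) * ?x - ?x * (?y * ?x - S (qpow (-2)) * (?x * ?y))))"
      using serre[of I1] unfolding other_def if_True simp_thms serre_left[OF refl] abs_Uq_hom S_def[symmetric] by simp
    show "?y * (?y * (?y * ?x - S (qpow (-2)) * (?x * ?y)) - (?y * ?x - S (qpow (-2)) * (?x * ?y)) * ?y)
      = S (qpow 2) * ((?y * (?y * ?x - S (qpow (-2)) * (?x * ?y)) - (?y * ?x - S (qpow (-2)) * (?x * ?y)) * ?y) * ?y)"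
      using serre[of I2] by (simp add: other_def serre_right[OF refl] abs_Uq_hom S_def[symmetric])
    have "abs_Uq (KK I1 * KK I2) = abs_Uq (KK I2 * KK I1)" by (rule Rels_abs_Uq) (simp add: Rels_def)
    then show "abs_Uq (KK I2) * abs_Uq (KK I1) = abs_Uq (KK I1) * abs_Uq (KK I2)" by (simp add: abs_Uq_hom)
  qed (simp_all only: kl kE[of I1 I1] kE[of I1 I2] kE[of I2 I1] kE[of I2 I2] kF[of I1 I1] kF[of I1 I2] kF[of I2 I1] kF[of I2 I2]
      EF[of I1 I1] EF[of I1 I2] EF[of I2 I1] EF[of I2 I2], simp_all add: cartan_def)
qed

section \<open>Identification of the root vectors with iterated commutators\<close>

definition braidE :: "ix \<Rightarrow> ncpoly" where
  "braidE i = (\<Sum>r\<le>2. sc ((-1) ^ r * qpow (- int r)) * dpow (E i) r * E (other i) * dpow (E i) (2 - r))"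

lemma qfact_2: "qfact 0 = 1" "qfact 1 = 1" "qfact 2 = qint 2"
proof -
  show "qfact 0 = 1" by (simp add: qfact_def)
  then show 1: "qfact 1 = 1" using qfact_Suc[of 0] qint_1 by simp
  show "qfact 2 = qint 2" using qfact_Suc[of 1] 1 by (simp add: numeral_2_eq_2)
qed

lemma dpow_values: "dpow z 0 = 1" "dpow z 1 = z" "dpow z 2 = sc (inverse (qint 2)) * (z * z)"
  by (simp_all only: dpow_def qfact_2) (simp_all add: sc_1 power2_eq_square)

lemma braidE_expand: "braidE i = sc (inverse (qint 2)) * (E (other i) * (E i * E i))
   - sc (qpow (-1)) * (E i * (E (other i) * E i)) + sc (qpow (-2)) * (sc (inverse (qint 2)) * (E i * (E i * E (other i))))"
proof -
  have c: "x * (sc c * y) = sc c * (x * y)" for x c y by (rule sc_left)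
  have 2: "{..2::nat} = {0, 1, 2}" by auto
  have sub: "2 - (0::nat) = 2" "2 - (1::nat) = 1" "2 - (2::nat) = 0" by simp_all
  have "braidE i = sc ((-1) ^ 0 * qpow (- int 0)) * dpow (E i) 0 * E (other i) * dpow (E i) 2
    + (sc ((-1) ^ 1 * qpow (- int 1)) * dpow (E i) 1 * E (other i) * dpow (E i) 1
    + sc ((-1) ^ 2 * qpow (- int 2)) * dpow (E i) 2 * E (other i) * dpow (E i) 0)"
    unfolding braidE_def 2 by (simp add: sub)
  also have "\<dots> = sc (inverse (qint 2)) * (E (other i) * (E i * E i))
   - sc (qpow (-1)) * (E i * (E (other i) * E i)) + sc (qpow (-2)) * (sc (inverse (qint 2)) * (E i * (E i * E (other i))))"
    unfolding dpow_values by (simp add: sc_1 sc_minus mult.assoc c[of "E (other i)"])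
  finally show ?thesis .
qed

lemma T_E_other: "T i (E (other i)) = braidE i"
  by (cases i) (simp_all add: T_def ext_hom_gn Tgen_def braidE_def other_def)

lemma T_E: "T i (E i) = - (Ki i * F i)"
  by (simp add: T_def ext_hom_gn Tgen_def)

lemma T_hom: "T i (x + y) = T i x + T i y" "T i (x - y) = T i x - T i y" "T i (x * y) = T i x * T i y"
  "T i (- x) = - T i x" "T i (sc c) = sc c"
  by (simp_all add: T_def ext_hom_add ext_hom_diff ext_hom_mult ext_hom_minus ext_hom_sc)

text \<open>Applied with h a composite of the T_i and the quotient map: a composite T-image of a
  generator is then the braid polynomial in the h-images of two generators.\<close>

lemma braid_image:
  assumes "\<And>x y. h (x + y) = h x + h y" "\<And>x y. h (x - y) = h x - h y" "\<And>x y. h (x * y) = h x * h y" "\<And>c. h (sc c) = S c"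
  shows "h (braidE i) = U.braid (h (E i)) (h (E (other i)))"
  by (simp add: braidE_expand assms U.braid_def)

abbreviation "q2i \<equiv> inverse (qint 2)"

lemma abs_v0: "abs_Uq (v 0) = U.a 0" by (simp add: v_def)

lemma abs_v1: "abs_Uq (v 1) = S q2i * U.a 1"
proof -
  have "abs_Uq (T I1 (E I2)) = U.braid (abs_Uq (E I1)) (abs_Uq (E I2))"
    using braid_image[of abs_Uq I1] T_E_other[of I1] by (simp add: abs_Uq_hom S_def other_def)
  then show ?thesis using U.braid_v1 by (simp add: v_def)
qed

lemma abs_v2: "abs_Uq (v 2) = S (q2i ^ 2) * U.a 2"
proof -
  have "abs_Uq (T I1 (T I2 (E I1))) = U.braid (abs_Uq (T I1 (E I2))) (abs_Uq (T I1 (E I1)))"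
    using braid_image[of "\<lambda>x. abs_Uq (T I1 x)" I2] T_E_other[of I2] by (simp add: abs_Uq_hom T_hom S_def other_def)
  also have "abs_Uq (T I1 (E I2)) = S q2i * U.a 1" using abs_v1 by (simp add: v_def)
  also have "abs_Uq (T I1 (E I1)) = - (abs_Uq (Ki I1) * abs_Uq (F I1))" by (simp add: T_E abs_Uq_hom)
  finally show ?thesis unfolding U.braid_v2 by (simp add: v_def)
qed

lemma abs_T_F2: "abs_Uq (T I1 (F I2)) = U.Ym"
proof -
  have c: "x * (sc c * y) = sc c * (x * y)" for x c y by (rule sc_left)
  have 2: "{..2::nat} = {0, 1, 2}" by auto
  have sub: "2 - (0::nat) = 2" "2 - (1::nat) = 1" "2 - (2::nat) = 0" by simp_all
  have "T I1 (F I2) = (\<Sum>r\<le>2. sc ((-1) ^ r * qpow (int r)) * dpow (F I1) (2 - r) * F I2 * dpow (F I1) r)"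
    by (simp add: T_def ext_hom_gn Tgen_def)
  also have "\<dots> = sc ((-1) ^ 0 * qpow (int 0)) * dpow (F I1) 2 * F I2 * dpow (F I1) 0
    + (sc ((-1) ^ 1 * qpow (int 1)) * dpow (F I1) 1 * F I2 * dpow (F I1) 1
    + sc ((-1) ^ 2 * qpow (int 2)) * dpow (F I1) 0 * F I2 * dpow (F I1) 2)"
    unfolding 2 by (simp add: sub)
  also have "\<dots> = sc (inverse (qint 2)) * (F I1 * (F I1 * F I2)) - sc (qpow 1) * (F I1 * (F I2 * F I1))
     + sc (qpow 2) * (sc (inverse (qint 2)) * (F I2 * (F I1 * F I1)))"
    unfolding dpow_values by (simp add: sc_1 sc_minus mult.assoc c[of "F I2"])
  finally show ?thesis by (simp add: abs_Uq_hom S_def U.Ym_def)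
qed

lemma abs_v3: "abs_Uq (v 3) = S (q2i ^ 3) * U.a 3"
proof -
  have "abs_Uq (T I1 (T I2 (T I1 (E I2)))) = U.braid (abs_Uq (T I1 (T I2 (E I1)))) (abs_Uq (T I1 (T I2 (E I2))))"
    using braid_image[of "\<lambda>x. abs_Uq (T I1 (T I2 x))" I1] T_E_other[of I1] by (simp add: abs_Uq_hom T_hom S_def other_def)
  also have "abs_Uq (T I1 (T I2 (E I1))) = S (q2i ^ 2) * U.a 2" using abs_v2 by (simp add: v_def)
  also have "abs_Uq (T I1 (T I2 (E I2))) = - (abs_Uq (Ki I2) * (abs_Uq (Ki I1) * (abs_Uq (Ki I1) * U.Ym)))"
  proof -
    have "T I1 (Ki I2) = Ki I2 * Ki I1 ^ 2"
      by (simp add: T_def ext_hom_gn Tgen_def cartan_def numeral_2_eq_2)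
    then show ?thesis by (simp add: T_E T_hom abs_Uq_hom abs_T_F2 power2_eq_square mult.assoc)
  qed
  finally show ?thesis unfolding U.braid_v3 by (simp add: v_def)
qed

text \<open>One factor 1/[2] per commutator and the normalising factor (1 - q^-2)^-2 per index, so
  that u_k = cu^k a_k.\<close>

definition cu :: K where "cu = q2i * inverse ((1 - qpow (-2)) ^ 2)"

lemma cu_nz: "cu \<noteq> 0"
proof -
  have "1 - qpow (-2) \<noteq> 0" using qpow_eq_1[of "-2"] by simp
  then show ?thesis by (simp add: cu_def qint_eq_0)
qed

lemma abs_u: "k \<le> 3 \<Longrightarrow> abs_Uq (u k) = U.w cu k"
proof -
  assume "k \<le> 3"
  then have "k = 0 \<or> k = 1 \<or> k = 2 \<or> k = 3" by auto
  then have "abs_Uq (v k) = S (q2i ^ k) * U.a k"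
    using abs_v0 abs_v1 abs_v2 abs_v3 by auto
  moreover have "cu ^ k = inverse ((1 - qpow (-2)) ^ (2 * k)) * q2i ^ k"
    unfolding cu_def power_mult_distrib power_inverse power_mult by (rule mult.commute)
  ultimately show ?thesis
    by (simp add: u_def U.w_def abs_Uq_hom U.s_mult mult.assoc S_def[symmetric])
qed

interpretation A: kron_alg S "abs_Uq (u 0)" "abs_Uq (u 1)" "abs_Uq (u 2)" "abs_Uq (u 3)"
proof -
  interpret kron "\<lambda>m. S (qpow m)" "abs_Uq (u 0)" "abs_Uq (u 1)" "abs_Uq (u 2)" "abs_Uq (u 3)"
    using U.kron_w[of cu] by (simp add: abs_u)
  show "kron_alg S (abs_Uq (u 0)) (abs_Uq (u 1)) (abs_Uq (u 2)) (abs_Uq (u 3))"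
    by unfold_locales
qed

lemma abs_adD: "abs_Uq (adD k) = U.a k"
proof (induction k)
  case (Suc k)
  have "abs_Uq DD = U.d" by (simp add: DD_def U.d_def abs_Uq_hom S_def)
  with Suc show ?case by (simp add: abs_Uq_hom U.\<delta>_def)
qed simp

lemma abs_u_adD: "k \<le> 3 \<Longrightarrow> abs_Uq (u k) = abs_Uq (sc (cu ^ k) * adD k)"
  by (simp add: abs_u U.w_def abs_Uq_hom abs_adD S_def)

lemma abs_P: "A.P0 = abs_Uq (sc (cu ^ 2) * adP0)" "A.P1 = abs_Uq (sc (cu ^ 4) * adP1)"
proof -
  have "A.P0 = S (cu ^ 2) * (U.a 2 * U.a 0) - S (qpow 2) * (S (cu ^ 2) * (U.a 1 * U.a 1))"
    unfolding A.P0_def using U.w_mult[of cu 2 0] U.w_mult[of cu 1 1] by (simp add: abs_u numeral_2_eq_2)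
  then show "A.P0 = abs_Uq (sc (cu ^ 2) * adP0)"
    by (simp add: adP0_def abs_Uq_hom S_def abs_adD right_diff_distrib U.s_pull[unfolded S_def, of "abs_Uq (sc (qpow 2))"] del: U.a.simps adD.simps)
  have "A.P1 = S (cu ^ 4) * (U.a 3 * U.a 1) - S (qpow 2) * (S (cu ^ 4) * (U.a 2 * U.a 2))"
    unfolding A.P1_def using U.w_mult[of cu 3 1] U.w_mult[of cu 2 2] by (simp add: abs_u)
  then show "A.P1 = abs_Uq (sc (cu ^ 4) * adP1)"
    by (simp add: adP1_def abs_Uq_hom S_def abs_adD right_diff_distrib U.s_pull[unfolded S_def, of "abs_Uq (sc (qpow 2))"] del: U.a.simps adD.simps)
qed

lemma low_sc: "low n f \<Longrightarrow> c \<noteq> 0 \<Longrightarrow> low n (act (sc c) f)"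
  by (auto simp: low_def act_sc)

lemma nonvanishing: A.nonvanishing
  unfolding A.nonvanishing_def
proof (intro allI impI)
  fix c i j k l
  assume 0: "S c * (A.P1 ^ i * (abs_Uq (u 2) ^ j * (abs_Uq (u 1) ^ k * A.P0 ^ l))) = 0"
  let ?p1 = "sc (cu ^ 4) * adP1" and ?p0 = "sc (cu ^ 2) * adP0"
    and ?u1 = "sc (cu ^ 1) * adD 1" and ?u2 = "sc (cu ^ 2) * adD 2"
  let ?X = "?p1 ^ i * (?u2 ^ j * (?u1 ^ k * ?p0 ^ l))"
  have e: "abs_Uq (u 1) = abs_Uq ?u1" "abs_Uq (u 2) = abs_Uq ?u2" by (rule abs_u_adD; simp)+
  have "abs_Uq (sc c * ?X) = 0"
    using 0 unfolding abs_P unfolding e by (simp only: abs_Uq_hom abs_Uq_power S_def)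
  then have I: "sc c * ?X \<in> Ideal" by (simp add: abs_Uq_eq_0)
  \<comment> \<open>The indicator of the row j = 0. Factors u1 and u2 keep the lowest row of a
    vector and factors \<open>P0\<close> and \<open>P1\<close> raise it by one, so no product of
    them kills f.\<close>
  define f :: vec where "f i j = (if j = 0 then 1 else 0)" for i j
  have f: "low 0 f" by (auto simp: low_def f_def)
  have cz: "cu ^ m \<noteq> 0" for m using cu_nz by simp
  have s: "\<exists>m. low m (act ?p1 f)" "\<exists>m. low m (act ?p0 f)" "\<exists>m. low m (act ?u1 f)" "\<exists>m. low m (act ?u2 f)" if "low n f" for n f
    unfolding act_mult
    using low_sc[OF low_P(2)[OF that]] low_sc[OF low_P(1)[OF that]] low_sc[OF low_adD[OF that]] cz by blast+
  obtain n1 where 1: "low n1 (act (?p0 ^ l) f)" using low_act_power[of ?p0] s(2) f by blast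
  obtain n2 where 2: "low n2 (act (?u1 ^ k) (act (?p0 ^ l) f))" using low_act_power[of ?u1] s(3) 1 by blast
  obtain n3 where 3: "low n3 (act (?u2 ^ j) (act (?u1 ^ k) (act (?p0 ^ l) f)))" using low_act_power[of ?u2] s(4) 2 by blast
  obtain n4 where 4: "low n4 (act (?p1 ^ i) (act (?u2 ^ j) (act (?u1 ^ k) (act (?p0 ^ l) f))))" using low_act_power[of ?p1] s(1) 3 by blast
  then obtain i0 where "act ?X f i0 n4 \<noteq> 0" by (auto simp: low_def act_mult)
  moreover have "c * act ?X f i0 n4 = 0" using act_Ideal[OF I, of f i0 n4] by (simp add: act_mult[of "sc c"] act_sc)
  ultimately show "c = 0" by simp
qed

section \<open>Bar-invariance through the ring of mirrored pairs\<close>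

declare One_nat_def [simp del]

text \<open>The second component multiplies in the opposite order, as for an anti-automorphism:
  pairs (X, \<open>sigma\<close> X) are closed under the ring operations.\<close>

datatype 'a bi = Bi 'a 'a

instantiation bi :: (ring_1) ring_1
begin

definition "0 = Bi 0 0"
definition "1 = Bi 1 1"
fun plus_bi where "Bi a b + Bi c d = Bi (a + c) (b + d)"
fun minus_bi where "Bi a b - Bi c d = Bi (a - c) (b - d)"
fun uminus_bi where "- Bi a b = Bi (- a) (- b)"
fun times_bi where "Bi a b * Bi c d = Bi (a * c) (d * b)"

instance
proof
  fix a b c :: "'a bi"
  show "a + b + c = a + (b + c)" "a * b * c = a * (b * c)" "(a + b) * c = a * c + b * c" "a * (b + c) = a * b + a * c"
    by (cases a; cases b; cases c; simp add: algebra_simps)+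
  show "a + b = b + a" "a - b = a + - b" by (cases a; cases b; simp)+
  show "0 + a = a" "- a + a = 0" "1 * a = a" "a * 1 = a"
    by (cases a; simp add: zero_bi_def one_bi_def)+
qed (simp add: zero_bi_def one_bi_def)

end

abbreviation "uu k \<equiv> abs_Uq (u k)"
abbreviation "qS m \<equiv> S (qpow m)"

text \<open>The six relations survive reversal with q inverted and u_k scaled by q^(2k). Every
  identity and every lattice statement of \<open>kron\<close> thereby holds for an element and its
  mirror simultaneously.\<close>

interpretation D: kron "\<lambda>m. Bi (qS m) (qS (- m))" "Bi (uu 0) (uu 0)" "Bi (uu 1) (qS 2 * uu 1)"
  "Bi (uu 2) (qS 4 * uu 2)" "Bi (uu 3) (qS 6 * uu 3)"
proof
  show "Bi (qS m) (qS (- m)) * x = x * Bi (qS m) (qS (- m))" for m x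
    by (cases x) (simp add: U.s_comm[of "qpow m"] U.s_comm[of "qpow (- m)"])
qed (simp_all add: one_bi_def U.qp_norm A.straighten algebra_simps)

lemma Bi_power: "Bi a b ^ n = Bi (a ^ n) (b ^ n)"
  by (induction n) (simp_all add: one_bi_def power_commutes)

lemma D_P0: "D.P0 = Bi A.P0 (qS 2 * A.P0)"
  by (simp add: D.P0_def A.P0_def U.qp_norm A.straighten algebra_simps)
lemma D_P1: "D.P1 = Bi A.P1 (qS 6 * A.P1)"
  by (simp add: D.P1_def A.P1_def U.qp_norm A.straighten algebra_simps)
lemma D_Z: "D.Z = Bi A.Z (qS 4 * A.Z)"
  by (simp add: D.Z_def A.Z_def U.qp_norm A.straighten algebra_simps)
lemma D_r: "D.r = Bi A.r (qS 8 * A.r)"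
  by (simp add: D.r_def A.r_def D_P0 D_P1 A.P1_P0 U.qp_norm)

text \<open>\<open>Z\<close> and \<open>r\<close> commute, so reversal changes only scalars; the
  mirror weights q^4 of \<open>Z\<close> and q^8 of \<open>r\<close> fit together because
  \<open>r\<close> counts as degree two.\<close>

lemma D_cheb: "D.cheb (Suc n) = Bi (A.cheb (Suc n)) (qS (4 * int n) * A.cheb (Suc n)) \<and> D.cheb 0 = Bi 0 0"
proof (induction n rule: less_induct)
  case (less n)
  consider "n = 0" | "n = Suc 0" | m where "n = Suc (Suc m)"
    by (metis not0_implies_Suc)
  then show ?case
  proof cases
    case 1
    then show ?thesis by (simp add: one_bi_def zero_bi_def)
  next
    case 2
    then show ?thesis by (simp add: one_bi_def zero_bi_def D_Z D_r)
  next
    case 3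
    have 1: "D.cheb (Suc (Suc m)) = Bi (A.cheb (Suc (Suc m))) (qS (4 * int m + 4) * A.cheb (Suc (Suc m)))"
      and 2: "D.cheb (Suc m) = Bi (A.cheb (Suc m)) (qS (4 * int m) * A.cheb (Suc m))"
      using less[of "Suc m"] less[of m] 3 by (simp_all add: algebra_simps)
    have "D.cheb (Suc (Suc (Suc m))) = D.Z * D.cheb (Suc (Suc m)) - D.r * D.cheb (Suc m)" by (rule D.cheb.simps)
    also have "\<dots> = Bi (A.cheb (Suc n)) (qS (4 * int n) * A.cheb (Suc n))"
      unfolding 1 2 3 A.cheb.simps(3)[of "Suc m"] D_Z D_r
      by (simp add: U.qp_norm A.cheb_Z A.cheb_r algebra_simps del: A.cheb.simps)
    finally show ?thesis using 3 less[of 0] by (simp add: zero_bi_def)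
  qed
qed

lemma D_SS: "D.SS n = Bi (A.SS n) (qS (- Nexp (n, 0, 0, n)) * A.SS n)"
  using D_cheb[of n]
  by (simp add: D.SS_def A.SS_def U.qp_norm del: A.cheb.simps D.cheb.simps)

text \<open>Reversal turns \<open>xx\<close> into \<open>yy\<close>, and \<open>xx_yy\<close> turns
  it back at the cost of q^(-2n).\<close>

lemma D_XX: "D.XX n = Bi (A.XX n) (qS (- Nexp (n + 1, 0, 0, n)) * A.XX n)"
proof -
  have c0: "D.cheb n = Bi (A.cheb n) (qS (4 * int n - 4) * A.cheb n)"
    using D_cheb[of "n - 1"] by (cases n) (simp_all add: algebra_simps del: A.cheb.simps(3) D.cheb.simps(3))
  have c1: "D.cheb (Suc n) = Bi (A.cheb (Suc n)) (qS (4 * int n) * A.cheb (Suc n))" using D_cheb by blast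
  have "D.xx n = Bi (A.xx n) (qS (4 * int n + 6) * A.yy n)"
    unfolding D.xx_def A.xx_def A.yy_def c0 c1 D_P1
    by (simp add: U.qp_norm algebra_simps A.P1_comm(1) del: A.cheb.simps)
  also have "A.yy n = qS (- 2 * int n) * A.xx n"
    unfolding A.xx_yy by (simp add: U.qp_norm)
  finally show ?thesis unfolding D.XX_def A.XX_def
    by (simp add: U.qp_norm) (rule U.qp_cong; simp add: algebra_simps power2_eq_square)
qed

lemma D_EE: "D.EE n m x y = Bi (A.EE n m x y) (A.RE n m x y)"
proof -
  have p: "(qS e * z) ^ k = qS (e * int k) * z ^ k" for e z k
  proof (induction k)
    case (Suc k)
    then show ?case by (simp add: U.qp_norm algebra_simps)
  qed simp
  show ?thesis unfolding D.EE_def A.EE_def A.RE_def D.pbw_def A.pbw_def A.rpbw_def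
    by (simp add: Bi_power p U.qp_norm del: bexp.simps) (rule U.qp_cong; simp add: algebra_simps)
qed

section \<open>The dual canonical basis elements\<close>

lemma of_int_Fract: "of_int k = Fract [:of_int k:] (1::rat poly)"
proof -
  have n: "of_nat n = Fract [:of_nat n:] (1::rat poly)" for n
    by (metis of_nat_fract of_nat_poly)
  show ?thesis
  proof (cases k)
    case (nonneg n) then show ?thesis using n by simp
  next
    case (neg n)
    have "- Fract [:of_nat (Suc n):] (1::rat poly) = Fract [:- of_nat (Suc n):] 1" by simp
    then show ?thesis unfolding neg using n[of "Suc n"] by (simp del: of_nat_Suc)
  qed
qed

text \<open>Evaluation at q is the embedding of polynomials into fractions, and so is
  injective.\<close>

lemma evq_Fract: "evq c = Fract (map_poly of_int c) 1"
proof (induction c)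
  case 0 show ?case by (simp add: evq_def Zero_fract_def)
next
  case (pCons a c)
  have "evq (pCons a c) = of_int a + qq * evq c"
    by (simp add: evq_def map_poly_pCons)
  also have "\<dots> = Fract (map_poly of_int (pCons a c)) 1"
    unfolding pCons.IH of_int_Fract qq_def by (simp add: map_poly_pCons)
  finally show ?case .
qed

lemma evq_sum: "evq c = (\<Sum>i\<le>n. of_int (coeff c i) * qq ^ i)" "evqbar c = (\<Sum>i\<le>n. of_int (coeff c i) * inverse qq ^ i)"
  if "degree c \<le> n"
proof -
  have d: "degree (map_poly (of_int :: int \<Rightarrow> K) c) \<le> n"
    by (rule degree_le) (use that in \<open>auto simp: coeff_map_poly coeff_eq_0\<close>)
  have "poly (map_poly of_int c) z = (\<Sum>i\<le>n. of_int (coeff c i) * z ^ i)" for z :: K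
  proof -
    have "poly (map_poly of_int c) z = (\<Sum>i\<le>degree (map_poly (of_int :: int \<Rightarrow> K) c). coeff (map_poly of_int c) i * z ^ i)"
      by (rule poly_altdef)
    also have "\<dots> = (\<Sum>i\<le>n. coeff (map_poly of_int c) i * z ^ i)"
      using d by (intro sum.mono_neutral_left) (auto simp: coeff_eq_0)
    finally show ?thesis by (simp add: coeff_map_poly)
  qed
  then show "evq c = (\<Sum>i\<le>n. of_int (coeff c i) * qq ^ i)" "evqbar c = (\<Sum>i\<le>n. of_int (coeff c i) * inverse qq ^ i)"
    by (simp_all only: evq_def evqbar_def)
qed

lemma evq_add: "evq (b + c) = evq b + evq c" and evqbar_add: "evqbar (b + c) = evqbar b + evqbar c"
  using evq_sum[of "b + c" "max (degree b) (degree c)"] evq_sum[of b "max (degree b) (degree c)"] evq_sum[of c "max (degree b) (degree c)"]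
  by (simp_all add: degree_add_le_max distrib_right sum.distrib)

lemma evq_0 [simp]: "evq 0 = 0" and evqbar_0 [simp]: "evqbar 0 = 0"
  by (simp_all add: evq_def evqbar_def)

lemma evq_1 [simp]: "evq 1 = 1" and evqbar_1 [simp]: "evqbar 1 = 1"
  by (simp_all add: evq_def evqbar_def)

lemma evq_minus: "evq (- c) = - evq c" and evqbar_minus: "evqbar (- c) = - evqbar c"
  using evq_add[of c "- c"] evqbar_add[of c "- c"] by (simp_all add: eq_neg_iff_add_eq_0 add.commute)

lemma evq_diff: "evq (b - c) = evq b - evq c" and evqbar_diff: "evqbar (b - c) = evqbar b - evqbar c"
  using evq_add[of b "- c"] evqbar_add[of b "- c"] by (simp_all add: evq_minus evqbar_minus)

lemma evq_monom: "evq (monom 1 n) = qpow (int n)" and evqbar_monom: "evqbar (monom 1 n) = qpow (- int n)"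
  by (simp_all add: evq_def evqbar_def map_poly_monom poly_monom qpow_def power_int_minus power_inverse)

lemma evq_inj: assumes "evq c = 0" shows "c = 0"
proof -
  have "map_poly of_int c = (0::rat poly)"
    using assms unfolding evq_Fract by (simp add: Zero_fract_def eq_fract)
  then have "coeff (map_poly of_int c :: rat poly) i = 0" for i by simp
  then show ?thesis by (intro poly_eqI) (simp add: coeff_map_poly)
qed

text \<open>Multiply by q^n, n being the degree: the left side becomes a polynomial of degree 2n,
  the right side the reversed polynomial, of degree at most n. The vanishing constant term makes n
  positive, a contradiction.\<close>

lemma evq_self_conj:
  assumes "evq c = evqbar c" "coeff c 0 = 0"
  shows "c = 0"
proof (rule ccontr)
  assume c: "c \<noteq> 0"
  define n where "n = degree c"
  have n: "n > 0" using assms(2) c unfolding n_def by (metis leading_coeff_0_iff neq0_conv)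
  define r where "r = (\<Sum>i\<le>n. monom (coeff c i) (n - i))"
  have em: "evq (monom a k) = of_int a * qq ^ k" for a k
    by (simp add: evq_def map_poly_monom poly_monom)
  have es: "evq (sum h I) = (\<Sum>i\<in>I. evq (h i))" for h and I :: "nat set"
    by (induction I rule: infinite_finite_induct) (simp_all add: evq_add)
  have "evq (monom 1 n * c) = qq ^ n * evq c"
  proof -
    have "map_poly (of_int :: int \<Rightarrow> rat) (monom 1 n * c) = monom 1 n * map_poly of_int c"
      by (rule poly_eqI) (simp add: coeff_map_poly coeff_monom_mult)
    then show ?thesis unfolding evq_Fract qq_power by simp
  qed
  also have "\<dots> = qq ^ n * evqbar c" unfolding assms(1) ..
  also have "\<dots> = evq r"
    unfolding r_def es em evq_sum(2)[OF order_refl, of c, folded n_def] sum_distrib_left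
  proof (rule sum.cong[OF refl])
    fix i assume "i \<in> {..n}"
    then have "qq ^ n = qq ^ (n - i) * qq ^ i" by (simp add: power_add[symmetric])
    then show "qq ^ n * (of_int (coeff c i) * inverse qq ^ i) = of_int (coeff c i) * qq ^ (n - i)"
      using qq_nz by (simp add: power_inverse)
  qed
  finally have "evq (monom 1 n * c - r) = 0" by (simp add: evq_diff)
  then have "monom 1 n * c = r" using evq_inj by fastforce
  then have "coeff (monom 1 n * c) (n + n) = coeff r (n + n)" by simp
  moreover have "coeff r (n + n) = 0"
    using n by (auto simp: r_def coeff_sum coeff_monom intro!: sum.neutral)
  ultimately have "coeff c n = 0" by (simp add: coeff_monom_mult)
  then show False using c by (simp add: n_def)
qed

definition Ev :: "int poly \<Rightarrow> Uq bi" where "Ev c = Bi (S (evq c)) (S (evqbar c))"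

lemma Ev_add: "Ev (b + c) = Ev b + Ev c" and Ev_diff: "Ev (b - c) = Ev b - Ev c" and Ev_0: "Ev 0 = 0" and Ev_1: "Ev 1 = 1"
  by (simp_all add: Ev_def evq_add evqbar_add evq_diff evqbar_diff U.s_add U.s_diff U.s_0 zero_bi_def one_bi_def)

lemma Ev_monom: "Ev (monom 1 n) = Bi (qS (int n)) (qS (- int n))"
  by (simp add: Ev_def evq_monom evqbar_monom)

lemma Ev_if: "Ev (if P then b else 0) = (if P then Ev b else 0)"
  by (simp add: Ev_0)

definition coefs :: "(nat \<Rightarrow> nat \<Rightarrow> int poly) \<Rightarrow> bool" where
  "coefs c \<longleftrightarrow> (\<forall>x y. coeff (c x y) 0 = 0) \<and> c 0 0 = 0"

text \<open>A power q^e in the pair ring is (q^e, q^-e), so a single integral polynomial serves as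
  coefficient in the first component and as its conjugate in the second.\<close>

lemma lat_coefs:
  assumes "X \<in> D.lat n m"
  shows "\<exists>c. coefs c \<and> X = (\<Sum>(x, y)\<in>idx n m. Ev (c x y) * D.EE n m x y)"
  using assms
proof (induction rule: D.lat.induct)
  case zero
  show ?case by (intro exI[of _ "\<lambda>_ _. 0"]) (simp add: coefs_def Ev_0)
next
  case (gen x y e)
  define c where "c x' y' = (if (x', y') = (x, y) then monom 1 (Suc e) else 0 :: int poly)" for x' y'
  have "coefs c" using gen(2) by (auto simp: coefs_def c_def)
  moreover have "(\<Sum>(x', y')\<in>idx n m. Ev (c x' y') * D.EE n m x' y')
     = (\<Sum>p\<in>idx n m. if p = (x, y) then Ev (monom 1 (Suc e)) * D.EE n m x y else 0)"
    by (rule sum.cong) (auto simp: c_def Ev_if split: if_splits)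
  ultimately show ?case using gen(1) by (intro exI[of _ c]) (simp add: Ev_monom del: of_nat_Suc)
next
  case (diff X Y)
  then obtain b c where "coefs b" "X = (\<Sum>(x, y)\<in>idx n m. Ev (b x y) * D.EE n m x y)"
    "coefs c" "Y = (\<Sum>(x, y)\<in>idx n m. Ev (c x y) * D.EE n m x y)" by blast
  then show ?case
    by (intro exI[of _ "\<lambda>x y. b x y - c x y"])
      (simp add: coefs_def Ev_diff left_diff_distrib case_prod_unfold sum_subtractf)
qed

lemma lat_expansion:
  assumes "Bi X X' - D.EE n m 0 0 \<in> D.lat n m"
  shows "\<exists>c. c 0 0 = 1 \<and> (\<forall>x y. (x, y) \<noteq> (0, 0) \<longrightarrow> coeff (c x y) 0 = 0)
    \<and> X = (\<Sum>(x, y)\<in>idx n m. S (evq (c x y)) * A.EE n m x y)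
    \<and> X' = (\<Sum>(x, y)\<in>idx n m. S (evqbar (c x y)) * A.RE n m x y)"
proof -
  obtain c where c: "coefs c" "Bi X X' - D.EE n m 0 0 = (\<Sum>(x, y)\<in>idx n m. Ev (c x y) * D.EE n m x y)"
    using lat_coefs[OF assms] by blast
  define c' where "c' x y = c x y + (if (x, y) = (0, 0) then 1 else 0)" for x y
  have "Bi X X' = (\<Sum>(x, y)\<in>idx n m. Ev (c x y) * D.EE n m x y) + D.EE n m 0 0"
    unfolding c(2)[symmetric] by (simp only: diff_add_cancel)
  also have "D.EE n m 0 0 = (\<Sum>p\<in>idx n m. if p = (0, 0) then D.EE n m 0 0 else 0)"
    by (simp add: D.zero_idx)
  also have "(\<Sum>(x, y)\<in>idx n m. Ev (c x y) * D.EE n m x y) + \<dots> = (\<Sum>(x, y)\<in>idx n m. Ev (c' x y) * D.EE n m x y)"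
    unfolding sum.distrib[symmetric] by (rule sum.cong) (auto simp: c'_def Ev_add Ev_if Ev_1 distrib_right split: if_splits)
  finally have X: "Bi X X' = (\<Sum>(x, y)\<in>idx n m. Ev (c' x y) * D.EE n m x y)" .
  have z: "Ev b * D.EE n m x y = Bi (S (evq b) * A.EE n m x y) (S (evqbar b) * A.RE n m x y)" for b x y
    by (simp add: Ev_def D_EE U.s_comm[of "evqbar b"])
  have "(\<Sum>p\<in>I. Bi (h p) (h' p)) = Bi (\<Sum>p\<in>I. h p) (\<Sum>p\<in>I. h' p)" for h h' :: "nat \<times> nat \<Rightarrow> Uq" and I
    by (induction I rule: infinite_finite_induct) (simp_all add: zero_bi_def)
  then have "Bi X X' = Bi (\<Sum>(x, y)\<in>idx n m. S (evq (c' x y)) * A.EE n m x y) (\<Sum>(x, y)\<in>idx n m. S (evqbar (c' x y)) * A.RE n m x y)"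
    unfolding X z by (simp add: case_prod_unfold)
  then show ?thesis using c(1) by (intro exI[of _ c']) (auto simp: coefs_def c'_def)
qed

fun iota :: "nat \<Rightarrow> nat \<Rightarrow> nat \<times> nat \<Rightarrow> exps" where
  "iota n m (x, y) = (n - x, 2 * x - y, 2 * y - x, m - y)"

lemma iota_image: "insert (n, 0, 0, m) (Sset (n, 0, 0, m)) = iota n m ` idx n m"
proof (intro set_eqI iffI)
  fix b assume b: "b \<in> insert (n, 0, 0, m) (Sset (n, 0, 0, m))"
  obtain b3 b2 b1 b0 where bb: "b = (b3, b2, b1, b0)" by (cases b) auto
  have "\<exists>x y :: nat. int b3 = int n - int x \<and> int b2 = 2 * int x - int y \<and> int b1 = 2 * int y - int x \<and> int b0 = int m - int y"
  proof (cases "b = (n, 0, 0, m)")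
    case True
    then show ?thesis using bb by (intro exI[of _ 0]) simp
  next
    case False
    then have "tri (n, 0, 0, m) b" using b by (simp add: Sset_def)
    then obtain x y :: nat where "int b3 = int n - int x" "int b2 = int 0 + 2 * int x - int y" "int b1 = int 0 - int x + 2 * int y" "int b0 = int m - int y"
      unfolding bb tri.simps by blast
    then show ?thesis by (intro exI[of _ x] exI[of _ y]) simp
  qed
  then obtain x y :: nat where "int b3 = int n - int x" "int b2 = 2 * int x - int y" "int b1 = 2 * int y - int x" "int b0 = int m - int y" by blast
  then have "(x, y) \<in> idx n m" "b = iota n m (x, y)" unfolding bb by (auto simp: idx_def)
  then show "b \<in> iota n m ` idx n m" by blast
next
  fix b assume "b \<in> iota n m ` idx n m"
  then obtain x y where xy: "(x, y) \<in> idx n m" "b = iota n m (x, y)" by auto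
  then have "tri (n, 0, 0, m) b"
    by (simp add: idx_def of_nat_diff)
  then show "b \<in> insert (n, 0, 0, m) (Sset (n, 0, 0, m))" by (auto simp: Sset_def)
qed

lemma iota_inj: "inj_on (iota n m) (idx n m)"
  by (rule inj_onI) (auto simp: idx_def)

lemma abs_PBW: "abs_Uq (PBW (iota n m (x, y))) = A.EE n m x y"
  by (simp add: A.EE_def A.pbw_def abs_Uq_hom abs_Uq_power S_def[symmetric] mult.assoc del: bexp.simps)

lemma abs_sigmaPBW: "abs_Uq (sigmaPBW (iota n m (x, y))) = A.RE n m x y"
proof -
  have p: "(qS e * z) ^ k = qS (e * int k) * z ^ k" for e z k
  proof (induction k)
    case (Suc k)
    then show ?case by (simp add: U.qp_norm algebra_simps)
  qed simp
  show ?thesis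
    by (simp add: A.RE_def A.rpbw_def abs_Uq_hom abs_Uq_power S_def[symmetric] p U.qp_norm del: bexp.simps)
      (rule U.qp_cong; simp add: algebra_simps)
qed

lemma abs_sum_iota:
  "abs_Uq (\<Sum>b\<in>insert (n, 0, 0, m) (Sset (n, 0, 0, m)). sc (h b) * PBW b) = (\<Sum>(x, y)\<in>idx n m. S (h (iota n m (x, y))) * A.EE n m x y)"
  "abs_Uq (\<Sum>b\<in>insert (n, 0, 0, m) (Sset (n, 0, 0, m)). sc (h b) * sigmaPBW b) = (\<Sum>(x, y)\<in>idx n m. S (h (iota n m (x, y))) * A.RE n m x y)"
  unfolding iota_image sum.reindex[OF iota_inj] abs_Uq_sum
  by (rule sum.cong; auto simp: abs_Uq_hom abs_PBW abs_sigmaPBW S_def[symmetric] simp del: iota.simps PBW.simps sigmaPBW.simps)+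

text \<open>\<open>B a\<close> rests on a choice, so two things are shown: \<open>c\<close> provides
  an admissible family, and its difference from the chosen family is invariant with coefficients in
  q Z[q], hence zero by \<open>bar_invariant_eq_0\<close>.\<close>

lemma dcb_unique:
  fixes n m c
  defines "a \<equiv> (n, 0, 0, m)"
  assumes c: "c 0 0 = 1" "\<And>x y. (x, y) \<noteq> (0, 0) \<Longrightarrow> coeff (c x y) 0 = 0"
    and X: "X = (\<Sum>(x, y)\<in>idx n m. S (evq (c x y)) * A.EE n m x y)"
    and X': "qS (- Nexp a) * X = (\<Sum>(x, y)\<in>idx n m. S (evqbar (c x y)) * A.RE n m x y)"
  shows "abs_Uq (B a) = X"
proof -
  \<comment> \<open>The outer entries alone recover the index: x = n - b3 and y = m - b0.\<close>
  define c1 where "c1 b = (if b \<in> insert a (Sset a) then case b of (b3, b2, b1, b0) \<Rightarrow> c (n - b3) (m - b0) else 0)" for b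
  have c1: "c1 (iota n m (x, y)) = c x y" if "(x, y) \<in> idx n m" for x y
  proof -
    have "iota n m (x, y) \<in> insert a (Sset a)" unfolding a_def iota_image using that by (rule imageI)
    then have "c1 (iota n m (x, y)) = (case iota n m (x, y) of (b3, b2, b1, b0) \<Rightarrow> c (n - b3) (m - b0))"
      by (simp add: c1_def)
    then show ?thesis using that by (auto simp: idx_def)
  qed
  have "dcb_coeffs a c1"
    unfolding dcb_coeffs_def
  proof (intro conjI ballI allI impI)
    show "c1 a = 1" using c1[of 0 0] c(1) by (simp add: a_def idx_def)
    show "coeff (c1 b) 0 = 0" if b: "b \<in> Sset a" for b
    proof -
      have "b \<in> iota n m ` idx n m" unfolding iota_image[symmetric] using b by (simp add: a_def)
      then obtain x y where xy: "(x, y) \<in> idx n m" "b = iota n m (x, y)" by auto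
      then have "(x, y) \<noteq> (0, 0)" using b by (auto simp: Sset_def a_def)
      then show ?thesis using xy c1 c(2) by simp
    qed
    show "c1 b = 0" if "b \<notin> insert a (Sset a)" for b using that by (simp add: c1_def)
    show "(\<Sum>b\<in>insert a (Sset a). sc (evqbar (c1 b)) * sigmaPBW b) \<simeq> sc (qpow (- Nexp a)) * (\<Sum>b\<in>insert a (Sset a). sc (evq (c1 b)) * PBW b)"
    proof -
      have 1: "(\<Sum>(x, y)\<in>idx n m. S (evqbar (c1 (iota n m (x, y)))) * A.RE n m x y) = (\<Sum>(x, y)\<in>idx n m. S (evqbar (c x y)) * A.RE n m x y)"
        and 2: "(\<Sum>(x, y)\<in>idx n m. S (evq (c1 (iota n m (x, y)))) * A.EE n m x y) = (\<Sum>(x, y)\<in>idx n m. S (evq (c x y)) * A.EE n m x y)"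
        by (rule sum.cong; auto simp: c1 simp del: iota.simps)+
      show ?thesis
        unfolding abs_Uq_eq[symmetric] abs_Uq_hom(3) a_def abs_sum_iota S_def[symmetric] 1 2
        using X' unfolding X a_def by (rule sym)
    qed
  qed
  define c0 where "c0 = (SOME c. dcb_coeffs a c)"
  have c0: "dcb_coeffs a c0" unfolding c0_def by (rule someI[of "dcb_coeffs a", OF \<open>dcb_coeffs a c1\<close>])
  define e where "e x y = (if (x, y) \<in> idx n m then c0 (iota n m (x, y)) - c x y else 0)" for x y
  have e0: "coeff (e x y) 0 = 0" for x y
  proof (cases "(x, y) \<in> idx n m \<and> (x, y) \<noteq> (0, 0)")
    case True
    then have "iota n m (x, y) \<in> insert a (Sset a)" unfolding a_def iota_image by blast
    moreover have "iota n m (x, y) \<noteq> a"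
      using True inj_onD[OF iota_inj, of n m "(x, y)" "(0, 0)"] by (auto simp: a_def idx_def)
    ultimately have "coeff (c0 (iota n m (x, y))) 0 = 0" using c0 unfolding dcb_coeffs_def by blast
    then show ?thesis using True c(2) by (simp add: e_def)
  next
    case False
    \<comment> \<open>At (0, 0) both families have coefficient 1, so the difference has zero
      constant term there as well.\<close>
    have "c0 (iota n m (0, 0)) = 1" using c0 by (simp add: dcb_coeffs_def a_def)
    then show ?thesis using False c(1) by (auto simp: e_def)
  qed
  have inv0: "(\<Sum>(x, y)\<in>idx n m. S (evqbar (c0 (iota n m (x, y)))) * A.RE n m x y)
      = qS (- Nexp a) * (\<Sum>(x, y)\<in>idx n m. S (evq (c0 (iota n m (x, y)))) * A.EE n m x y)"
    using c0 unfolding dcb_coeffs_def abs_Uq_eq[symmetric] abs_Uq_hom(3) a_def abs_sum_iota S_def[symmetric] by blast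
  have "(\<Sum>(x, y)\<in>idx n m. S (evqbar (e x y)) * A.RE n m x y) = qS (- Nexp a) * (\<Sum>(x, y)\<in>idx n m. S (evq (e x y)) * A.EE n m x y)"
  proof -
    have 1: "(\<Sum>(x, y)\<in>idx n m. S (evqbar (e x y)) * A.RE n m x y)
       = (\<Sum>(x, y)\<in>idx n m. S (evqbar (c0 (iota n m (x, y)))) * A.RE n m x y) - (\<Sum>(x, y)\<in>idx n m. S (evqbar (c x y)) * A.RE n m x y)"
      unfolding sum_subtractf[symmetric] by (rule sum.cong) (auto simp: e_def evqbar_diff U.s_diff left_diff_distrib simp del: iota.simps)
    have 2: "(\<Sum>(x, y)\<in>idx n m. S (evq (e x y)) * A.EE n m x y)
       = (\<Sum>(x, y)\<in>idx n m. S (evq (c0 (iota n m (x, y)))) * A.EE n m x y) - (\<Sum>(x, y)\<in>idx n m. S (evq (c x y)) * A.EE n m x y)"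
      unfolding sum_subtractf[symmetric] by (rule sum.cong) (auto simp: e_def evq_diff U.s_diff left_diff_distrib simp del: iota.simps)
    show ?thesis unfolding 1 2 right_diff_distrib inv0 X'[symmetric] X ..
  qed
  then have "evq (e x y) = 0" if "(x, y) \<in> idx n m" for x y
    unfolding a_def
  proof (rule A.bar_invariant_eq_0[OF nonvanishing _ _ _ that, where d' = "\<lambda>x y. evqbar (e x y)" and d = "\<lambda>x y. evq (e x y)"])
    show "evqbar (e x y) = evq (e x y) \<Longrightarrow> evq (e x y) = 0" for x y
      using evq_self_conj[of "e x y"] e0[of x y] by simp
    show "evq (e x y) = 0 \<Longrightarrow> evqbar (e x y) = 0" for x y
      using evq_inj[of "e x y"] by auto
  qed
  then have eq: "evq (c0 (iota n m (x, y))) = evq (c x y)" if "(x, y) \<in> idx n m" for x y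
    using that by (simp add: e_def evq_diff)
  have "abs_Uq (B a) = (\<Sum>(x, y)\<in>idx n m. S (evq (c0 (iota n m (x, y)))) * A.EE n m x y)"
  proof -
    have "B a = (\<Sum>b\<in>insert a (Sset a). sc (evq (c0 b)) * PBW b)" by (simp only: B_def c0_def)
    then show ?thesis unfolding a_def by (simp only: abs_sum_iota(1))
  qed
  also have "\<dots> = X" unfolding X by (rule sum.cong) (auto simp: eq simp del: iota.simps)
  finally show ?thesis .
qed

lemma abs_B: "abs_Uq (B (n, 0, 0, n)) = A.SS n" "abs_Uq (B (n + 1, 0, 0, n)) = A.XX n"
proof -
  have "Bi (A.SS n) (qS (- Nexp (n, 0, 0, n)) * A.SS n) - D.EE n n 0 0 \<in> D.lat n n"
    using D.SS_XX_lat[of n] unfolding D_SS by blast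
  from lat_expansion[OF this] show "abs_Uq (B (n, 0, 0, n)) = A.SS n"
    using dcb_unique by blast
  have "Bi (A.XX n) (qS (- Nexp (n + 1, 0, 0, n)) * A.XX n) - D.EE (n + 1) n 0 0 \<in> D.lat (n + 1) n"
    using D.SS_XX_lat[of n] unfolding D_XX Suc_eq_plus1 by blast
  from lat_expansion[OF this] show "abs_Uq (B (n + 1, 0, 0, n)) = A.XX n"
    using dcb_unique by blast
qed

lemma abs_p: "abs_Uq p0 = A.P0" "abs_Uq p1 = A.P1"
  by (simp_all add: p0_def p1_def A.P0_def A.P1_def abs_Uq_hom S_def[symmetric] power2_eq_square)

text \<open>Shrinks the rectangular sum of \<open>comb\<close> to the index set of the theorem,
  outside of which the coefficients vanish by \<open>cX_out\<close> and
  \<open>cS_out\<close>.\<close>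

lemma comb_region:
  assumes "R \<subseteq> {..n} \<times> {..m}" "\<And>k l. k \<le> n \<Longrightarrow> l \<le> m \<Longrightarrow> (k, l) \<notin> R \<Longrightarrow> f k l = 0"
  shows "A.comb n m f = (\<Sum>(k, l)\<in>R. S (f k l) * A.MM n m k l)"
proof -
  have "A.comb n m f = (\<Sum>(k, l)\<in>{..n} \<times> {..m}. S (f k l) * A.MM n m k l)"
    by (simp add: A.comb_def sum.cartesian_product)
  also have "\<dots> = (\<Sum>(k, l)\<in>R. S (f k l) * A.MM n m k l)"
    using assms by (intro sum.mono_neutral_right) (auto simp: U.s_0)
  finally show ?thesis .
qed

theorem mainTheorem4:
  fixes n :: nat
  shows "u 2 ^ n * B (n + 1, 0, 0, n) * u 1 ^ (n + 1) \<simeq>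
           (\<Sum>(k, l)\<in>{(k, l). k + l \<le> n \<or> (k, l) = (n + 1, 0)}.
              sc (qpow (fexp n k l) * qbinom (int n - int k) l * qbinom (int n + 1 - int l) k)
              * p1 ^ (n + 1 - k) * u 2 ^ (2 * k) * u 1 ^ (2 * l) * p0 ^ (n - l))
       \<and> u 2 ^ n * B (n, 0, 0, n) * u 1 ^ n \<simeq>
           (\<Sum>(k, l)\<in>{(k, l). k + l \<le> n}.
              sc (qpow (gexp n k l) * qbinom (int n - int k) l * qbinom (int n - int l) k)
              * p1 ^ (n - k) * u 2 ^ (2 * k) * u 1 ^ (2 * l) * p0 ^ (n - l))" (is "?X \<simeq> ?X' \<and> ?S \<simeq> ?S'")
proof
  have "abs_Uq ?X = A.FX n"
    by (simp only: abs_Uq_hom abs_Uq_power abs_B A.FX_def mult.assoc Suc_eq_plus1)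
  also have "\<dots> = (\<Sum>(k, l)\<in>{(k, l). k + l \<le> n \<or> (k, l) = (n + 1, 0)}. S (cX n k l) * A.MM (n + 1) n k l)"
    unfolding A.FS_FX[THEN conjunct2] Suc_eq_plus1 using cX_out[of _ n] by (intro comb_region) auto
  also have "\<dots> = abs_Uq ?X'"
    unfolding abs_Uq_sum
    by (rule sum.cong) (auto simp: abs_Uq_hom abs_Uq_power abs_p cX_def A.MM_def S_def[symmetric] mult.assoc)
  finally show "?X \<simeq> ?X'" unfolding abs_Uq_eq .
  have "abs_Uq ?S = A.FS n"
    by (simp only: abs_Uq_hom abs_Uq_power abs_B A.FS_def mult.assoc)
  also have "\<dots> = (\<Sum>(k, l)\<in>{(k, l). k + l \<le> n}. S (cS n k l) * A.MM n n k l)"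
    unfolding A.FS_FX[THEN conjunct1] using cS_out[of _ n] by (intro comb_region) auto
  also have "\<dots> = abs_Uq ?S'"
    unfolding abs_Uq_sum
    by (rule sum.cong) (auto simp: abs_Uq_hom abs_Uq_power abs_p cS_def A.MM_def S_def[symmetric] mult.assoc)
  finally show "?S \<simeq> ?S'" unfolding abs_Uq_eq .
qed

end
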